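(* Consider the class of reduced surfaces $D:f=0$ of degree $d$ in $\mathbb{P}^3$ over $\mathbb{C}$, not cones over plane curves and with one-dimensional singular subscheme $\Sigma$, which are tame (with respect to some pair of syzygies $\rho_1,\rho_2$) with fixed degrees $e_1=\deg\rho_1\le e_2=\deg\rho_2$ satisfying $e_1+2e_2\le d-1$. In this class the free surface (if it exists) has a singular subscheme $\Sigma$ of maximal degree. More precisely, for any such tame surface $D$ one has $$\deg\Sigma\le s_1^2-s_2,$$ where $e_3=d-1-e_1-e_2$, $s_1=e_1+e_2+e_3$ and $s_2=e_1e_2+e_1e_3+e_2e_3$. Moreover, equality holds if and only if the surface $D$ is free.
   Context: Let $S=\mathbb{C}[x,y,z,w]$ with the standard grading, $f\in S$ homogeneous of degree $d$, with partial derivatives $f_x,f_y,f_z,f_w$, Jacobian ideal $J_f=(f_x,f_y,f_z,f_w)$ and Milnor algebra $M(f)=S/J_f$ (graded). The singular subscheme $\Sigma$ of $D:f=0$ is the subscheme of $\mathbb{P}^3$ defined by $J_f$. When $\dim\Sigma=1$, the Hilbert polynomial of $M(f)$ has the form $P(M(f))(k)=ak+b$ with $a\neq 0$, and $\deg\Sigma=a$. Syzygies: $AR(f)\subset S^4$ is the graded $S$-module of all $\rho=(\alpha,\beta,\gamma,\delta)$ with $\alpha f_x+\beta f_y+\gamma f_z+\delta f_w=0$; $AR(f)_q$ consists of those with all components in $S_q$, and such a $\rho$ has degree $q$. Choice of $\rho_1,\rho_2$: $\rho_1$ is a nonzero homogeneous element of minimal degree $e_1$ in $AR(f)$, and $\rho_2\in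 AR(f)$ is a homogeneous representative of a nonzero homogeneous element of minimal degree $e_2\ge e_1$ in $AR(f)/(S\rho_1)$. Tameness: let $\Omega^k$ be the $S$-module of algebraic differential $k$-forms on $\mathbb{C}^4$; for $\rho=(\alpha,\beta,\gamma,\delta)$ put $\omega(\rho)=\alpha\,dx+\beta\,dy+\gamma\,dz+\delta\,dw$, and let $\Omega^1_0=\{\omega(\rho):\rho\in AR(f)\}$. $D$ is tame with respect to $\rho_1,\rho_2$ (where $\rho_1$ is a nonzero element of minimal degree $e_1$ in $AR(f)$ and $\rho_2$ represents a nonzero homogeneous element of minimal degree $e_2$ in $AR(f)/(S\rho_1)$) if the sequence $S(-e_1-1)\oplus S(-e_2-1)\xrightarrow{u}\Omega^1_0\xrightarrow{v}\Omega^3(e_1+e_2+2)$ is exact (at the middle term), where $u(a,b)=a\,\omega(\rho_1)+b\,\omega(\rho_2)$ and $v(\omega)=\omega(\rho_1)\wedge\omega(\rho_2)\wedge\omega$. $D$ is tame if it is tame with respect to some such pair $\rho_1,\rho_2$. Freeness: $D$ is free (with exponents $d_1\le d_2\le d_3$) if $AR(f)\cong S(-d_1)\oplus S(-d_2)\oplus S(-d_3)$ as graded $S$-modules for some positive integers $d_1\le d_2\le d_3$. *)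

theory Defs
  imports
    "HOL-Analysis.Analysis"
    "HOL-Library.Poly_Mapping"
    "HOL-Computational_Algebra.Squarefree"
begin

section \<open>The graded ring \<open>S = \<complex>[x, y, z, w]\<close>\<close>

text \<open>The variables \<open>x, y, z, w\<close> are indexed by the four elements \<open>0, 1, 2, 3\<close> of the
  numeral type \<open>4\<close>; a polynomial maps exponent vectors to coefficients.\<close>

type_synonym poly4 = "(4 \<Rightarrow>\<^sub>0 nat) \<Rightarrow>\<^sub>0 complex"

definition var :: "4 \<Rightarrow> poly4" where
  "var i = Poly_Mapping.single (Poly_Mapping.single i 1) 1"

definition cscale :: "complex \<Rightarrow> poly4 \<Rightarrow> poly4" where
  "cscale c p = Poly_Mapping.single 0 c * p"

interpretation poly4: vector_space cscale
proof
  show "cscale a (x + y) = cscale a x + cscale a y" for a x y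
    by (simp add: cscale_def distrib_left)
  show "cscale (a + b) x = cscale a x + cscale b x" for a b x
    by (simp add: cscale_def distrib_right single_add)
  show "cscale a (cscale b x) = cscale (a * b) x" for a b x
    by (simp add: cscale_def mult.assoc[symmetric] mult_single)
  show "cscale 1 x = x" for x
    by (simp add: cscale_def)
qed

definition eval4 :: "poly4 \<Rightarrow> complex ^ 4 \<Rightarrow> complex" where
  "eval4 p v = (\<Sum>m\<in>Poly_Mapping.keys p.
     Poly_Mapping.lookup p m * (\<Prod>i\<in>UNIV. (v $ i) ^ Poly_Mapping.lookup m i))"

definition mdeg :: "(4 \<Rightarrow>\<^sub>0 nat) \<Rightarrow> nat" where
  "mdeg m = (\<Sum>i\<in>UNIV. Poly_Mapping.lookup m i)"

text \<open>\<open>hom_part q\<close> is \<open>S\<^sub>q\<close>; it contains \<open>0\<close>.\<close>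

definition hom_part :: "nat \<Rightarrow> poly4 set" where
  "hom_part q = {p. \<forall>m\<in>Poly_Mapping.keys p. mdeg m = q}"

definition hom_component :: "nat \<Rightarrow> poly4 \<Rightarrow> poly4" where
  "hom_component q p = (\<Sum>m\<in>{m \<in> Poly_Mapping.keys p. mdeg m = q}.
     Poly_Mapping.single m (Poly_Mapping.lookup p m))"

text \<open>In \<open>pdiff\<close> the truncated subtraction on exponents is harmless: if \<open>m\<close> does not involve
  the variable \<open>i\<close>, the coefficient vanishes.\<close>

definition pdiff :: "4 \<Rightarrow> poly4 \<Rightarrow> poly4" where
  "pdiff i p = (\<Sum>m\<in>Poly_Mapping.keys p.
     Poly_Mapping.single (m - Poly_Mapping.single i 1)
       (of_nat (Poly_Mapping.lookup m i) * Poly_Mapping.lookup p m))"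

definition is_ideal :: "poly4 set \<Rightarrow> bool" where
  "is_ideal I \<longleftrightarrow> 0 \<in> I \<and> (\<forall>p\<in>I. \<forall>q\<in>I. p + q \<in> I) \<and> (\<forall>p\<in>I. \<forall>a. a * p \<in> I)"

definition jacobian_ideal :: "poly4 \<Rightarrow> poly4 set" where
  "jacobian_ideal f = {\<Sum>i\<in>UNIV. a i * pdiff i f | a :: 4 \<Rightarrow> poly4. True}"


section \<open>Dimension and degree of the subscheme of \<open>\<bbbP>\<^sup>3\<close> defined by a homogeneous ideal\<close>

text \<open>\<open>proj_points I\<close> is the set of points of \<open>Proj (S/I)\<close>: the homogeneous primes of \<open>S\<close>
  that contain \<open>I\<close> but not the irrelevant ideal. Strict chains of such primes are, up to
  reversal, strict chains of irreducible closed subsets.\<close>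

definition proj_points :: "poly4 set \<Rightarrow> poly4 set set" where
  "proj_points I = {P. is_ideal P \<and> P \<noteq> UNIV \<and> (\<forall>a b. a * b \<in> P \<longrightarrow> a \<in> P \<or> b \<in> P)
     \<and> (\<forall>p\<in>P. \<forall>q. hom_component q p \<in> P) \<and> I \<subseteq> P \<and> (\<exists>i. var i \<notin> P)}"

definition has_chain :: "poly4 set \<Rightarrow> nat \<Rightarrow> bool" where
  "has_chain I n \<longleftrightarrow> (\<exists>P. (\<forall>i\<le>n. P i \<in> proj_points I) \<and> (\<forall>i<n. P i \<subset> P (Suc i)))"

definition has_proj_dim :: "poly4 set \<Rightarrow> nat \<Rightarrow> bool" where
  "has_proj_dim I n \<longleftrightarrow> has_chain I n \<and> (\<forall>m. has_chain I m \<longrightarrow> m \<le> n)"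

text \<open>The dimension of \<open>(S/I)\<^sub>k = S\<^sub>k/I\<^sub>k\<close>, where \<open>I\<^sub>k = I \<inter> S\<^sub>k\<close>.\<close>

definition hilbert_function :: "poly4 set \<Rightarrow> nat \<Rightarrow> nat" where
  "hilbert_function I k = poly4.dim (hom_part k) - poly4.dim (I \<inter> hom_part k)"

definition hilbert_polynomial :: "poly4 set \<Rightarrow> rat poly" where
  "hilbert_polynomial I =
     (THE P. \<forall>\<^sub>F k in sequentially. poly P (of_nat k) = of_nat (hilbert_function I k))"

text \<open>For a one-dimensional singular subscheme the Hilbert polynomial is \<open>a k + b\<close>, and the
  degree is \<open>a\<close>.\<close>

definition deg_Sigma :: "poly4 \<Rightarrow> rat" where
  "deg_Sigma f = coeff (hilbert_polynomial (jacobian_ideal f)) 1"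


section \<open>Cones\<close>

text \<open>The zero set of \<open>f\<close> is the cone with vertex \<open>p\<close> over the curve \<open>g = 0\<close> in the plane
  \<open>\<Sum>i. a\<^sub>i x\<^sub>i = 0\<close>, which does not contain \<open>p\<close>. Sets are written as affine cones in
  \<open>\<complex>\<^sup>4\<close>; the points \<open>s p + q\<close>, for \<open>q\<close> on the (scaling invariant) cone over
  the curve, are those of the projective lines joining \<open>p\<close> to points of the curve. For reduced
  \<open>f\<close> there is no difference between the zero set and the surface.\<close>

definition cone_over_plane_curve :: "poly4 \<Rightarrow> bool" where
  "cone_over_plane_curve f \<longleftrightarrow> (\<exists>(p :: complex ^ 4) (a :: complex ^ 4) g k.
     (\<Sum>i\<in>UNIV. a $ i * p $ i) \<noteq> 0 \<and> k \<ge> 1 \<and> g \<in> hom_part k \<and>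
     (\<exists>q. (\<Sum>i\<in>UNIV. a $ i * q $ i) = 0 \<and> eval4 g q \<noteq> 0) \<and>
     {v. eval4 f v = 0} =
       {s *s p + q | s q. (\<Sum>i\<in>UNIV. a $ i * q $ i) = 0 \<and> eval4 g q = 0})"


section \<open>Syzygies\<close>

definition AR :: "poly4 \<Rightarrow> (poly4 ^ 4) set" where
  "AR f = {\<rho>. (\<Sum>i\<in>UNIV. \<rho> $ i * pdiff i f) = 0}"

definition AR_part :: "poly4 \<Rightarrow> nat \<Rightarrow> (poly4 ^ 4) set" where
  "AR_part f q = {\<rho> \<in> AR f. \<forall>i. \<rho> $ i \<in> hom_part q}"

text \<open>The class of a homogeneous \<open>\<sigma>\<close> in \<open>AR f / S \<rho>\<^sub>1\<close> is nonzero iff \<open>\<sigma>\<close> is not a multiple of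
  \<open>\<rho>\<^sub>1\<close>.\<close>

definition minimal_syzygies ::
    "poly4 \<Rightarrow> nat \<Rightarrow> nat \<Rightarrow> poly4 ^ 4 \<Rightarrow> poly4 ^ 4 \<Rightarrow> bool" where
  "minimal_syzygies f e1 e2 \<rho>1 \<rho>2 \<longleftrightarrow>
     \<rho>1 \<in> AR_part f e1 \<and> \<rho>1 \<noteq> 0 \<and>
     (\<forall>q. \<forall>\<sigma>\<in>AR_part f q. \<sigma> \<noteq> 0 \<longrightarrow> e1 \<le> q) \<and>
     \<rho>2 \<in> AR_part f e2 \<and> \<rho>2 \<notin> range (\<lambda>a. a *s \<rho>1) \<and>
     (\<forall>q. \<forall>\<sigma>\<in>AR_part f q. \<sigma> \<notin> range (\<lambda>a. a *s \<rho>1) \<longrightarrow> e2 \<le> q) \<and>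
     e1 \<le> e2"


section \<open>Differential forms and tameness\<close>

text \<open>An algebraic differential form on \<open>\<complex>\<^sup>4\<close> is given by its coefficients: the set
  \<open>I = {i\<^sub>1 < \<dots> < i\<^sub>k}\<close> indexes the coefficient of \<open>dx\<^sub>i\<^sub>1 \<and> \<dots> \<and> dx\<^sub>i\<^sub>k\<close>. In \<open>wedge\<close> the
  exponent counts the transpositions needed to sort \<open>I\<close> followed by \<open>K - I\<close>.\<close>

type_synonym form4 = "poly4 ^ (4 set)"

definition wedge :: "form4 \<Rightarrow> form4 \<Rightarrow> form4" where
  "wedge \<alpha> \<beta> = (\<chi> K. \<Sum>I\<in>Pow K.
     (-1) ^ card {(i, j). i \<in> I \<and> j \<in> K - I \<and> j < i} * \<alpha> $ I * \<beta> $ (K - I))"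

definition dvar :: "4 \<Rightarrow> form4" where
  "dvar i = (\<chi> I. if I = {i} then 1 else 0)"

definition omega :: "poly4 ^ 4 \<Rightarrow> form4" where
  "omega \<rho> = (\<Sum>i\<in>UNIV. \<rho> $ i *s dvar i)"

definition Omega1_0 :: "poly4 \<Rightarrow> form4 set" where
  "Omega1_0 f = omega ` AR f"

text \<open>Exactness at the middle term: the kernel of \<open>v\<close> is the image of \<open>u\<close>. The degree shifts
  play no role for this.\<close>

definition tame_wrt :: "poly4 \<Rightarrow> poly4 ^ 4 \<Rightarrow> poly4 ^ 4 \<Rightarrow> bool" where
  "tame_wrt f \<rho>1 \<rho>2 \<longleftrightarrow>
     {\<eta> \<in> Omega1_0 f. wedge (wedge (omega \<rho>1) (omega \<rho>2)) \<eta> = 0} =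
     {a *s omega \<rho>1 + b *s omega \<rho>2 | a b. True}"


section \<open>Free surfaces\<close>

text \<open>The component of degree \<open>k\<close> of \<open>S(-d)\<close>; negative \<open>k\<close> are irrelevant.\<close>

definition shifted_part :: "nat \<Rightarrow> nat \<Rightarrow> poly4 set" where
  "shifted_part d k = (if k < d then {0} else hom_part (k - d))"

definition free_with_exponents :: "poly4 \<Rightarrow> nat ^ 3 \<Rightarrow> bool" where
  "free_with_exponents f d \<longleftrightarrow> (\<exists>\<phi> :: poly4 ^ 3 \<Rightarrow> poly4 ^ 4.
     bij_betw \<phi> UNIV (AR f) \<and>
     (\<forall>u v. \<phi> (u + v) = \<phi> u + \<phi> v) \<and> (\<forall>a v. \<phi> (a *s v) = a *s \<phi> v) \<and>
     (\<forall>k. \<phi> ` {v. \<forall>i. v $ i \<in> shifted_part (d $ i) k} = AR_part f k))"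

definition free_surface :: "poly4 \<Rightarrow> bool" where
  "free_surface f \<longleftrightarrow> (\<exists>d :: nat ^ 3.
     0 < d $ 0 \<and> d $ 0 \<le> d $ 1 \<and> d $ 1 \<le> d $ 2 \<and> free_with_exponents f d)"


section \<open>The class of surfaces\<close>

definition tame_surfaces :: "nat \<Rightarrow> nat \<Rightarrow> nat \<Rightarrow> poly4 set" where
  "tame_surfaces d e1 e2 = {f. f \<in> hom_part d \<and> squarefree f \<and> \<not> cone_over_plane_curve f \<and>
     has_proj_dim (jacobian_ideal f) 1 \<and>
     (\<exists>\<rho>1 \<rho>2. minimal_syzygies f e1 e2 \<rho>1 \<rho>2 \<and> tame_wrt f \<rho>1 \<rho>2)}"

end

theory Submission
  imports Defs
begin

text \<open>Let \<open>\<rho>\<^sub>1, \<rho>\<^sub>2\<close> be a tame pair. For a syzygy \<open>\<rho>\<close> the cross product of \<open>\<rho>\<^sub>1, \<rho>\<^sub>2, \<rho>\<close> is orthogonal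
  to the same vectors as the gradient of \<open>f\<close>; since \<open>\<Sigma>\<close> has codimension two, it equals \<open>h \<nabla>f\<close> for a
  polynomial \<open>h\<close>. By tameness \<open>\<rho> \<mapsto> h\<close> has kernel \<open>S \<rho>\<^sub>1 \<oplus> S \<rho>\<^sub>2\<close>, so \<open>AR(f)\<close> is an extension of a
  shifted ideal \<open>I(-e\<^sub>3)\<close> by \<open>S(-e\<^sub>1) \<oplus> S(-e\<^sub>2)\<close>. Counting dimensions, the Hilbert function of \<open>S/I\<close> is
  eventually \<open>(s\<^sub>1\<^sup>2 - s\<^sub>2 - deg \<Sigma>) k + c\<close>, which yields the inequality. In case of equality \<open>I\<close> has
  codimension at least three; as \<open>AR(f)\<close> is a second syzygy module, the extension then splits and
  \<open>I = S\<close>, so \<open>f\<close> is free. Conversely, minimality of \<open>\<rho>\<^sub>1, \<rho>\<^sub>2\<close> determines the exponents of a free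
  surface.\<close>

text \<open>The hypothesis e1 + 2 e2 \<le> d - 1 says that e2 \<le> e3, so e1, e2, e3 are ordered
  like exponents; e1 is positive because a constant syzygy would make the surface a cone. The number
  s1^2 - s2 is the slope of the Hilbert polynomial of S/J when AR(f) is S(-e1) + S(-e2) + S(-e3).
  With I(-e3) in place of the last summand the slope drops by that of S/I, which is never negative.
  Codimension and depth enter only through Hilbert functions. If the Hilbert function of an ideal
  grows slowly, counting monomials forces the ideal to contain a nonzero polynomial in few
  variables, in any linear coordinates. In suitable coordinates other polynomials are monic in the
  omitted variables, and division with remainder makes the quotient by them free over the ring in
  the remaining variables, whose nonzero elements can then be cancelled. With three variables
  remaining this gives cancellation modulo a single partial derivative; with two, cancellation
  modulo a regular sequence p, q in I. The latter is a concrete substitute for the vanishing of Ext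
  that makes the extension split.\<close>

abbreviation "lookup \<equiv> Poly_Mapping.lookup"
abbreviation "keys \<equiv> Poly_Mapping.keys"
abbreviation "single \<equiv> Poly_Mapping.single"


section \<open>Dimensions of graded pieces\<close>

lemma (in vector_space) finite_basisE:
  assumes "V \<subseteq> span W" "finite W" "subspace V"
  obtains B where "B \<subseteq> V" "finite B" "independent B" "span B = V" "card B = dim V"
proof -
  obtain B where B: "B \<subseteq> V" "independent B" "V \<subseteq> span B" "card B = dim V"
    using basis_exists[of V] by blast
  moreover have "finite B"
    using independent_span_bound[of W B] assms B by auto
  moreover have "span B = V"
    using B assms span_minimal by blast
  ultimately show ?thesis using that by blast
qed

lemma (in vector_space) dim_le_fd:
  assumes "V \<subseteq> U" "U \<subseteq> span W" "finite W" "subspace U"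
  shows "dim V \<le> dim U"
proof -
  obtain B where "finite B" "span B = U" "card B = dim U"
    using finite_basisE[OF assms(2-4)] by metis
  with assms(1) show ?thesis using dim_le_card[of V B] by auto
qed

text \<open>The ambient spaces are infinite-dimensional; finiteness is supplied by a finite set
  \<open>W\<close> whose span contains \<open>V\<close>. A basis \<open>A\<close> of the kernel is
  extended to a basis \<open>B\<close> of \<open>V\<close>, and \<open>f\<close> is injective on the
  span of the remaining vectors \<open>C\<close>.\<close>

lemma (in Vector_Spaces.linear) rank_nullity:
  assumes "vs1.subspace V" "finite W" "V \<subseteq> vs1.span W"
  shows "vs1.dim V = vs2.dim (f ` V) + vs1.dim {v \<in> V. f v = 0}"
proof -
  interpret vector_space_pair s1 s2 by unfold_locales
  have lin: "Vector_Spaces.linear s1 s2 f" by unfold_locales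
  define K where "K = {v \<in> V. f v = 0}"
  have subK: "vs1.subspace K" unfolding K_def using assms(1)
    by (auto simp: vs1.subspace_def add scale)
  obtain A where A: "A \<subseteq> K" "finite A" "vs1.independent A" "vs1.span A = K" "card A = vs1.dim K"
  proof -
    have "K \<subseteq> vs1.span W" using assms(3) unfolding K_def by blast
    from vs1.finite_basisE[OF this assms(2) subK] that show thesis by blast
  qed
  obtain B where B: "A \<subseteq> B" "B \<subseteq> V" "vs1.independent B" "V \<subseteq> vs1.span B"
    using vs1.maximal_independent_subset_extend[of A V] A K_def by auto
  have finB: "finite B" using vs1.independent_span_bound[of W B] assms B by auto
  have spB: "vs1.span B = V" using B assms(1) vs1.span_minimal by blast
  define C where "C = B - A"
  have inj: "inj_on f (vs1.span C)"
  proof -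
    have "x = 0" if x: "x \<in> vs1.span C" "f x = 0" for x
    proof -
      have "x \<in> K" using x spB B vs1.span_mono[of C B] unfolding C_def K_def by auto
      then have "x \<in> vs1.span A" using A by simp
      moreover have "vs1.span C \<inter> vs1.span A = {0}"
      proof -
        have "y = 0" if y: "y \<in> vs1.span C" "y \<in> vs1.span A" for y
        proof -
          \<comment> \<open>\<open>C\<close> and \<open>A\<close> are disjoint, so a vector in both
            spans has only zero coordinates with respect to \<open>B\<close>.\<close>
          have "vs1.representation B y = vs1.representation C y"
            using vs1.representation_extend[OF B(3) y(1)] unfolding C_def by blast
          moreover have "vs1.representation B y = vs1.representation A y"
            using vs1.representation_extend[OF B(3) y(2) B(1)] .
          ultimately have "vs1.representation B y b = 0" for b
            using vs1.representation_ne_zero[of C y b] vs1.representation_ne_zero[of A y b]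
            unfolding C_def by auto
          moreover have "y \<in> vs1.span B" using y B vs1.span_mono by blast
          ultimately show ?thesis using vs1.sum_nonzero_representation_eq[OF B(3), of y] by simp
        qed
        then show ?thesis using vs1.span_zero by blast
      qed
      ultimately show ?thesis using x by blast
    qed
    then show ?thesis using linear_inj_on_iff_eq_0[OF lin vs1.subspace_span] by blast
  qed
  have indC: "vs1.independent C" using B vs1.independent_mono unfolding C_def by blast
  have ind: "vs2.independent (f ` C)"
    using linear_independent_injective_image[OF lin indC inj] .
  have "f ` V = vs2.span (f ` C)"
  proof
    have "f ` B \<subseteq> vs2.span (f ` C)"
    proof
      fix y assume "y \<in> f ` B"
      then obtain b where b: "b \<in> B" "y = f b" by blast
      show "y \<in> vs2.span (f ` C)"
      proof (cases "b \<in> A")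
        case True
        then have "y = 0" using A b K_def by auto
        then show ?thesis by (simp add: vs2.span_zero)
      next
        case False
        then show ?thesis using b C_def by (auto intro: vs2.span_base)
      qed
    qed
    then have "vs2.span (f ` B) \<subseteq> vs2.span (f ` C)"
      using vs2.span_minimal by auto
    then show "f ` V \<subseteq> vs2.span (f ` C)" using linear_span_image[OF lin, of B] spB by simp
    show "vs2.span (f ` C) \<subseteq> f ` V"
      using linear_span_image[OF lin, of C] spB vs1.span_mono[of C B] C_def by auto
  qed
  then have "vs2.dim (f ` V) = card (f ` C)" using ind vs2.dim_span_eq_card_independent by simp
  also have "\<dots> = card C" using card_image[OF inj_on_subset[OF inj vs1.span_superset]] .
  finally have "vs2.dim (f ` V) = card C" .
  moreover have "vs1.dim V = card B" using vs1.dim_span_eq_card_independent[OF B(3)] spB by simp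
  moreover have "card C + card A = card B"
    unfolding C_def using card_Diff_subset[OF A(2) B(1)] card_mono[OF finB B(1)] by linarith
  ultimately show ?thesis using A(5) unfolding K_def by linarith
qed

section \<open>Monomials as bases of the graded pieces of S\<close>

lemma linear_cscale_iff:
  "Vector_Spaces.linear cscale cscale f \<longleftrightarrow>
    (\<forall>x y. f (x + y) = f x + f y) \<and> (\<forall>c x. f (cscale c x) = cscale c (f x))"
  by (simp add: Vector_Spaces.linear_iff poly4.vector_space_axioms)

lemma cscale_mult_left: "cscale c a * b = cscale c (a * b)"
  by (simp add: cscale_def mult.assoc)

lemma cscale_mult_right: "a * cscale c b = cscale c (a * b)"
  by (simp add: cscale_def ac_simps)

lemma cscale_single: "cscale c (single m a) = single m (c * a)"
  by (simp add: cscale_def mult_single)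

lemma poly4_sum_monomials:
  fixes p :: poly4
  assumes "finite M" "keys p \<subseteq> M"
  shows "p = (\<Sum>m\<in>M. single m (lookup p m))"
proof (rule poly_mapping_eqI)
  fix k
  have "lookup (\<Sum>m\<in>M. single m (lookup p m)) k =
    (\<Sum>m\<in>M. if m = k then lookup p k else 0)"
    by (auto simp: lookup_sum lookup_single when_def intro!: sum.cong)
  also have "\<dots> = lookup p k"
    using assms by (auto simp: in_keys_iff)
  finally show "lookup p k =
    lookup (\<Sum>m\<in>M. single m (lookup p m)) k" by simp
qed

lemma lookup_cscale: "lookup (cscale c p) m = c * lookup p m"
proof -
  have "cscale c p = cscale c (\<Sum>m\<in>keys p. single m (lookup p m))"
    by (rule arg_cong[OF poly4_sum_monomials]) auto
  also have "\<dots> = (\<Sum>m\<in>keys p. single m (c * lookup p m))"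
    by (simp add: poly4.scale_sum_right cscale_single)
  also have "lookup \<dots> m =
      (\<Sum>k\<in>keys p. if k = m then c * lookup p m else 0)"
    by (auto simp: lookup_sum lookup_single when_def intro!: sum.cong)
  also have "\<dots> = c * lookup p m"
    by (auto simp: in_keys_iff)
  finally show ?thesis .
qed

lemma keys_cscale: "keys (cscale c p) \<subseteq> keys p"
  by (auto simp: in_keys_iff lookup_cscale)

text \<open>Graded pieces, subrings in fewer variables and spaces of bounded degree in one variable
  all have this form.\<close>

definition mono_span :: "(4 \<Rightarrow>\<^sub>0 nat) set \<Rightarrow> poly4 set" where
  "mono_span M = {p. keys p \<subseteq> M}"

lemma subspace_mono_span: "poly4.subspace (mono_span M)"
proof -
  have "keys (x + y) \<subseteq> M"
    if "keys x \<subseteq> M" "keys y \<subseteq> M" for x y :: poly4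
    using that keys_add[of x y] by blast
  then show ?thesis
    unfolding poly4.subspace_def mono_span_def using keys_cscale by (simp, blast)
qed

lemma mono_span_eq_span:
  assumes "finite M"
  shows "mono_span M = poly4.span ((\<lambda>m. single m 1) ` M)"
proof
  show "mono_span M \<subseteq> poly4.span ((\<lambda>m. single m 1) ` M)"
  proof
    fix p assume "p \<in> mono_span M"
    then have "p = (\<Sum>m\<in>M. cscale (lookup p m) (single m 1))"
      unfolding cscale_single mult_1_right
      by (intro poly4_sum_monomials[OF assms]) (simp add: mono_span_def)
    also have "\<dots> \<in> poly4.span ((\<lambda>m. single m 1) ` M)"
      by (intro poly4.span_sum poly4.span_scale poly4.span_base) auto
    finally show "p \<in> poly4.span ((\<lambda>m. single m 1) ` M)" .
  qed
  have "(\<lambda>m. single m 1) ` M \<subseteq> mono_span M"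
    by (auto simp: mono_span_def)
  then show "poly4.span ((\<lambda>m. single m 1) ` M) \<subseteq> mono_span M"
    using poly4.span_minimal subspace_mono_span by blast
qed

lemma independent_monomials:
  assumes "finite M"
  shows "poly4.independent ((\<lambda>m. single m 1) ` M)"
proof (rule poly4.independent_if_scalars_zero)
  fix g x assume sum: "(\<Sum>x\<in>(\<lambda>m. single m 1) ` M. cscale (g x) x) = 0"
    and x: "x \<in> (\<lambda>m. single m (1::complex)) ` M"
  then obtain k where k: "k \<in> M" "x = single k 1" by blast
  have inj: "inj_on (\<lambda>m::4 \<Rightarrow>\<^sub>0 nat. single m (1::complex)) M"
    by (rule inj_onI) (metis lookup_single_eq lookup_single_not_eq zero_neq_one)
  have "0 = lookup (\<Sum>m\<in>M. cscale (g (single m 1)) (single m 1)) k"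
    using sum unfolding sum.reindex[OF inj] comp_def by (simp only: lookup_zero)
  also have "\<dots> = (\<Sum>m\<in>M. if m = k then g x else 0)"
    unfolding lookup_sum cscale_single k(2) by (intro sum.cong) (auto simp: lookup_single when_def)
  also have "\<dots> = g x" using k(1) assms by (simp only: sum.delta if_True)
  finally show "g x = 0" by simp
qed (use assms in auto)

lemma dim_mono_span:
  assumes "finite M"
  shows "poly4.dim (mono_span M) = card M"
proof -
  have "inj_on (\<lambda>m::4 \<Rightarrow>\<^sub>0 nat. single m (1::complex)) M"
    by (rule inj_onI) (metis lookup_single_eq lookup_single_not_eq zero_neq_one)
  then show ?thesis
    using poly4.dim_span_eq_card_independent[OF independent_monomials[OF assms]]
    by (simp add: mono_span_eq_span[OF assms] card_image)
qed

lemma UNIV_4_eq: "(UNIV :: 4 set) = {0, 1, 2, 3}"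
  unfolding UNIV_4 by auto

lemma UNIV_2_eq: "(UNIV :: 2 set) = {0, 1}"
  using UNIV_2 by auto

lemma all_2_iff: "(\<forall>i::2. P i) \<longleftrightarrow> P 0 \<and> P 1"
  using UNIV_2_eq by (metis UNIV_I empty_iff insert_iff)

lemma all_4_iff: "(\<forall>i::4. P i) \<longleftrightarrow> P 0 \<and> P 1 \<and> P 2 \<and> P 3"
proof -
  \<comment> \<open>\<open>forall_4\<close> runs over 1, 2, 3, 4, whereas the indices here run from
    0; arithmetic in the type is modulo 4.\<close>
  have "(4::4) = 0" by simp
  then show ?thesis using forall_4[of P] by metis
qed

lemma sum_4_eq: "sum f (UNIV :: 4 set) = f 0 + f 1 + f 2 + f 3"
  unfolding UNIV_4_eq by (simp add: add.assoc)

lemma poly_mapping_4_eqI: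
  fixes m n :: "4 \<Rightarrow>\<^sub>0 'a::zero"
  assumes "lookup m 0 = lookup n 0" "lookup m 1 = lookup n 1"
    "lookup m 2 = lookup n 2" "lookup m 3 = lookup n 3"
  shows "m = n"
  using assms all_4_iff[of "\<lambda>i. lookup m i = lookup n i"]
  by (blast intro: poly_mapping_eqI)

lemma mdeg_add: "mdeg (a + b) = mdeg a + mdeg b"
  by (simp add: mdeg_def lookup_add sum.distrib)

lemma mdeg_0 [simp]: "mdeg 0 = 0"
  by (simp add: mdeg_def)

lemma mdeg_single [simp]: "mdeg (single i n) = n"
  by (simp add: mdeg_def lookup_single when_def)

lemma bij_betw_monomials:
  "bij_betw (\<lambda>m. map (lookup m) [0, 1, 2, 3::4])
     {m. mdeg m = k} {l. length l = 4 \<and> sum_list l = k}"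
proof (rule bij_betw_imageI)
  show "inj_on (\<lambda>m. map (lookup m) [0, 1, 2, 3::4]) {m. mdeg m = k}"
    by (rule inj_onI) (auto intro: poly_mapping_4_eqI)
  show "(\<lambda>m. map (lookup m) [0, 1, 2, 3::4]) ` {m. mdeg m = k} =
    {l. length l = 4 \<and> sum_list l = k}"
  proof (intro equalityI subsetI)
    fix l :: "nat list" assume "l \<in> {l. length l = 4 \<and> sum_list l = k}"
    then obtain a b c e where l: "l = [a, b, c, e]" "a + b + c + e = k"
      by (auto simp: numeral_eq_Suc length_Suc_conv)
    define m where "m = single (0::4) a + single 1 b
      + single 2 c + single 3 e"
    have "l = map (lookup m) [0, 1, 2, 3]"
      by (simp add: l m_def lookup_add lookup_single when_def)
    moreover have "mdeg m = k" using l by (simp add: m_def mdeg_add)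
    ultimately show "l \<in> (\<lambda>m. map (lookup m) [0, 1, 2, 3::4]) ` {m. mdeg m = k}"
      by blast
  qed (auto simp: mdeg_def sum_4_eq)
qed

lemma card_monomials: "card {m. mdeg m = k} = (k + 3) choose 3"
proof -
  have "card {m. mdeg m = k} = card {l::nat list. length l = 4 \<and> sum_list l = k}"
    using bij_betw_same_card[OF bij_betw_monomials] .
  also have "\<dots> = (k + 3) choose k"
    using card_length_sum_list[of 4 k] by (simp add: add.commute)
  also have "\<dots> = (k + 3) choose (k + 3 - k)"
    by (rule binomial_symmetric) simp
  also have "k + 3 - k = 3" by simp
  finally show ?thesis .
qed

text \<open>An infinite set would have cardinality 0, but the count just obtained is
  positive.\<close>

lemma finite_monomials: "finite {m. mdeg m = k}"
  by (rule card_ge_0_finite, unfold card_monomials) (rule zero_less_binomial, simp)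

lemma hom_part_eq_mono_span: "hom_part k = mono_span {m. mdeg m = k}"
  by (auto simp: hom_part_def mono_span_def)

lemma subspace_hom_part: "poly4.subspace (hom_part k)"
  by (simp add: hom_part_eq_mono_span subspace_mono_span)

lemma dim_hom_part: "poly4.dim (hom_part k) = (k + 3) choose 3"
  unfolding hom_part_eq_mono_span dim_mono_span[OF finite_monomials] card_monomials ..

definition hom_basis :: "nat \<Rightarrow> poly4 set" where
  "hom_basis k = (\<lambda>m. single m 1) ` {m. mdeg m = k}"

lemma finite_hom_basis: "finite (hom_basis k)"
  by (simp add: hom_basis_def finite_monomials)

lemma span_hom_basis: "poly4.span (hom_basis k) = hom_part k"
  by (simp add: hom_basis_def hom_part_eq_mono_span mono_span_eq_span finite_monomials)

lemma hom_part_0 [simp]: "0 \<in> hom_part k" by (simp add: hom_part_def)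

lemma hom_part_add: "p \<in> hom_part k \<Longrightarrow> q \<in> hom_part k \<Longrightarrow> p + q \<in> hom_part k"
  using subspace_hom_part poly4.subspace_add by blast

lemma hom_part_diff: "p \<in> hom_part k \<Longrightarrow> q \<in> hom_part k \<Longrightarrow> p - q \<in> hom_part k"
  using subspace_hom_part poly4.subspace_diff by blast

lemma hom_part_cscale: "p \<in> hom_part k \<Longrightarrow> cscale c p \<in> hom_part k"
  using subspace_hom_part poly4.subspace_scale by blast

lemma hom_part_sum: "(\<And>i. i \<in> A \<Longrightarrow> p i \<in> hom_part k) \<Longrightarrow> sum p A \<in> hom_part k"
  using subspace_hom_part poly4.subspace_sum by blast

lemma hom_part_mult: "p \<in> hom_part k \<Longrightarrow> q \<in> hom_part l \<Longrightarrow> p * q \<in> hom_part (k + l)"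
  using keys_mult[of p q] by (auto simp: hom_part_def mdeg_add)

lemma hom_part_single: "mdeg m = k \<Longrightarrow> single m c \<in> hom_part k"
  by (auto simp: hom_part_def)

lemma var_in_hom_part: "var i \<in> hom_part 1"
  by (simp add: var_def hom_part_def)

lemma hom_part_0E:
  assumes "p \<in> hom_part 0"
  obtains c where "p = single 0 c"
proof -
  have "m = 0" if "mdeg m = 0" for m
    using that by (intro poly_mapping_eqI) (simp add: mdeg_def)
  then have "keys p \<subseteq> {0}" using assms by (auto simp: hom_part_def)
  then have "p = (\<Sum>m\<in>{0}. single m (lookup p m))"
    by (intro poly4_sum_monomials) auto
  then show ?thesis using that[of "lookup p 0"] by simp
qed


section \<open>Homogeneous components\<close>

lemma lookup_hom_component:
  "lookup (hom_component q p) m = (if mdeg m = q then lookup p m else 0)"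
proof -
  have "lookup (hom_component q p) m =
    (\<Sum>k\<in>{m \<in> keys p. mdeg m = q}. if k = m then lookup p m else 0)"
    by (auto simp: hom_component_def lookup_sum lookup_single when_def intro!: sum.cong)
  also have "\<dots> = (if mdeg m = q then lookup p m else 0)"
    by (auto simp: in_keys_iff)
  finally show ?thesis .
qed

lemma hom_component_in_hom_part: "hom_component q p \<in> hom_part q"
  by (auto simp: hom_part_def in_keys_iff lookup_hom_component split: if_splits)

lemma hom_component_add: "hom_component q (a + b) = hom_component q a + hom_component q b"
  by (rule poly_mapping_eqI) (simp add: lookup_hom_component lookup_add)

lemma hom_component_diff: "hom_component q (a - b) = hom_component q a - hom_component q b"
  by (rule poly_mapping_eqI) (simp add: lookup_hom_component lookup_minus)

lemma hom_component_0 [simp]: "hom_component q 0 = 0"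
  by (rule poly_mapping_eqI) (simp add: lookup_hom_component)

lemma hom_component_sum: "hom_component q (sum f A) = (\<Sum>i\<in>A. hom_component q (f i))"
  by (induction A rule: infinite_finite_induct) (simp_all add: hom_component_add)

lemma hom_component_hom_part:
  "p \<in> hom_part k \<Longrightarrow> hom_component q p = (if q = k then p else 0)"
  by (rule poly_mapping_eqI) (auto simp: lookup_hom_component hom_part_def in_keys_iff)

lemma sum_hom_components:
  "p = (\<Sum>q\<in>mdeg ` keys p. hom_component q p)"
proof (rule poly_mapping_eqI)
  fix m
  have "lookup (\<Sum>q\<in>mdeg ` keys p. hom_component q p) m =
    (\<Sum>q\<in>mdeg ` keys p. if q = mdeg m then lookup p m else 0)"
    by (auto simp: lookup_sum lookup_hom_component intro!: sum.cong)
  also have "\<dots> = lookup p m"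
    by (auto simp: in_keys_iff)
  finally show "lookup p m =
    lookup (\<Sum>q\<in>mdeg ` keys p. hom_component q p) m" by simp
qed

lemma hom_component_mult:
  assumes "b \<in> hom_part r"
  shows "hom_component k (a * b) = (if r \<le> k then hom_component (k - r) a * b else 0)"
proof -
  let ?D = "mdeg ` keys a"
  have "a * b = (\<Sum>q\<in>?D. hom_component q a) * b"
    by (rule arg_cong[OF sum_hom_components])
  then have "hom_component k (a * b) = (\<Sum>q\<in>?D. hom_component k (hom_component q a * b))"
    by (simp only: hom_component_sum sum_distrib_right)
  also have "\<dots> = (\<Sum>q\<in>?D. if k = q + r then hom_component q a * b else 0)"
    using hom_component_hom_part[OF hom_part_mult[OF hom_component_in_hom_part assms]]
    by (intro sum.cong refl) simp
  also have "\<dots> = (if r \<le> k then hom_component (k - r) a * b else 0)"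
  proof (cases "r \<le> k")
    case True
    then have "(\<Sum>q\<in>?D. if k = q + r then hom_component q a * b else 0) =
        (\<Sum>q\<in>?D. if q = k - r then hom_component (k - r) a * b else 0)"
      by (intro sum.cong) auto
    moreover have "hom_component (k - r) a = 0" if "k - r \<notin> ?D"
      using that by (intro poly_mapping_eqI) (force simp: lookup_hom_component in_keys_iff image_iff)
    ultimately show ?thesis using True by auto
  qed (auto intro!: sum.neutral)
  finally show ?thesis .
qed

section \<open>Ascending chain condition for homogeneous ideals\<close>

lemma nat_seq_mono_subseq:
  fixes s :: "nat \<Rightarrow> nat"
  shows "\<exists>g :: nat \<Rightarrow> nat. strict_mono g \<and> mono (\<lambda>n. s (g n))"
proof -
  obtain g :: "nat \<Rightarrow> nat" where g: "strict_mono g" "monoseq (\<lambda>n. s (g n))"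
    using seq_monosub[of s] by blast
  show ?thesis
  proof (cases "incseq (\<lambda>n. s (g n))")
    case True
    then show ?thesis using g(1) by (intro exI[of _ g]) simp
  next
    case False
    then have dec: "decseq (\<lambda>n. s (g n))" using g by (simp add: monoseq_iff)
    \<comment> \<open>A decreasing sequence of naturals is constant once it has reached its least
      value, so it suffices to start the subsequence there.\<close>
    define L where "L = (LEAST v. \<exists>n. v = s (g n))"
    obtain N where N: "L = s (g N)"
      using LeastI_ex[of "\<lambda>v. \<exists>n. v = s (g n)"] unfolding L_def by blast
    have "s (g (N + n)) = L" for n
    proof (rule antisym)
      show "s (g (N + n)) \<le> L" using dec N by (simp add: decseq_def)
      show "L \<le> s (g (N + n))" unfolding L_def by (rule Least_le) blast
    qed
    then have "mono (\<lambda>n. s (g (N + n)))" by (simp add: monoI)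
    moreover have "strict_mono (\<lambda>n. g (N + n))"
      using g(1) by (simp add: strict_mono_def)
    ultimately show ?thesis by (intro exI[of _ "\<lambda>n. g (N + n)"]) blast
  qed
qed

text \<open>The sequence is thinned out for one coordinate after another; a further subsequence
  stays monotone in the coordinates already treated.\<close>

lemma dickson:
  fixes s :: "nat \<Rightarrow> 'a \<Rightarrow> nat"
  assumes "finite A"
  shows "\<exists>g :: nat \<Rightarrow> nat. strict_mono g \<and> (\<forall>x\<in>A. mono (\<lambda>n. s (g n) x))"
  using assms
proof (induction A rule: finite_induct)
  case empty
  have "strict_mono (\<lambda>n::nat. n)" by (simp add: strict_mono_def)
  then show ?case by blast
next
  case (insert a A)
  then obtain g :: "nat \<Rightarrow> nat" where g: "strict_mono g" "\<forall>x\<in>A. mono (\<lambda>n. s (g n) x)" by blast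
  obtain h :: "nat \<Rightarrow> nat" where h: "strict_mono h" "mono (\<lambda>n. s (g (h n)) a)"
    using nat_seq_mono_subseq[of "\<lambda>n. s (g n) a"] by blast
  have "mono (\<lambda>n. s (g (h n)) x)" if "x \<in> A" for x
    using g(2) that strict_mono_mono[OF h(1)] unfolding mono_def by blast
  moreover have "strict_mono (\<lambda>n. g (h n))" using g(1) h(1) by (simp add: strict_mono_def)
  ultimately show ?case using h(2) by (intro exI[of _ "\<lambda>n. g (h n)"]) blast
qed

section \<open>Homogeneous ideals and their leading monomials\<close>

definition hom_ideal :: "poly4 set \<Rightarrow> bool" where
  "hom_ideal I \<longleftrightarrow> is_ideal I \<and> (\<forall>p\<in>I. \<forall>q. hom_component q p \<in> I)"

lemma hom_idealD:
  assumes "hom_ideal I"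
  shows "0 \<in> I" "p \<in> I \<Longrightarrow> q \<in> I \<Longrightarrow> p + q \<in> I" "p \<in> I \<Longrightarrow> a * p \<in> I" "p \<in> I \<Longrightarrow> p * a \<in> I"
    "p \<in> I \<Longrightarrow> hom_component k p \<in> I"
proof -
  show *: "p \<in> I \<Longrightarrow> a * p \<in> I" using assms by (simp add: hom_ideal_def is_ideal_def)
  then show "p \<in> I \<Longrightarrow> p * a \<in> I" by (simp add: mult.commute)
qed (use assms in \<open>simp_all add: hom_ideal_def is_ideal_def\<close>)

lemma hom_ideal_uminus: "hom_ideal I \<Longrightarrow> p \<in> I \<Longrightarrow> - p \<in> I"
  using hom_idealD(3)[of I p "- 1"] by simp

lemma hom_ideal_diff: "hom_ideal I \<Longrightarrow> p \<in> I \<Longrightarrow> q \<in> I \<Longrightarrow> p - q \<in> I"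
  using hom_idealD(2)[of I p "- q"] hom_ideal_uminus[of I q] by simp

lemma hom_ideal_cscale: "hom_ideal I \<Longrightarrow> p \<in> I \<Longrightarrow> cscale c p \<in> I"
  by (simp add: cscale_def hom_idealD)

lemma hom_ideal_sum: "hom_ideal I \<Longrightarrow> (\<And>i. i \<in> A \<Longrightarrow> p i \<in> I) \<Longrightarrow> sum p A \<in> I"
  by (induction A rule: infinite_finite_induct) (simp_all add: hom_idealD)

lemma subspace_hom_ideal: "hom_ideal I \<Longrightarrow> poly4.subspace I"
  by (simp add: poly4.subspace_def hom_idealD hom_ideal_cscale)

lemma hom_ideal_memI:
  assumes "hom_ideal I" "\<And>k. hom_component k p \<in> I"
  shows "p \<in> I"
proof -
  have "(\<Sum>q\<in>mdeg ` keys p. hom_component q p) \<in> I"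
    using assms by (intro hom_ideal_sum) auto
  then show ?thesis by (simp only: sum_hom_components[symmetric])
qed

text \<open>Leading monomial for the linear order that the type of exponent vectors carries, which
  is compatible with addition. The value at 0 is unspecified, hence the removal of 0 in
  \<open>lmonos\<close>.\<close>

definition lmono :: "poly4 \<Rightarrow> 4 \<Rightarrow>\<^sub>0 nat" where
  "lmono p = Max (keys p)"

lemma lmono_in_keys: "p \<noteq> 0 \<Longrightarrow> lmono p \<in> keys p"
  unfolding lmono_def by (rule Max_in) auto

lemma lmono_ge: "m \<in> keys p \<Longrightarrow> m \<le> lmono p"
  unfolding lmono_def by (rule Max_ge) auto

lemma lookup_monomial_mult:
  "lookup (single m c * (p::poly4)) (m + k) = c * lookup p k"
proof -
  have "single m c * p =
    single m c * (\<Sum>n\<in>keys p. single n (lookup p n))"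
    by (rule arg_cong[OF poly4_sum_monomials]) auto
  also have "\<dots> = (\<Sum>n\<in>keys p. single (m + n) (c * lookup p n))"
    by (simp add: sum_distrib_left mult_single)
  also have "lookup \<dots> (m + k) =
      (\<Sum>n\<in>keys p. if n = k then c * lookup p k else 0)"
    unfolding lookup_sum by (intro sum.cong) (auto simp: lookup_single when_def)
  also have "\<dots> = c * lookup p k"
    by (auto simp: in_keys_iff)
  finally show ?thesis .
qed

lemma keys_monomial_mult:
  assumes "c \<noteq> 0"
  shows "keys (single m c * (p::poly4)) = (+) m ` keys p"
proof
  show "keys (single m c * p) \<subseteq> (+) m ` keys p"
    using keys_mult[of "single m c" p] by (auto split: if_splits)
  show "(+) m ` keys p \<subseteq> keys (single m c * p)"
    using assms by (auto simp: in_keys_iff lookup_monomial_mult)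
qed

definition lmonos :: "poly4 set \<Rightarrow> (4 \<Rightarrow>\<^sub>0 nat) set" where
  "lmonos I = lmono ` (I - {0})"

lemma lmonos_upward_closed:
  assumes "hom_ideal I" "m \<in> lmonos I" "\<forall>x. lookup m x \<le> lookup n x"
  shows "n \<in> lmonos I"
proof -
  obtain p where p: "p \<in> I" "p \<noteq> 0" "lmono p = m" using assms by (auto simp: lmonos_def)
  define q where "q = single (n - m) 1 * p"
  have n: "n - m + m = n" using assms(3)
    by (intro poly_mapping_eqI) (simp add: lookup_add lookup_minus)
  have keys: "keys q = (+) (n - m) ` keys p"
    unfolding q_def by (rule keys_monomial_mult) simp
  have "lmono q = n - m + lmono p"
    unfolding lmono_def[of q] keys using p lmono_in_keys[of p] lmono_ge[of _ p]
    by (intro Max_eqI) (auto intro: add_left_mono)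
  then have "lmono q = n" by (simp only: p(3) n)
  moreover have "q \<in> I" unfolding q_def using assms p by (simp add: hom_idealD)
  moreover have "q \<noteq> 0" using keys p lmono_in_keys[of p] by (metis empty_iff image_is_empty keys_zero)
  ultimately show ?thesis by (auto simp: lmonos_def)
qed

text \<open>The component of \<open>p\<close> in the degree of its leading monomial lies in the
  ideal and keeps that leading monomial, so homogeneous witnesses suffice.\<close>

lemma hom_ideal_lmonosE:
  assumes "hom_ideal I" "m \<in> lmonos I"
  obtains p where "p \<in> I" "p \<noteq> 0" "lmono p = m" "p \<in> hom_part (mdeg m)"
proof -
  obtain p where p: "p \<in> I" "p \<noteq> 0" "lmono p = m" using assms by (auto simp: lmonos_def)
  define q where "q = hom_component (mdeg m) p"
  have m: "m \<in> keys p" using p lmono_in_keys by blast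
  then have mq: "m \<in> keys q" by (simp add: q_def in_keys_iff lookup_hom_component)
  have "keys q \<subseteq> keys p"
    by (auto simp: q_def in_keys_iff lookup_hom_component split: if_splits)
  then have "lmono q = m" using mq lmono_ge[of _ p] p(3)
    unfolding lmono_def[of q] by (intro Max_eqI) auto
  moreover have "q \<noteq> 0" using mq by auto
  ultimately show ?thesis
    using that[of q] assms p hom_component_in_hom_part by (simp add: q_def hom_idealD)
qed

text \<open>Reduction as for Groebner bases: subtracting a multiple of an element of
  \<open>I\<close> with the same leading monomial lowers the leading monomial. Within one degree
  only finitely many monomials lie below a given one, and their number is the induction
  measure.\<close>

lemma hom_ideal_subset_if_lmonos_subset:
  assumes I: "hom_ideal I" and J: "hom_ideal J" and sub: "I \<subseteq> J" "lmonos J \<subseteq> lmonos I"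
  shows "J \<subseteq> I"
proof -
  have hom: "p \<in> I" if "p \<in> J" "p \<in> hom_part k" for p k
    using that
  proof (induction "card {m. mdeg m = k \<and> m < lmono p}" arbitrary: p rule: less_induct)
    case less
    show ?case
    proof (cases "p = 0")
      case True
      then show ?thesis using I by (simp add: hom_idealD)
    next
      case False
      then have "lmono p \<in> lmonos I" using less.prems sub by (auto simp: lmonos_def)
      then obtain q where q: "q \<in> I" "q \<noteq> 0" "lmono q = lmono p" "q \<in> hom_part (mdeg (lmono p))"
        using hom_ideal_lmonosE[OF I] by metis
      have mp: "lmono p \<in> keys p" using False lmono_in_keys by blast
      then have deg: "mdeg (lmono p) = k" using less.prems by (simp add: hom_part_def)
      define c where "c = lookup p (lmono p) / lookup q (lmono p)"
      define r where "r = p - cscale c q"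
      have qm: "lookup q (lmono p) \<noteq> 0"
        using lmono_in_keys[OF q(2)] q(3) by (simp add: in_keys_iff)
      have r: "r \<in> J" "r \<in> hom_part k"
        using less.prems q deg sub J unfolding r_def
        by (auto intro!: hom_ideal_diff hom_ideal_cscale hom_part_diff hom_part_cscale)
      have "r \<in> I"
      proof (cases "r = 0")
        case True
        then show ?thesis using I by (simp add: hom_idealD)
      next
        case nz: False
        have rm: "lmono r \<in> keys r" using nz lmono_in_keys by blast
        moreover have "lookup r (lmono p) = 0"
          unfolding r_def c_def using qm by (simp add: lookup_minus lookup_cscale)
        ultimately have "lmono r \<noteq> lmono p" by (auto simp: in_keys_iff)
        moreover have "lmono r \<le> lmono p"
        proof -
          have "lmono r \<in> keys p \<or> lmono r \<in> keys q"
            using rm unfolding r_def by (auto simp: in_keys_iff lookup_minus lookup_cscale)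
          then show ?thesis using lmono_ge q(3) by metis
        qed
        ultimately have lt: "lmono r < lmono p" by simp
        have "mdeg (lmono r) = k" using rm r(2) by (simp add: hom_part_def)
        then have "{m. mdeg m = k \<and> m < lmono r} \<subset> {m. mdeg m = k \<and> m < lmono p}"
          using lt by auto
        then have "card {m. mdeg m = k \<and> m < lmono r} < card {m. mdeg m = k \<and> m < lmono p}"
          by (intro psubset_card_mono finite_subset[OF _ finite_monomials[of k]]) auto
        then show ?thesis using less.hyps r by blast
      qed
      then have "r + cscale c q \<in> I" using I q by (simp add: hom_idealD hom_ideal_cscale)
      then show ?thesis by (simp add: r_def)
    qed
  qed
  show ?thesis
  proof
    fix p assume "p \<in> J"
    then have "hom_component k p \<in> I" for k
      by (intro hom[OF hom_idealD(5)[OF J] hom_component_in_hom_part])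
    then show "p \<in> I" by (rule hom_ideal_memI[OF I])
  qed
qed

text \<open>Every step of a strictly ascending chain contributes a new leading monomial. By
  Dickson's lemma one of these divides a later one, which was therefore already present.\<close>

lemma wf_hom_ideal: "wf {(J, I). hom_ideal J \<and> hom_ideal I \<and> I \<subset> J}"
  unfolding wf_iff_no_infinite_down_chain
proof
  assume "\<exists>f. \<forall>i. (f (Suc i), f i) \<in> {(J, I). hom_ideal J \<and> hom_ideal I \<and> I \<subset> J}"
  then obtain f where "\<forall>i. (f (Suc i), f i) \<in> {(J, I). hom_ideal J \<and> hom_ideal I \<and> I \<subset> J}" by blast
  then have f: "\<And>i. hom_ideal (f i)" "\<And>i. f i \<subset> f (Suc i)" by blast+
  have mono: "f i \<subseteq> f j" if "i \<le> j" for i j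
  proof (rule lift_Suc_mono_le[of f, OF _ that])
    show "f n \<le> f (Suc n)" for n using f(2)[of n] by simp
  qed
  have "\<exists>m. m \<in> lmonos (f (Suc i)) - lmonos (f i)" for i
    using hom_ideal_subset_if_lmonos_subset[OF f(1) f(1), of i "Suc i"] f(2)[of i] by blast
  then obtain m where m: "\<And>i. m i \<in> lmonos (f (Suc i)) - lmonos (f i)" by metis
  obtain g :: "nat \<Rightarrow> nat" where g: "strict_mono g" "\<forall>x\<in>UNIV. mono (\<lambda>n. lookup (m (g n)) x)"
    using dickson[of UNIV "\<lambda>n. lookup (m n)"] by auto
  have lt: "g 0 < g 1" using g(1) by (simp add: strict_mono_def)
  have "lmonos (f (Suc (g 0))) \<subseteq> lmonos (f (g 1))"
    using mono[of "Suc (g 0)" "g 1"] lt by (auto simp: lmonos_def)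
  then have "m (g 0) \<in> lmonos (f (g 1))" using m by blast
  moreover have "\<forall>x. lookup (m (g 0)) x \<le> lookup (m (g 1)) x"
  proof
    fix x show "lookup (m (g 0)) x \<le> lookup (m (g 1)) x"
      using monoD[of "\<lambda>n. lookup (m (g n)) x" 0 1] g(2) by simp
  qed
  ultimately have "m (g 1) \<in> lmonos (f (g 1))" using lmonos_upward_closed f(1) by blast
  then show False using m by blast
qed

lemma hom_ideal_noetherian_induct [consumes 1, case_names step]:
  assumes "hom_ideal I"
    and "\<And>I. hom_ideal I \<Longrightarrow> (\<And>J. hom_ideal J \<Longrightarrow> I \<subset> J \<Longrightarrow> P J) \<Longrightarrow> P I"
  shows "P I"
  using assms(1)
proof (induction I rule: wf_induct_rule[OF wf_hom_ideal])
  case (1 I)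
  then show ?case using assms(2)[of I] by blast
qed


section \<open>Vectors of polynomials\<close>

text \<open>Multiplication \<open>*s\<close> on these vectors has polynomial scalars; dimension
  counts need the underlying complex vector space.\<close>

definition vscale :: "complex \<Rightarrow> poly4 ^ 'n \<Rightarrow> poly4 ^ 'n" where
  "vscale c v = single 0 c *s v"

lemma vscale_nth [simp]: "vscale c v $ i = cscale c (v $ i)"
  by (simp add: vscale_def cscale_def)

interpretation pvec: vector_space vscale
  by unfold_locales (simp_all add: vec_eq_iff poly4.scale_right_distrib poly4.scale_left_distrib)

lemma linear_vscale_cscale_iff:
  "Vector_Spaces.linear vscale cscale f \<longleftrightarrow>
    (\<forall>x y. f (x + y) = f x + f y) \<and> (\<forall>c x. f (vscale c x) = cscale c (f x))"
  by (simp add: Vector_Spaces.linear_iff poly4.vector_space_axioms pvec.vector_space_axioms)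

lemma linear_cscale_vscale_iff:
  "Vector_Spaces.linear cscale vscale f \<longleftrightarrow>
    (\<forall>x y. f (x + y) = f x + f y) \<and> (\<forall>c x. f (cscale c x) = vscale c (f x))"
  by (simp add: Vector_Spaces.linear_iff poly4.vector_space_axioms pvec.vector_space_axioms)

lemma linear_vscale_vscale_iff:
  "Vector_Spaces.linear vscale vscale f \<longleftrightarrow>
    (\<forall>x y. f (x + y) = f x + f y) \<and> (\<forall>c x. f (vscale c x) = vscale c (f x))"
  by (simp add: Vector_Spaces.linear_iff pvec.vector_space_axioms)

lemma (in vector_space) dim_singleton_0: "dim {0} = 0"
  using dim_span[of "{}"] dim_eq_card_independent[of "{}"] independent_empty by simp

lemma (in Vector_Spaces.linear) dim_inj_image:
  assumes "vs1.subspace V" "finite W" "V \<subseteq> vs1.span W" "\<And>v. v \<in> V \<Longrightarrow> f v = 0 \<Longrightarrow> v = 0"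
  shows "vs2.dim (f ` V) = vs1.dim V"
proof -
  have "{v \<in> V. f v = 0} = {0}"
    using assms(1,4) vs1.subspace_0 zero by auto
  moreover have "vs1.dim {0} = 0"
    by (rule vs1.dim_singleton_0)
  ultimately show ?thesis using rank_nullity[OF assms(1-3)] by simp
qed

definition vprod :: "('n \<Rightarrow> poly4 set) \<Rightarrow> (poly4 ^ 'n) set" where
  "vprod V = {v. \<forall>i. v $ i \<in> V i}"

lemma subspace_vprod:
  "(\<And>i. poly4.subspace (V i)) \<Longrightarrow> pvec.subspace (vprod V)"
  by (simp add: pvec.subspace_def vprod_def poly4.subspace_0 poly4.subspace_add poly4.subspace_scale)

lemma vprod_finite_span:
  fixes V :: "'n::finite \<Rightarrow> poly4 set"
  assumes "\<And>i. finite (W i)" "\<And>i. V i \<subseteq> poly4.span (W i)"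
  shows "finite (\<Union>i. axis i ` W i)" "vprod V \<subseteq> pvec.span (\<Union>i. axis i ` W i)"
proof -
  show "finite (\<Union>i. axis i ` W i)" using assms(1) by auto
  show "vprod V \<subseteq> pvec.span (\<Union>i. axis i ` W i)"
  proof
    fix v assume v: "v \<in> vprod V"
    have eq: "v = (\<Sum>i\<in>UNIV. axis i (v $ i))"
      by (simp add: vec_eq_iff axis_def)
    have "axis i (v $ i) \<in> pvec.span (\<Union>i. axis i ` W i)" for i
    proof -
      have lin: "Vector_Spaces.linear cscale vscale (axis i :: poly4 \<Rightarrow> poly4 ^ 'n)"
        by (auto simp: linear_cscale_vscale_iff vec_eq_iff axis_def)
      interpret vector_space_pair cscale "vscale :: complex \<Rightarrow> poly4 ^ 'n \<Rightarrow> poly4 ^ 'n"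
        by unfold_locales
      have "axis i (v $ i) \<in> axis i ` poly4.span (W i)"
        using v assms(2)[of i] by (auto simp: vprod_def)
      also have "\<dots> = pvec.span (axis i ` W i)"
        using linear_span_image[OF lin] by simp
      also have "\<dots> \<subseteq> pvec.span (\<Union>i. axis i ` W i)"
        by (rule pvec.span_mono) blast
      finally show ?thesis .
    qed
    then have "(\<Sum>i\<in>UNIV. axis i (v $ i)) \<in> pvec.span (\<Union>i. axis i ` W i)"
      by (rule pvec.span_sum)
    then show "v \<in> pvec.span (\<Union>i. axis i ` W i)" by (simp only: eq[symmetric])
  qed
qed

lemma dim_vprod:
  fixes V :: "'n::finite \<Rightarrow> poly4 set"
  assumes sub: "\<And>i. poly4.subspace (V i)" and fin: "\<And>i. finite (W i)" "\<And>i. V i \<subseteq> poly4.span (W i)"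
  shows "pvec.dim (vprod V) = (\<Sum>i\<in>UNIV. poly4.dim (V i))"
proof -
  \<comment> \<open>Coordinates outside \<open>A\<close> are forced to be 0, so that adding one
    index to \<open>A\<close> contributes one factor, split off by rank-nullity for the projection
    to that coordinate.\<close>
  define U where "U A = vprod (\<lambda>i. if i \<in> A then V i else {0})" for A
  have subU: "poly4.subspace (if i \<in> A then V i else {0})" for i A
    using sub poly4.subspace_single_0 by auto
  have "pvec.dim (U A) = (\<Sum>i\<in>A. poly4.dim (V i))" if "finite A" for A
    using that
  proof (induction A rule: finite_induct)
    case empty
    have "U {} = {0}" by (auto simp: U_def vprod_def vec_eq_iff)
    moreover have "pvec.dim {0 :: poly4 ^ 'n} = 0"
      by (rule pvec.dim_singleton_0)
    ultimately show ?case by simp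
  next
    case (insert a A)
    have lin: "Vector_Spaces.linear vscale cscale (\<lambda>v :: poly4 ^ 'n. v $ a)"
      by (simp add: linear_vscale_cscale_iff)
    have W: "(if i \<in> insert a A then V i else {0}) \<subseteq> poly4.span (W i)" for i
      using fin(2)[of i] poly4.span_zero by auto
    have subI: "pvec.subspace (U (insert a A))"
      unfolding U_def by (rule subspace_vprod[OF subU])
    have spI: "U (insert a A) \<subseteq> pvec.span (\<Union>i. axis i ` W i)"
      unfolding U_def by (rule vprod_finite_span(2)[OF fin(1) W])
    have finI: "finite (\<Union>i. axis i ` W i)" using fin(1) by simp
    have "pvec.dim (U (insert a A)) = poly4.dim ((\<lambda>v. v $ a) ` U (insert a A)) +
        pvec.dim {v \<in> U (insert a A). v $ a = 0}"
      by (rule linear.rank_nullity[OF lin subI finI spI])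
    moreover have "(\<lambda>v. v $ a) ` U (insert a A) = V a"
    proof
      show "V a \<subseteq> (\<lambda>v. v $ a) ` U (insert a A)"
      proof
        fix p assume "p \<in> V a"
        then have "axis a p \<in> U (insert a A)"
          using sub[THEN poly4.subspace_0] by (simp add: U_def vprod_def axis_def)
        then show "p \<in> (\<lambda>v. v $ a) ` U (insert a A)" by (rule rev_image_eqI) simp
      qed
    qed (auto simp: U_def vprod_def)
    moreover have "{v \<in> U (insert a A). v $ a = 0} = U A"
    proof -
      have "v \<in> U (insert a A) \<and> v $ a = 0 \<longleftrightarrow> v \<in> U A" for v
      proof
        assume "v \<in> U (insert a A) \<and> v $ a = 0"
        then show "v \<in> U A" unfolding U_def vprod_def by (auto split: if_splits)
      next
        assume v: "v \<in> U A"
        then have "v $ i \<in> (if i \<in> A then V i else {0})" for i by (simp add: U_def vprod_def)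
        then have "v $ a = 0" "\<And>i. v $ i \<in> (if i \<in> insert a A then V i else {0})"
          using insert.hyps sub[THEN poly4.subspace_0] by (metis singletonD, metis insert_iff singletonD)
        then show "v \<in> U (insert a A) \<and> v $ a = 0" by (simp add: U_def vprod_def)
      qed
      then show ?thesis by blast
    qed
    ultimately show ?case using insert by simp
  qed
  from this[of UNIV] show ?thesis by (simp add: U_def)
qed


section \<open>Hilbert functions\<close>

definition colon_ideal :: "poly4 set \<Rightarrow> poly4 \<Rightarrow> poly4 set" where
  "colon_ideal I a = {p. a * p \<in> I}"

definition add_ideal :: "poly4 set \<Rightarrow> poly4 \<Rightarrow> poly4 set" where
  "add_ideal I a = {p + a * q | p q. p \<in> I}"

lemma hom_component_mult_left:
  "a \<in> hom_part r \<Longrightarrow> hom_component k (a * b) = (if r \<le> k then a * hom_component (k - r) b else 0)"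
  using hom_component_mult[of a r k b] by (simp add: mult.commute)

lemma hom_ideal_colon:
  assumes "hom_ideal I" "a \<in> hom_part r"
  shows "hom_ideal (colon_ideal I a)"
proof -
  have "a * hom_component q p \<in> I" if "a * p \<in> I" for p q
    using hom_idealD(5)[OF assms(1) that, of "q + r"]
    by (simp add: hom_component_mult_left[OF assms(2)])
  moreover have "a * (b * p) \<in> I" if "a * p \<in> I" for b p
    using hom_idealD(3)[OF assms(1) that, of b] by (simp add: mult.left_commute)
  ultimately show ?thesis
    using hom_idealD[OF assms(1)]
    by (simp add: hom_ideal_def is_ideal_def colon_ideal_def distrib_left)
qed

lemma colon_ideal_superset: "hom_ideal I \<Longrightarrow> I \<subseteq> colon_ideal I a"
  by (auto simp: colon_ideal_def hom_idealD)

lemma hom_ideal_add_ideal: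
  assumes "hom_ideal I" "a \<in> hom_part r"
  shows "hom_ideal (add_ideal I a)"
  unfolding hom_ideal_def is_ideal_def
proof (intro conjI ballI allI)
  show "0 \<in> add_ideal I a"
    using hom_idealD(1)[OF assms(1)] unfolding add_ideal_def by force
next
  fix x y assume "x \<in> add_ideal I a" "y \<in> add_ideal I a"
  then obtain p q p' q' where "x = p + a * q" "y = p' + a * q'" "p \<in> I" "p' \<in> I"
    unfolding add_ideal_def by blast
  then have "x + y = (p + p') + a * (q + q')" "p + p' \<in> I"
    using hom_idealD(2)[OF assms(1)] by (simp_all add: algebra_simps)
  then show "x + y \<in> add_ideal I a" unfolding add_ideal_def by blast
next
  fix x b assume "x \<in> add_ideal I a"
  then obtain p q where "x = p + a * q" "p \<in> I" unfolding add_ideal_def by blast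
  then have "b * x = b * p + a * (b * q)" "b * p \<in> I"
    using hom_idealD(3)[OF assms(1)] by (simp_all add: distrib_left mult.left_commute)
  then show "b * x \<in> add_ideal I a" unfolding add_ideal_def by blast
next
  fix x k assume "x \<in> add_ideal I a"
  then obtain p q where "x = p + a * q" "p \<in> I" unfolding add_ideal_def by blast
  then have "hom_component k x = hom_component k p + a * (if r \<le> k then hom_component (k - r) q else 0)"
    "hom_component k p \<in> I"
    using hom_idealD(5)[OF assms(1)]
    by (simp_all add: hom_component_add hom_component_mult_left[OF assms(2)])
  then show "hom_component k x \<in> add_ideal I a" unfolding add_ideal_def by blast
qed

lemma add_ideal_superset: "I \<subseteq> add_ideal I a"
proof
  fix p assume "p \<in> I"
  moreover have "p = p + a * 0" by simp
  ultimately show "p \<in> add_ideal I a" unfolding add_ideal_def by blast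
qed

lemma in_add_ideal: "hom_ideal I \<Longrightarrow> a \<in> add_ideal I a"
proof -
  assume "hom_ideal I"
  then have "0 \<in> I" by (rule hom_idealD(1))
  moreover have "a = 0 + a * 1" by simp
  ultimately show "a \<in> add_ideal I a" unfolding add_ideal_def by blast
qed

lemma subspace_ideal_part: "hom_ideal I \<Longrightarrow> poly4.subspace (I \<inter> hom_part k)"
  by (simp add: poly4.subspace_inter subspace_hom_ideal subspace_hom_part)

lemma ideal_part_span: "I \<inter> hom_part k \<subseteq> poly4.span (hom_basis k)"
  by (simp add: span_hom_basis)

lemma dim_le_hom_part: "V \<subseteq> hom_part k \<Longrightarrow> poly4.dim V \<le> poly4.dim (hom_part k)"
  by (rule poly4.dim_le_fd[OF _ _ finite_hom_basis[of k] subspace_hom_part]) (simp_all add: span_hom_basis)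

lemma hilbert_function_plus_dim:
  "hilbert_function I k + poly4.dim (I \<inter> hom_part k) = poly4.dim (hom_part k)"
  using dim_le_hom_part[of "I \<inter> hom_part k" k] by (simp add: hilbert_function_def)

text \<open>Numerical form of the exact sequence 0 -> S/(I : a)(-r) -> S/I -> S/(I + (a)) -> 0. The
  map (p, q) -> p + a q sends the degree k + r part of I times S_k onto the degree k + r part of I +
  (a); its kernel projects isomorphically to the degree k part of (I : a).\<close>

lemma hilbert_function_colon:
  assumes I: "hom_ideal I" and a: "a \<in> hom_part r"
  shows "hilbert_function I (k + r) =
    hilbert_function (colon_ideal I a) k + hilbert_function (add_ideal I a) (k + r)"
proof -
  define X :: "(poly4 ^ 2) set" where
    "X = vprod (\<lambda>i. if i = 0 then I \<inter> hom_part (k + r) else hom_part k)"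
  define f :: "poly4 ^ 2 \<Rightarrow> poly4" where "f = (\<lambda>v. v $ 0 + a * v $ 1)"
  define W where "W i = (if i = 0 then hom_basis (k + r) else hom_basis k)" for i :: 2
  have in_X: "v \<in> X \<longleftrightarrow> v $ 0 \<in> I \<inter> hom_part (k + r) \<and> v $ 1 \<in> hom_part k" for v
    by (simp add: X_def vprod_def all_2_iff)
  have sub: "poly4.subspace (if i = 0 then I \<inter> hom_part (k + r) else hom_part k)" for i :: 2
    using I by (simp add: subspace_ideal_part subspace_hom_part)
  have W: "finite (W i)" "(if i = 0 then I \<inter> hom_part (k + r) else hom_part k) \<subseteq> poly4.span (W i)" for i
    by (auto simp: W_def finite_hom_basis span_hom_basis)
  have dimX: "pvec.dim X = poly4.dim (I \<inter> hom_part (k + r)) + poly4.dim (hom_part k)"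
    unfolding X_def dim_vprod[OF sub W] UNIV_2_eq by simp
  have subX: "pvec.subspace X" unfolding X_def by (rule subspace_vprod[OF sub])
  note spX = vprod_finite_span[of W, OF W, folded X_def]
  have lin: "Vector_Spaces.linear vscale cscale f"
    by (auto simp: linear_vscale_cscale_iff f_def algebra_simps poly4.scale_right_distrib cscale_mult_right)
  have lin1: "Vector_Spaces.linear vscale cscale (\<lambda>v :: poly4 ^ 2. v $ 1)"
    by (simp add: linear_vscale_cscale_iff)
  have img: "f ` X = add_ideal I a \<inter> hom_part (k + r)"
  proof (intro equalityI subsetI)
    fix y assume "y \<in> f ` X"
    then obtain v where v: "v \<in> X" "y = v $ 0 + a * v $ 1" by (auto simp: f_def)
    then have "y \<in> hom_part (k + r)"
      using in_X hom_part_mult[OF a, of "v $ 1" k] by (auto intro: hom_part_add simp: add.commute)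
    then show "y \<in> add_ideal I a \<inter> hom_part (k + r)"
      using v in_X unfolding add_ideal_def by blast
  next
    fix y assume y: "y \<in> add_ideal I a \<inter> hom_part (k + r)"
    then obtain p q where pq: "y = p + a * q" "p \<in> I" unfolding add_ideal_def by blast
    define v :: "poly4 ^ 2" where
      "v = (\<chi> i. if i = 0 then hom_component (k + r) p else hom_component k q)"
    have "y = hom_component (k + r) y" using y hom_component_hom_part[of y "k + r" "k + r"] by simp
    also have "\<dots> = f v"
      by (simp add: pq f_def v_def hom_component_add hom_component_mult_left[OF a])
    finally have "y = f v" .
    moreover have "v \<in> X" unfolding in_X
      using hom_idealD(5)[OF I pq(2)] by (simp add: v_def hom_component_in_hom_part)
    ultimately show "y \<in> f ` X" by blast
  qed
  have ker: "pvec.dim {v \<in> X. f v = 0} = poly4.dim (colon_ideal I a \<inter> hom_part k)"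
  proof -
    have subK: "pvec.subspace {v \<in> X. f v = 0}"
      using subX unfolding pvec.subspace_def f_def
      by (auto simp: algebra_simps cscale_mult_right poly4.scale_right_distrib[symmetric] add.assoc[symmetric])
    have inj: "v = 0" if "v \<in> {v \<in> X. f v = 0}" "v $ 1 = 0" for v
    proof -
      have "v $ 0 = 0" using that by (simp add: f_def)
      then show ?thesis using that(2) by (simp add: vec_eq_iff all_2_iff)
    qed
    have "(\<lambda>v. v $ 1) ` {v \<in> X. f v = 0} = colon_ideal I a \<inter> hom_part k"
    proof (intro equalityI subsetI)
      fix y assume "y \<in> (\<lambda>v. v $ 1) ` {v \<in> X. f v = 0}"
      then obtain v where v: "v \<in> X" "v $ 0 + a * v $ 1 = 0" "y = v $ 1" by (auto simp: f_def)
      then have "a * y = - (v $ 0)" by (simp add: eq_neg_iff_add_eq_0 add.commute)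
      then show "y \<in> colon_ideal I a \<inter> hom_part k"
        using v in_X hom_ideal_uminus[OF I, of "v $ 0"] by (auto simp: colon_ideal_def)
    next
      fix y assume y: "y \<in> colon_ideal I a \<inter> hom_part k"
      define v :: "poly4 ^ 2" where "v = (\<chi> i. if i = 0 then - (a * y) else y)"
      have "- (a * y) \<in> hom_part (k + r)"
        using y hom_part_diff[OF hom_part_0 hom_part_mult[OF a, of y k]] by (simp add: add.commute)
      moreover have "- (a * y) \<in> I"
        using y hom_ideal_uminus[OF I, of "a * y"] by (simp add: colon_ideal_def)
      ultimately have "v \<in> X" unfolding in_X using y by (simp add: v_def)
      moreover have "f v = 0" by (simp add: f_def v_def)
      ultimately have "v \<in> {v \<in> X. f v = 0}" by blast
      then show "y \<in> (\<lambda>v. v $ 1) ` {v \<in> X. f v = 0}" by (rule rev_image_eqI) (simp add: v_def)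
    qed
    moreover have spK: "{v \<in> X. f v = 0} \<subseteq> pvec.span (\<Union>i. axis i ` W i)" using spX(2) by blast
    moreover have "poly4.dim ((\<lambda>v. v $ 1) ` {v \<in> X. f v = 0}) = pvec.dim {v \<in> X. f v = 0}"
      by (rule linear.dim_inj_image[OF lin1 subK spX(1) spK inj])
    ultimately show ?thesis by simp
  qed
  have "pvec.dim X = poly4.dim (f ` X) + pvec.dim {v \<in> X. f v = 0}"
    by (rule linear.rank_nullity[OF lin subX spX])
  then show ?thesis unfolding dimX img ker
    using hilbert_function_plus_dim[of I "k + r"]
      hilbert_function_plus_dim[of "colon_ideal I a" k] hilbert_function_plus_dim[of "add_ideal I a" "k + r"]
    by linarith
qed


section \<open>Hilbert polynomials\<close>

lemma poly_eqI_sequentially: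
  fixes P Q :: "rat poly"
  assumes "\<forall>\<^sub>F k in sequentially. poly P (of_nat k) = poly Q (of_nat k)"
  shows "P = Q"
proof (rule ccontr)
  assume "P \<noteq> Q"
  then have fin: "finite {x. poly (P - Q) x = 0}" using poly_roots_finite[of "P - Q"] by simp
  obtain N where N: "\<And>k. k \<ge> N \<Longrightarrow> poly P (of_nat k) = poly Q (of_nat k)"
    using assms unfolding eventually_sequentially by blast
  have "of_nat ` {N..} \<subseteq> {x. poly (P - Q) x = 0}" using N by auto
  then have "finite ((of_nat :: nat \<Rightarrow> rat) ` {N..})" using fin finite_subset by blast
  then have "finite {N..}" by (rule finite_imageD) simp
  then show False using infinite_Ici by blast
qed

text \<open>Induction on the degree: a suitable multiple of the difference of the monomial of degree
  n + 1 removes the leading term of \<open>P\<close>.\<close>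

lemma poly_antidifference:
  fixes P :: "rat poly"
  shows "\<exists>Q. (\<forall>x. poly Q (x + 1) - poly Q x = poly P x) \<and> degree Q \<le> Suc (degree P)"
proof (induction "degree P" arbitrary: P rule: less_induct)
  case less
  define n where "n = degree P"
  define c where "c = coeff P n"
  \<comment> \<open>This is (x + 1)^(n+1) - x^(n+1), of degree n with leading coefficient n +
    1.\<close>
  define L where "L = [:1, 1:] ^ Suc n - monom (1::rat) (Suc n)"
  have coeffL: "coeff L i = (if i \<le> n then of_nat (Suc n choose i) else 0)" for i
  proof -
    have "coeff ([:1, 1:] ^ Suc n :: rat poly) i = of_nat (Suc n choose i)" if "i \<le> Suc n"
      using coeff_linear_poly_power[OF that, of "1::rat" 1] by simp
    moreover have "coeff ([:1, 1:] ^ Suc n :: rat poly) i = 0" if "\<not> i \<le> Suc n"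
    proof (rule coeff_eq_0)
      show "degree ([:1, 1:] ^ Suc n :: rat poly) < i" using that degree_linear_power[of "1::rat" "Suc n"] by simp
    qed
    ultimately show ?thesis by (cases "i \<le> Suc n"; cases "i = Suc n") (auto simp: L_def)
  qed
  define R where "R = P - smult (c / of_nat (Suc n)) L"
  have "coeff R i = 0" if "i \<ge> n" for i
  proof (cases "i = n")
    case True
    have "(of_nat (Suc n choose n) :: rat) = of_nat (Suc n)" by simp
    then show ?thesis using True by (simp add: R_def coeffL c_def del: of_nat_Suc)
  next
    case False
    then have "coeff P i = 0" using that by (intro coeff_eq_0) (simp add: n_def)
    then show ?thesis using False that by (simp add: R_def coeffL)
  qed
  note coeffR = this
  define A where "A = monom (c / of_nat (Suc n)) (Suc n)"
  have A: "poly A (x + 1) - poly A x = poly (smult (c / of_nat (Suc n)) L) x" for x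
    by (simp add: A_def L_def poly_monom algebra_simps del: of_nat_Suc power_Suc)
  have degA: "degree A \<le> Suc n" by (simp add: A_def degree_monom_le)
  show ?case
  proof (cases "R = 0")
    case True
    then have "P = smult (c / of_nat (Suc n)) L" by (simp add: R_def)
    then show ?thesis using A degA n_def by (intro exI[of _ A]) simp
  next
    case False
    have "degree R < n"
      using coeffR[of "degree R"] False leading_coeff_0_iff[of R] not_le_imp_less by blast
    then obtain Q where Q: "\<forall>x. poly Q (x + 1) - poly Q x = poly R x" "degree Q \<le> Suc (degree R)"
      using less[of R] n_def by blast
    have "poly (Q + A) (x + 1) - poly (Q + A) x = poly P x" for x
      using Q(1)[rule_format, of x] A[of x] by (simp add: R_def)
    moreover have "degree (Q + A) \<le> Suc n"
      using Q(2) \<open>degree R < n\<close> degA by (intro degree_add_le) auto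
    ultimately show ?thesis using n_def by blast
  qed
qed

text \<open>Degree bounds are phrased as vanishing of all coefficients from n on; then n = 0 means
  the zero polynomial, which \<open>degree\<close> cannot distinguish from the other
  constants.\<close>

lemma eventually_poly_sum:
  fixes h :: "nat \<Rightarrow> rat"
  assumes "\<forall>\<^sub>F k in sequentially. h (Suc k) - h k = poly P (of_nat k)" "\<And>i. i \<ge> n \<Longrightarrow> coeff P i = 0"
  shows "\<exists>Q. (\<forall>i\<ge>Suc n. coeff Q i = 0) \<and> (\<forall>\<^sub>F k in sequentially. h k = poly Q (of_nat k))"
proof -
  obtain N where N: "\<And>k. k \<ge> N \<Longrightarrow> h (Suc k) - h k = poly P (of_nat k)"
    using assms(1) unfolding eventually_sequentially by blast
  obtain Q where Q: "(\<forall>x. poly Q (x + 1) - poly Q x = poly P x)" "\<forall>i\<ge>Suc n. coeff Q i = 0"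
  proof (cases "P = 0")
    case True
    then show ?thesis using that[of 0] by simp
  next
    case False
    then have "degree P < n" using assms(2) leading_coeff_0_iff not_le_imp_less by blast
    then show ?thesis using poly_antidifference[of P] that coeff_eq_0
      by (metis Suc_le_eq le_trans not_less_eq_eq order_less_le_trans)
  qed
  define d where "d = h N - poly Q (of_nat N)"
  have "h k = poly (Q + [:d:]) (of_nat k)" if "k \<ge> N" for k
    using that
  proof (induction k rule: dec_induct)
    case base
    then show ?case by (simp add: d_def)
  next
    case (step k)
    have "h (Suc k) = h k + (poly Q (of_nat k + 1) - poly Q (of_nat k))"
      using N[OF step(1)] Q(1) by simp
    then show ?case using step.IH by (simp add: add.commute)
  qed
  then have "\<forall>\<^sub>F k in sequentially. h k = poly (Q + [:d:]) (of_nat k)"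
    unfolding eventually_sequentially by blast
  moreover have "\<forall>i\<ge>Suc n. coeff (Q + [:d:]) i = 0"
    using Q(2) by (auto simp: coeff_pCons split: nat.split)
  ultimately show ?thesis by blast
qed

lemma coeff_0_iff_degree_less: "(\<forall>i\<ge>n. coeff P i = 0) \<longleftrightarrow> P = 0 \<or> degree P < n"
  by (metis coeff_0 coeff_eq_0 leading_coeff_0_iff linorder_not_le order_less_le_trans)

lemma coeff_pcompose_linear_0:
  fixes P :: "rat poly"
  assumes "\<forall>i\<ge>n. coeff P i = 0"
  shows "\<forall>i\<ge>n. coeff (pcompose P [:c, 1:]) i = 0"
  using assms unfolding coeff_0_iff_degree_less by (auto simp: degree_pcompose)

section \<open>Homogeneous primes and the growth of Hilbert functions\<close>

lemma poly_mapping_neq_0D: "p \<noteq> 0 \<Longrightarrow> \<exists>m. lookup p m \<noteq> 0"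
  using poly_mapping_eqI[of p 0] by auto

text \<open>Take the components of \<open>a\<close> and \<open>b\<close> of highest degrees k and l
  outside \<open>I\<close>. Modulo \<open>I\<close>, the component of \<open>a * b\<close> in degree
  k + l is their product, so this product lies in \<open>I\<close>.\<close>

lemma hom_ideal_not_primeE:
  assumes I: "hom_ideal I" and ab: "a * b \<in> I" "a \<notin> I" "b \<notin> I"
  obtains p q k l where "p \<in> hom_part k" "q \<in> hom_part l" "p * q \<in> I" "p \<notin> I" "q \<notin> I"
proof -
  have top: "\<exists>k. hom_component k x \<notin> I \<and> (\<forall>i>k. hom_component i x \<in> I)" if "x \<notin> I" for x
  proof -
    define K where "K = {k. hom_component k x \<notin> I}"
    have "K \<subseteq> mdeg ` keys x"
    proof
      fix k assume "k \<in> K"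
      then have "hom_component k x \<noteq> 0" using hom_idealD(1)[OF I] by (auto simp: K_def)
      then obtain m where "lookup (hom_component k x) m \<noteq> 0"
        using poly_mapping_neq_0D[of "hom_component k x"] by blast
      then show "k \<in> mdeg ` keys x"
        by (auto simp: lookup_hom_component in_keys_iff split: if_splits)
    qed
    then have fin: "finite K" by (rule finite_subset) simp
    have "\<exists>k. hom_component k x \<notin> I" using hom_ideal_memI[OF I, of x] that by blast
    then have "K \<noteq> {}" unfolding K_def by blast
    then have "Max K \<in> K" using fin by (rule Max_in[rotated])
    moreover have "i \<notin> K" if "i > Max K" for i
      using Max_ge[OF fin, of i] that by linarith
    ultimately show ?thesis unfolding K_def by blast
  qed
  obtain k where k: "hom_component k a \<notin> I" "\<And>i. i > k \<Longrightarrow> hom_component i a \<in> I"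
    using top[OF ab(2)] by blast
  obtain l where l: "hom_component l b \<notin> I" "\<And>i. i > l \<Longrightarrow> hom_component i b \<in> I"
    using top[OF ab(3)] by blast
  let ?D = "mdeg ` keys b"
  have expand: "hom_component (k + l) (a * b) =
      (\<Sum>q\<in>?D. if q \<le> k + l then hom_component (k + l - q) a * hom_component q b else 0)"
  proof -
    have "a * b = a * (\<Sum>q\<in>?D. hom_component q b)"
      by (rule arg_cong[OF sum_hom_components])
    then have "hom_component (k + l) (a * b) = (\<Sum>q\<in>?D. hom_component (k + l) (a * hom_component q b))"
      by (simp only: hom_component_sum sum_distrib_left)
    also have "\<dots> = (\<Sum>q\<in>?D. if q \<le> k + l then hom_component (k + l - q) a * hom_component q b else 0)"
      by (intro sum.cong refl hom_component_mult hom_component_in_hom_part)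
    finally show ?thesis .
  qed
  have lD: "l \<in> ?D"
  proof -
    have "hom_component l b \<noteq> 0" using l(1) hom_idealD(1)[OF I] by auto
    then obtain m where "lookup (hom_component l b) m \<noteq> 0"
      using poly_mapping_neq_0D[of "hom_component l b"] by blast
    then show ?thesis by (auto simp: lookup_hom_component in_keys_iff split: if_splits)
  qed
  have rest: "(if q \<le> k + l then hom_component (k + l - q) a * hom_component q b else 0) \<in> I"
    if "q \<noteq> l" for q
  proof (cases "q < l")
    case True
    then have "hom_component (k + l - q) a \<in> I" by (intro k(2)) simp
    then show ?thesis using hom_idealD(1,4)[OF I] by simp
  next
    case False
    then have "hom_component q b \<in> I" using that by (intro l(2)) simp
    then show ?thesis using hom_idealD(1,3)[OF I] by simp
  qed
  have "hom_component (k + l) (a * b) = hom_component k a * hom_component l b +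
      (\<Sum>q\<in>?D - {l}. if q \<le> k + l then hom_component (k + l - q) a * hom_component q b else 0)"
    unfolding expand by (subst sum.remove[OF _ lD]) simp_all
  then have "hom_component k a * hom_component l b = hom_component (k + l) (a * b) -
      (\<Sum>q\<in>?D - {l}. if q \<le> k + l then hom_component (k + l - q) a * hom_component q b else 0)"
    by simp
  also have "\<dots> \<in> I"
  proof (rule hom_ideal_diff[OF I hom_idealD(5)[OF I ab(1)] hom_ideal_sum[OF I]])
    fix q assume "q \<in> ?D - {l}"
    then show "(if q \<le> k + l then hom_component (k + l - q) a * hom_component q b else 0) \<in> I"
      by (intro rest) simp
  qed
  finally show ?thesis
    using that[OF hom_component_in_hom_part hom_component_in_hom_part _ k(1) l(1)] by blast
qed

lemma monomial_eq_prod_var: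
  assumes "is_ideal I" "\<forall>i. var i \<in> I" "m \<noteq> 0"
  shows "single m c \<in> I"
proof -
  obtain i where "lookup m i \<noteq> 0"
    using poly_mapping_neq_0D[OF assms(3)] by blast
  then have "m = (m - single i 1) + single i 1"
    by (intro poly_mapping_eqI) (auto simp: lookup_add lookup_minus lookup_single when_def)
  then have "single m c = single (m - single i 1) c * var i"
    by (simp add: var_def mult_single)
  then show ?thesis using assms(1,2) by (simp add: is_ideal_def)
qed

lemma hilbert_function_eq_0_iff_subset:
  "hom_part k \<subseteq> I \<Longrightarrow> hilbert_function I k = 0"
  by (simp add: hilbert_function_def Int_absorb1)

lemma hilbert_function_irrelevant:
  assumes "hom_ideal I" "\<forall>i. var i \<in> I" "k > 0"
  shows "hilbert_function I k = 0"
proof (rule hilbert_function_eq_0_iff_subset)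
  show "hom_part k \<subseteq> I"
  proof
    fix p assume p: "p \<in> hom_part k"
    have "(\<Sum>m\<in>keys p. single m (lookup p m)) \<in> I"
    proof (rule hom_ideal_sum[OF assms(1)])
      fix m assume "m \<in> keys p"
      then have "m \<noteq> 0" using p assms(3) by (auto simp: hom_part_def)
      then show "single m (lookup p m) \<in> I"
        using assms by (intro monomial_eq_prod_var) (simp_all add: hom_ideal_def)
    qed
    then show "p \<in> I" by (simp only: poly4_sum_monomials[OF finite_keys subset_refl, symmetric])
  qed
qed

lemma proj_points_antimono: "I \<subseteq> J \<Longrightarrow> proj_points J \<subseteq> proj_points I"
  unfolding proj_points_def
  by (rule Collect_mono) (intro impI, elim conjE, intro conjI; (assumption | erule (1) subset_trans))

lemma has_chain_antimono:
  assumes "I \<subseteq> J" "has_chain J m"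
  shows "has_chain I m"
proof -
  obtain P where "\<forall>i\<le>m. P i \<in> proj_points J" "\<forall>i<m. P i \<subset> P (Suc i)"
    using assms(2) unfolding has_chain_def by (elim exE conjE)
  moreover from this(1) have "\<forall>i\<le>m. P i \<in> proj_points I"
    using proj_points_antimono[OF assms(1)] by (meson subsetD)
  ultimately show ?thesis unfolding has_chain_def by (intro exI[of _ P] conjI)
qed

text \<open>Noetherian induction. If \<open>I\<close> is prime and misses a variable, that variable
  is a nonzerodivisor on S/I, so the Hilbert function of the ideal enlarged by it is the first
  difference of that of \<open>I\<close>; the enlarged ideal has a smaller chain bound because
  \<open>I\<close> itself can be put below its chains. If \<open>I\<close> is not prime, a
  homogeneous p of a violating pair makes both (I : p) and I + (p) strictly larger, and their
  Hilbert functions add up. The bound n = 0 expresses that there are no points at all.\<close>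

lemma hilbert_function_eventually_poly:
  assumes "hom_ideal I" "\<And>m. has_chain I m \<Longrightarrow> m < n"
  shows "\<exists>P :: rat poly. (\<forall>i\<ge>n. coeff P i = 0) \<and>
    (\<forall>\<^sub>F k in sequentially. of_nat (hilbert_function I k) = poly P (of_nat k))"
  using assms
proof (induction I arbitrary: n rule: hom_ideal_noetherian_induct)
  case (step I n)
  show ?case
  proof (cases "\<forall>a b. a * b \<in> I \<longrightarrow> a \<in> I \<or> b \<in> I")
    case True
    show ?thesis
    proof (cases "\<forall>i. var i \<in> I")
      case True
      have "\<forall>\<^sub>F k in sequentially. of_nat (hilbert_function I k) = poly (0::rat poly) (of_nat k)"
        unfolding eventually_sequentially
        using hilbert_function_irrelevant[OF step(1) True] by (intro exI[of _ 1]) simp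
      then show ?thesis by (intro exI[of _ 0]) simp
    next
      case False
      then obtain j where j: "var j \<notin> I" by blast
      have "I \<noteq> UNIV" using j by blast
      then have Ipt: "I \<in> proj_points I"
        using step(1) True j unfolding proj_points_def hom_ideal_def by simp blast
      have "has_chain I 0" unfolding has_chain_def by (intro exI[of _ "\<lambda>_. I"]) (simp add: Ipt)
      then obtain n' where n': "n = Suc n'" using step.prems[of 0] by (cases n) auto
      let ?K = "add_ideal I (var j)"
      have K: "hom_ideal ?K" by (rule hom_ideal_add_ideal[OF step(1) var_in_hom_part])
      have sub: "I \<subset> ?K" using add_ideal_superset in_add_ideal[OF step(1)] j by blast
      have chain: "m < n'" if c: "has_chain ?K m" for m
      proof -
        obtain P where P: "\<forall>i\<le>m. P i \<in> proj_points ?K" "\<forall>i<m. P i \<subset> P (Suc i)"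
          using c unfolding has_chain_def by (elim exE conjE)
        \<comment> \<open>The chain above the enlarged ideal is prolonged by \<open>I\<close> as its
          new smallest member.\<close>
        define Q where "Q i = (case i of 0 \<Rightarrow> I | Suc i' \<Rightarrow> P i')" for i
        have "P i \<in> proj_points I" if "i \<le> m" for i
          using P(1) that proj_points_antimono[of I ?K] sub by (meson psubset_imp_subset subsetD)
        then have "\<forall>i\<le>Suc m. Q i \<in> proj_points I"
          using Ipt by (auto simp: Q_def split: nat.split)
        moreover have "\<forall>i<Suc m. Q i \<subset> Q (Suc i)"
        proof -
          have "?K \<subseteq> P 0" using P(1) unfolding proj_points_def by blast
          then have "I \<subset> P 0" using sub by blast
          then show ?thesis using P(2) by (auto simp: Q_def split: nat.split)
        qed
        ultimately have "has_chain I (Suc m)" unfolding has_chain_def by (intro exI[of _ Q] conjI)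
        then show ?thesis using step.prems n' by auto
      qed
      obtain P :: "rat poly" where P: "\<forall>i\<ge>n'. coeff P i = 0"
          "\<forall>\<^sub>F k in sequentially. of_nat (hilbert_function ?K k) = poly P (of_nat k)"
        using step(2)[OF K sub chain] by blast
      have "colon_ideal I (var j) = I"
        using True j colon_ideal_superset[OF step(1)] unfolding colon_ideal_def by blast
      then have diff: "hilbert_function I (k + 1) = hilbert_function I k + hilbert_function ?K (k + 1)" for k
        using hilbert_function_colon[OF step(1) var_in_hom_part, of k j] by simp
      have "\<forall>\<^sub>F k in sequentially. of_nat (hilbert_function ?K (Suc k)) = poly P (of_nat (Suc k))"
        using P(2) eventually_sequentially_Suc[of "\<lambda>k. of_nat (hilbert_function ?K k) = poly P (of_nat k)"]
        by blast
      then have "\<forall>\<^sub>F k in sequentially. of_nat (hilbert_function I (Suc k)) - of_nat (hilbert_function I k) =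
          poly (pcompose P [:1, 1:]) (of_nat k)"
        by eventually_elim (use diff in \<open>simp add: poly_pcompose\<close>)
      moreover have "\<And>i. i \<ge> n' \<Longrightarrow> coeff (pcompose P [:1, 1:]) i = 0"
        using coeff_pcompose_linear_0[OF P(1)] by blast
      ultimately show ?thesis
        unfolding n' by (rule eventually_poly_sum)
    qed
  next
    case False
    then obtain a b where ab: "a * b \<in> I" "a \<notin> I" "b \<notin> I" by blast
    obtain p q r l where pq: "p \<in> hom_part r" "q \<in> hom_part l" "p * q \<in> I" "p \<notin> I" "q \<notin> I"
      using hom_ideal_not_primeE[OF step(1) ab] .
    let ?C = "colon_ideal I p" and ?K = "add_ideal I p"
    have C: "hom_ideal ?C" "I \<subset> ?C"
      using hom_ideal_colon[OF step(1) pq(1)] colon_ideal_superset[OF step(1), of p] pq(3,5)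
      by (auto simp: colon_ideal_def)
    have K: "hom_ideal ?K" "I \<subset> ?K"
      using hom_ideal_add_ideal[OF step(1) pq(1)] add_ideal_superset[of I p] in_add_ideal[OF step(1), of p] pq(4)
      by auto
    have "m < n" if "has_chain ?C m" for m
      using step.prems has_chain_antimono[of I ?C m] that C(2) by auto
    then obtain P1 :: "rat poly" where P1: "\<forall>i\<ge>n. coeff P1 i = 0"
          "\<forall>\<^sub>F k in sequentially. of_nat (hilbert_function ?C k) = poly P1 (of_nat k)"
      using step(2)[OF C, of n] by blast
    have "m < n" if "has_chain ?K m" for m
      using step.prems has_chain_antimono[of I ?K m] that K(2) by auto
    then obtain P2 :: "rat poly" where P2: "\<forall>i\<ge>n. coeff P2 i = 0"
          "\<forall>\<^sub>F k in sequentially. of_nat (hilbert_function ?K k) = poly P2 (of_nat k)"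
      using step(2)[OF K, of n] by blast
    \<comment> \<open>The colon ideal contributes in degree k - r, since multiplication by
      \<open>p\<close> raises degrees by r.\<close>
    let ?P = "pcompose P1 [:- of_nat r, 1:] + P2"
    obtain N1 where N1: "\<And>k. k \<ge> N1 \<Longrightarrow> of_nat (hilbert_function ?C k) = poly P1 (of_nat k)"
      using P1(2) unfolding eventually_sequentially by blast
    obtain N2 where N2: "\<And>k. k \<ge> N2 \<Longrightarrow> of_nat (hilbert_function ?K k) = poly P2 (of_nat k)"
      using P2(2) unfolding eventually_sequentially by blast
    have "of_nat (hilbert_function I k) = poly ?P (of_nat k)" if "k \<ge> N1 + N2 + r" for k
    proof -
      have "hilbert_function I k = hilbert_function ?C (k - r) + hilbert_function ?K k"
        using hilbert_function_colon[OF step(1) pq(1), of "k - r"] that by simp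
      then show ?thesis
        using N1[of "k - r"] N2[of k] that by (simp add: poly_pcompose of_nat_diff)
    qed
    then have "\<forall>\<^sub>F k in sequentially. of_nat (hilbert_function I k) = poly ?P (of_nat k)"
      unfolding eventually_sequentially by blast
    moreover have "\<forall>i\<ge>n. coeff ?P i = 0"
      using coeff_pcompose_linear_0[OF P1(1)] P2(1) by simp
    ultimately show ?thesis by blast
  qed
qed


section \<open>Division by polynomials that are monic in one variable\<close>

text \<open>For n = 1 this is the subring of the polynomials that do not involve the variable
  i.\<close>

definition var_deg_less :: "4 \<Rightarrow> nat \<Rightarrow> poly4 set" where
  "var_deg_less i n = {p. \<forall>m\<in>keys p. lookup m i < n}"

lemma var_deg_less_eq_mono_span: "var_deg_less i n = mono_span {m. lookup m i < n}"
  by (auto simp: var_deg_less_def mono_span_def)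

lemma mono_span_0: "0 \<in> mono_span M"
  by (simp add: mono_span_def)

lemma mono_span_add: "p \<in> mono_span M \<Longrightarrow> q \<in> mono_span M \<Longrightarrow> p + q \<in> mono_span M"
  using subspace_mono_span poly4.subspace_add by blast

lemma mono_span_diff: "p \<in> mono_span M \<Longrightarrow> q \<in> mono_span M \<Longrightarrow> p - q \<in> mono_span M"
  using subspace_mono_span poly4.subspace_diff by blast

lemma mono_span_sum: "(\<And>i. i \<in> A \<Longrightarrow> p i \<in> mono_span M) \<Longrightarrow> sum p A \<in> mono_span M"
  using subspace_mono_span poly4.subspace_sum by blast

lemma mono_span_mult:
  assumes "p \<in> mono_span M" "q \<in> mono_span N" "\<And>m n. m \<in> M \<Longrightarrow> n \<in> N \<Longrightarrow> m + n \<in> K"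
  shows "p * q \<in> mono_span K"
proof -
  have "keys (p * q) \<subseteq> K"
  proof
    fix x assume "x \<in> keys (p * q)"
    then obtain m n where "x = m + n" "m \<in> keys p" "n \<in> keys q"
      using keys_mult[of p q] by auto
    then show "x \<in> K" using assms unfolding mono_span_def by auto
  qed
  then show ?thesis by (simp add: mono_span_def)
qed

lemma var_deg_less_mult:
  assumes "p \<in> var_deg_less i 1" "q \<in> var_deg_less i n"
  shows "p * q \<in> var_deg_less i n"
  using assms unfolding var_deg_less_eq_mono_span
  by (rule mono_span_mult) (simp add: lookup_add)

definition monic_var :: "4 \<Rightarrow> nat \<Rightarrow> poly4 \<Rightarrow> bool" where
  "monic_var i n p \<longleftrightarrow> (\<exists>c p'. c \<noteq> 0 \<and> p' \<in> var_deg_less i n \<and>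
     p = single (single i n) c + p')"

text \<open>Division with remainder in one variable. The set \<open>M\<close> is carried along so
  that quotient and remainder inherit restrictions on the support of \<open>a\<close>, such as a
  bounded degree in another variable; its hypothesis is stability under a single reduction
  step.\<close>

lemma monic_var_division:
  assumes p: "monic_var i n p" and a: "a \<in> mono_span M"
    and M: "\<And>m k. m \<in> M \<Longrightarrow> n \<le> lookup m i \<Longrightarrow>
      m - single i n \<in> M \<and>
      (k \<in> keys p \<longrightarrow> m - single i n + k \<in> M)"
  obtains u r where "u \<in> mono_span M" "r \<in> mono_span M" "r \<in> var_deg_less i n" "a = p * u + r"
proof -
  obtain c p' where c: "c \<noteq> 0" and p': "p' \<in> var_deg_less i n"
    and p_eq: "p = single (single i n) c + p'"
    using p unfolding monic_var_def by (elim exE conjE)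
  define Red where "Red = {a. \<exists>u r. u \<in> mono_span M \<and> r \<in> mono_span M \<and> r \<in> var_deg_less i n \<and> a = p * u + r}"
  have Red_add: "a + b \<in> Red" if a: "a \<in> Red" and b: "b \<in> Red" for a b
  proof -
    obtain u r where ur: "u \<in> mono_span M" "r \<in> mono_span M" "r \<in> var_deg_less i n" "a = p * u + r"
      using a unfolding Red_def by blast
    obtain u' r' where ur': "u' \<in> mono_span M" "r' \<in> mono_span M" "r' \<in> var_deg_less i n" "b = p * u' + r'"
      using b unfolding Red_def by blast
    have "a + b = p * (u + u') + (r + r')" by (simp add: ur ur' algebra_simps)
    moreover have "u + u' \<in> mono_span M" "r + r' \<in> mono_span M" "r + r' \<in> var_deg_less i n"
      using ur ur' mono_span_add unfolding var_deg_less_eq_mono_span by blast+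
    ultimately show ?thesis unfolding Red_def by blast
  qed
  have Red_0: "0 \<in> Red"
  proof -
    have "(0::poly4) = p * 0 + 0" by simp
    then show ?thesis unfolding Red_def var_deg_less_eq_mono_span using mono_span_0 by blast
  qed
  have Red_sum: "sum f A \<in> Red" if "\<And>x. x \<in> A \<Longrightarrow> f x \<in> Red" for f :: "(4 \<Rightarrow>\<^sub>0 nat) \<Rightarrow> poly4" and A
    using that by (induction A rule: infinite_finite_induct) (simp_all add: Red_0 Red_add)
  have single: "single m e \<in> Red" if "m \<in> M" for m e
    using that
  proof (induction "lookup m i" arbitrary: m e rule: less_induct)
    case less
    show ?case
    proof (cases "lookup m i < n")
      case True
      have "single m e = p * 0 + single m e" by simp
      moreover have "single m e \<in> mono_span M" "single m e \<in> var_deg_less i n"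
        using less.prems True by (auto simp: mono_span_def var_deg_less_def)
      ultimately show ?thesis unfolding Red_def using mono_span_0 by blast
    next
      case False
      define m' where "m' = m - single i n"
      have m: "m = single i n + m'"
        using False unfolding m'_def
        by (intro poly_mapping_eqI) (auto simp: lookup_add lookup_minus lookup_single when_def)
      \<comment> \<open>The leading term of \<open>p\<close> times \<open>t\<close> is the monomial
        to be reduced. What remains is - t p', all of whose monomials have a smaller exponent of
        i.\<close>
      define t where "t = single m' (e / c)"
      have M': "m' \<in> M" "\<And>k. k \<in> keys p \<Longrightarrow> m' + k \<in> M"
        using M[OF less.prems] False unfolding m'_def by auto
      have "single m e = single (single i n) c * t"
        using c by (simp add: t_def mult_single m)
      then have eq: "single m e = p * t + (- t) * p'"
        by (simp add: p_eq algebra_simps)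
      have "(\<Sum>k\<in>keys p'. single (m' + k) (- e / c * lookup p' k)) \<in> Red"
      proof (rule Red_sum)
        fix k assume k: "k \<in> keys p'"
        then have ki: "lookup k i < n" using p' by (simp add: var_deg_less_def)
        then have "k \<noteq> single i n" by auto
        then have "k \<in> keys p"
          using k by (simp add: p_eq in_keys_iff lookup_add lookup_single)
        then have "m' + k \<in> M" by (rule M'(2))
        moreover have "lookup (m' + k) i < lookup m i"
          using ki by (simp add: m lookup_add)
        ultimately show "single (m' + k) (- e / c * lookup p' k) \<in> Red"
          using less.hyps by blast
      qed
      also have "(\<Sum>k\<in>keys p'. single (m' + k) (- e / c * lookup p' k)) =
          (- t) * (\<Sum>k\<in>keys p'. single k (lookup p' k))"
        by (simp add: t_def sum_distrib_left single_uminus[symmetric] mult_single)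
      also have "\<dots> = (- t) * p'"
        by (simp only: poly4_sum_monomials[OF finite_keys subset_refl, symmetric])
      finally have "(- t) * p' \<in> Red" .
      moreover have "p * t \<in> Red"
      proof -
        have "p * t = p * t + 0" by simp
        moreover have "t \<in> mono_span M" using M'(1) by (simp add: t_def mono_span_def)
        ultimately show ?thesis unfolding Red_def var_deg_less_eq_mono_span using mono_span_0 by blast
      qed
      ultimately show ?thesis unfolding eq by (rule Red_add[rotated])
    qed
  qed
  have "(\<Sum>m\<in>keys a. single m (lookup a m)) \<in> Red"
    using a by (intro Red_sum single) (auto simp: mono_span_def)
  then have "a \<in> Red" by (simp only: poly4_sum_monomials[OF finite_keys subset_refl, symmetric])
  then show ?thesis using that unfolding Red_def by blast
qed

text \<open>Multiplication by \<open>p\<close> raises the degree in the variable i by exactly n,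
  because the leading coefficient is a nonzero constant.\<close>

lemma monic_var_mult_eq_0:
  assumes p: "monic_var i n p" and pu: "p * u \<in> var_deg_less i n"
  shows "u = 0"
proof (rule ccontr)
  assume "u \<noteq> 0"
  obtain c p' where c: "c \<noteq> 0" and p': "p' \<in> var_deg_less i n"
    and p_eq: "p = single (single i n) c + p'"
    using p unfolding monic_var_def by (elim exE conjE)
  let ?E = "(\<lambda>m. lookup m i) ` keys u"
  have "Max ?E \<in> ?E" using \<open>u \<noteq> 0\<close> by (intro Max_in) auto
  then obtain m where m: "m \<in> keys u" "lookup m i = Max ?E" by auto
  have max: "lookup k i \<le> lookup m i" if "k \<in> keys u" for k
    unfolding m(2) using that by (intro Max_ge) auto
  let ?k = "single i n + m"
  have "p' * u \<in> mono_span {k. lookup k i < n + lookup m i}"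
  proof (rule mono_span_mult)
    show "p' \<in> mono_span {m. lookup m i < n}" using p' by (simp add: var_deg_less_eq_mono_span)
    show "u \<in> mono_span {k. lookup k i \<le> lookup m i}"
      using max by (auto simp: mono_span_def)
  qed (simp add: lookup_add)
  then have "?k \<notin> keys (p' * u)"
    by (auto simp: mono_span_def lookup_add)
  then have "lookup (p * u) ?k = c * lookup u m"
    by (simp add: p_eq distrib_right lookup_add lookup_monomial_mult in_keys_iff)
  then have "?k \<in> keys (p * u)" using c m(1) by (simp add: in_keys_iff)
  then have "lookup ?k i < n" using pu by (simp add: var_deg_less_def)
  then show False by (simp add: lookup_add)
qed

text \<open>S/(p) is free over the polynomials without the variable i, so the nonzero
  \<open>b\<close> is a nonzerodivisor on it: for the remainder r of t, the product b r is a
  multiple of p of degree below n, hence 0.\<close>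

lemma monic_var_cancel:
  assumes p: "monic_var i n p" and b: "b \<in> var_deg_less i 1" "b \<noteq> 0" and dvd: "p dvd b * t"
  shows "p dvd t"
proof -
  obtain s where s: "b * t = p * s" using dvd by (rule dvdE)
  obtain u r where ur: "r \<in> var_deg_less i n" "t = p * u + r"
    by (rule monic_var_division[OF p, of t UNIV]) (auto simp: mono_span_def)
  have "p * (s - b * u) = b * r" using s ur(2) by (simp add: algebra_simps)
  moreover have "b * r \<in> var_deg_less i n" using b(1) ur(1) by (rule var_deg_less_mult)
  ultimately have "p * (s - b * u) \<in> var_deg_less i n" by (simp only:)
  then have "s - b * u = 0" by (rule monic_var_mult_eq_0[OF p])
  with \<open>p * (s - b * u) = b * r\<close> have "r = 0" using b(2) by simp
  then show ?thesis using ur(2) by simp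
qed

text \<open>With \<open>\<complex>[z, w]\<close> as base ring, \<open>S/(p, q)\<close> is free with basis the monomials
  \<open>x\<^sup>i y\<^sup>j\<close>, \<open>i < n\<close>, \<open>j < l\<close>; hence it is torsion free over \<open>\<complex>[z, w]\<close>.\<close>

lemma monic_var_cancel2:
  assumes p: "monic_var 0 n p" and q: "monic_var 1 l q" "q \<in> var_deg_less 0 1"
    and b: "b \<in> var_deg_less 0 1" "b \<in> var_deg_less 1 1" "b \<noteq> 0" and eq: "b * a = p * s + q * t"
  shows "\<exists>s t. a = p * s + q * t"
proof -
  let ?M = "{m. lookup m (0::4) < n}"
  have M: "m - single 1 l \<in> ?M \<and>
      (k \<in> keys q \<longrightarrow> m - single 1 l + k \<in> ?M)" if "m \<in> ?M" for m k
    using that q(2) by (auto simp: lookup_minus lookup_add var_deg_less_def)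
  obtain a1 r1 where r1: "r1 \<in> var_deg_less 0 n" "a = p * a1 + r1"
    by (rule monic_var_division[OF p, of a UNIV]) (auto simp: mono_span_def)
  obtain a2 r2 where r2: "a2 \<in> mono_span ?M" "r2 \<in> mono_span ?M" "r2 \<in> var_deg_less 1 l" "r1 = q * a2 + r2"
    using monic_var_division[OF q(1) r1(1)[unfolded var_deg_less_eq_mono_span] M] by blast
  obtain t1 r3 where r3: "r3 \<in> var_deg_less 0 n" "t = p * t1 + r3"
    by (rule monic_var_division[OF p, of t UNIV]) (auto simp: mono_span_def)
  \<comment> \<open>After reduction of \<open>a\<close> and \<open>t\<close> modulo
    \<open>p\<close>, the right-hand side has degree below n in x, so the multiple of
    \<open>p\<close> on the left is 0. The remaining relation is treated in the same way in
    y.\<close>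
  have "p * (s - b * a1 + q * t1) = b * r2 - q * (r3 - b * a2)"
    using eq r1(2) r2(4) r3(2) by (simp add: algebra_simps)
  moreover have "b * r2 - q * (r3 - b * a2) \<in> var_deg_less 0 n"
  proof -
    have "b * r2 \<in> var_deg_less 0 n" "b * a2 \<in> var_deg_less 0 n"
      using b(1) r2(1,2) var_deg_less_mult unfolding var_deg_less_eq_mono_span by blast+
    moreover from this(2) have "q * (r3 - b * a2) \<in> var_deg_less 0 n"
      using r3(1) q(2) by (intro var_deg_less_mult) (auto simp: var_deg_less_eq_mono_span intro: mono_span_diff)
    ultimately show ?thesis by (simp add: var_deg_less_eq_mono_span mono_span_diff)
  qed
  ultimately have "p * (s - b * a1 + q * t1) \<in> var_deg_less 0 n" by (simp only:)
  then have "s - b * a1 + q * t1 = 0" by (rule monic_var_mult_eq_0[OF p])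
  then have "q * (r3 - b * a2) = b * r2"
    using \<open>p * (s - b * a1 + q * t1) = b * r2 - q * (r3 - b * a2)\<close> by simp
  moreover have "b * r2 \<in> var_deg_less 1 l" using b(2) r2(3) by (rule var_deg_less_mult)
  ultimately have "q * (r3 - b * a2) \<in> var_deg_less 1 l" by (simp only:)
  then have "r3 - b * a2 = 0" by (rule monic_var_mult_eq_0[OF q(1)])
  with \<open>q * (r3 - b * a2) = b * r2\<close> have "r2 = 0" using b(3) by simp
  then have "a = p * a1 + q * a2" using r1(2) r2(4) by simp
  then show ?thesis by blast
qed


section \<open>Substitutions\<close>

text \<open>The parameter \<open>h\<close> embeds the coefficients: with the identity this is
  evaluation at a point, with the constant polynomials it is substitution of polynomials.\<close>

definition psubst :: "(complex \<Rightarrow> 'a::comm_ring_1) \<Rightarrow> (4 \<Rightarrow> 'a) \<Rightarrow> poly4 \<Rightarrow> 'a" where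
  "psubst h v p = (\<Sum>m\<in>keys p.
     h (lookup p m) * (\<Prod>i\<in>UNIV. v i ^ lookup m i))"

locale coeff_hom =
  fixes h :: "complex \<Rightarrow> 'a::comm_ring_1"
  assumes hom_add: "h (a + b) = h a + h b" and hom_mult: "h (a * b) = h a * h b" and hom_1: "h 1 = 1"
begin

lemma hom_0: "h 0 = 0"
  using hom_add[of 0 0] by simp

lemma psubst_superset:
  assumes "finite M" "keys p \<subseteq> M"
  shows "psubst h v p = (\<Sum>m\<in>M. h (lookup p m) * (\<Prod>i\<in>UNIV. v i ^ lookup m i))"
  unfolding psubst_def using assms
  by (intro sum.mono_neutral_left) (auto simp: in_keys_iff hom_0)

lemma psubst_0 [simp]: "psubst h v 0 = 0"
  by (simp add: psubst_def)

lemma psubst_add: "psubst h v (p + q) = psubst h v p + psubst h v q"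
proof -
  let ?M = "keys p \<union> keys q"
  have "keys (p + q) \<subseteq> ?M" by (rule keys_add)
  then show ?thesis
    by (simp add: psubst_superset[of ?M] lookup_add hom_add distrib_right sum.distrib)
qed

lemma psubst_sum: "psubst h v (sum f A) = (\<Sum>i\<in>A. psubst h v (f i))"
  by (induction A rule: infinite_finite_induct) (simp_all add: psubst_add)

lemma psubst_single: "psubst h v (single m c) = h c * (\<Prod>i\<in>UNIV. v i ^ lookup m i)"
  by (subst psubst_superset[of "{m}"]) auto

lemma psubst_const: "psubst h v (single 0 c) = h c"
  by (simp add: psubst_single)

lemma psubst_var: "psubst h v (var j) = v j"
proof -
  have "(\<Prod>i\<in>UNIV. v i ^ lookup (single j 1) i) = (\<Prod>i\<in>UNIV. if i = j then v j else 1)"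
    by (intro prod.cong) (auto simp: lookup_single when_def)
  then show ?thesis by (simp add: var_def psubst_single hom_1)
qed

lemma psubst_mult: "psubst h v (p * q) = psubst h v p * psubst h v q"
proof -
  have single: "psubst h v (single m c * single n e) =
      psubst h v (single m c) * psubst h v (single n e)" for m n c e
    by (simp add: mult_single psubst_single hom_mult lookup_add power_add prod.distrib algebra_simps)
  let ?p = "\<Sum>m\<in>keys p. single m (lookup p m)"
  let ?q = "\<Sum>m\<in>keys q. single m (lookup q m)"
  have "psubst h v (?p * ?q) = psubst h v ?p * psubst h v ?q"
    by (simp add: sum_product psubst_sum single)
  then show ?thesis
    by (simp only: poly4_sum_monomials[OF finite_keys subset_refl, symmetric])
qed

lemma psubst_cscale: "psubst h v (cscale c p) = h c * psubst h v p"
  by (simp add: cscale_def psubst_mult psubst_const)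

lemma psubst_1: "psubst h v 1 = 1"
  using psubst_const[of v 1] by (simp add: hom_1)

lemma psubst_power: "psubst h v (p ^ n) = psubst h v p ^ n"
  by (induction n) (simp_all add: psubst_1 psubst_mult)

lemma psubst_prod: "psubst h v (prod f A) = (\<Prod>i\<in>A. psubst h v (f i))"
  by (induction A rule: infinite_finite_induct) (simp_all add: psubst_1 psubst_mult)

end

interpretation eval: coeff_hom "\<lambda>c. c"
  by unfold_locales auto

interpretation poly: coeff_hom "single 0 :: complex \<Rightarrow> poly4"
  by unfold_locales (auto simp: single_add mult_single)

lemma eval4_eq_psubst: "eval4 p v = psubst (\<lambda>c. c) (\<lambda>i. v $ i) p"
  by (simp add: eval4_def psubst_def)

abbreviation psub :: "(4 \<Rightarrow> poly4) \<Rightarrow> poly4 \<Rightarrow> poly4" where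
  "psub \<equiv> psubst (single 0)"

lemma (in coeff_hom) psubst_psub: "psubst h w (psub v p) = psubst h (\<lambda>i. psubst h w (v i)) p"
proof -
  have "psubst h w (psub v p) = (\<Sum>m\<in>keys p. psubst h w (single 0 (lookup p m) *
      (\<Prod>i\<in>UNIV. v i ^ lookup m i)))"
    unfolding psubst_def[of "single 0"] by (rule psubst_sum)
  also have "\<dots> = psubst h (\<lambda>i. psubst h w (v i)) p"
    unfolding psubst_def[of h "\<lambda>i. psubst h w (v i)"]
    by (intro sum.cong refl) (simp add: psubst_mult psubst_const psubst_prod psubst_power)
  finally show ?thesis .
qed

lemma prod_single: "finite A \<Longrightarrow> (\<Prod>i\<in>A. single (f i) (1::complex)) = single (sum f A) 1"
  for f :: "4 \<Rightarrow> 4 \<Rightarrow>\<^sub>0 nat"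
  by (induction A rule: finite_induct) (simp_all add: mult_single)

lemma var_power: "var i ^ n = single (single i n) 1"
  by (induction n) (simp_all add: var_def mult_single single_add[symmetric])

lemma psub_var: "psub var p = p"
proof -
  have "(\<Prod>i\<in>UNIV. var i ^ lookup m i) = single m 1" for m
  proof -
    have "(\<Sum>i\<in>UNIV. single i (lookup m i)) = m"
      by (rule poly_mapping_eqI) (simp add: lookup_sum lookup_single when_def)
    then show ?thesis by (simp add: var_power prod_single)
  qed
  then have "psub var p = (\<Sum>m\<in>keys p. single m (lookup p m))"
    by (simp add: psubst_def mult_single)
  then show ?thesis by (simp only: poly4_sum_monomials[OF finite_keys subset_refl, symmetric])
qed

lemma hom_part_power: "p \<in> hom_part k \<Longrightarrow> p ^ n \<in> hom_part (k * n)"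
proof (induction n)
  case 0
  show ?case using hom_part_single[of 0 0 1] by simp
next
  case (Suc n)
  then show ?case using hom_part_mult[of p k "p ^ n" "k * n"] by simp
qed

lemma hom_part_prod:
  "(\<And>i. i \<in> A \<Longrightarrow> f i \<in> hom_part (k i)) \<Longrightarrow> finite A \<Longrightarrow> prod f A \<in> hom_part (sum k A)"
proof (induction A rule: infinite_finite_induct)
  case empty
  show ?case using hom_part_single[of 0 0 1] by simp
next
  case (insert x F)
  then show ?case using hom_part_mult[of "f x" "k x" "prod f F" "sum k F"] by simp
qed simp

lemma psub_hom_part:
  assumes "\<And>i. v i \<in> hom_part 1" "p \<in> hom_part k"
  shows "psub v p \<in> hom_part k"
  unfolding psubst_def
proof (rule hom_part_sum)
  fix m assume "m \<in> keys p"
  then have m: "mdeg m = k" using assms(2) by (simp add: hom_part_def)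
  have "v i ^ n \<in> hom_part n" for i n using hom_part_power[OF assms(1), of i n] by simp
  then have "(\<Prod>i\<in>UNIV. v i ^ lookup m i) \<in> hom_part (\<Sum>i\<in>UNIV. lookup m i)"
    by (intro hom_part_prod) auto
  then have "(\<Prod>i\<in>UNIV. v i ^ lookup m i) \<in> hom_part k" using m by (simp add: mdeg_def)
  then show "single 0 (lookup p m) * (\<Prod>i\<in>UNIV. v i ^ lookup m i) \<in> hom_part k"
    using hom_part_cscale by (simp add: cscale_def)
qed

lemma var_deg_less_1_power:
  assumes "p \<in> var_deg_less j 1"
  shows "p ^ n \<in> var_deg_less j 1"
proof (induction n)
  case 0
  show ?case by (simp add: var_deg_less_def)
next
  case (Suc n)
  show ?case unfolding power_Suc by (rule var_deg_less_mult[OF assms Suc])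
qed

lemma psub_var_deg_less:
  assumes "\<And>i. i \<noteq> j \<Longrightarrow> v i \<in> var_deg_less j 1" "p \<in> var_deg_less j 1"
  shows "psub v p \<in> var_deg_less j 1"
  unfolding psubst_def var_deg_less_eq_mono_span
proof (rule mono_span_sum)
  have one: "1 \<in> var_deg_less j 1" by (simp add: var_deg_less_def)
  fix m assume "m \<in> keys p"
  then have m: "lookup m j = 0" using assms(2) by (simp add: var_deg_less_def)
  have f: "v i ^ lookup m i \<in> var_deg_less j 1" for i
    using assms(1)[of i] var_deg_less_1_power one m by (cases "i = j") auto
  have "(\<Prod>i\<in>A. v i ^ lookup m i) \<in> var_deg_less j 1" for A
  proof (induction A rule: infinite_finite_induct)
    case (insert i A)
    then show ?case using var_deg_less_mult[OF f] by simp
  qed (use one in simp_all)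
  moreover have "single 0 (lookup p m) \<in> var_deg_less j 1"
    by (auto simp: var_deg_less_def)
  ultimately show "single 0 (lookup p m) * (\<Prod>i\<in>UNIV. v i ^ lookup m i)
      \<in> mono_span {m. lookup m j < 1}"
    using var_deg_less_mult unfolding var_deg_less_eq_mono_span by blast
qed

text \<open>Kronecker substitution \<open>x\<^sub>i = t\<^bsup>N\<^sup>i\<^esup>\<close> reduces this to polynomials in one variable.\<close>

lemma ex_eval4_nonzero:
  assumes "p \<noteq> 0"
  shows "\<exists>x. eval4 p x \<noteq> 0"
proof -
  define N where "N = Suc (Max (mdeg ` keys p))"
  have N: "lookup m i < N" if "m \<in> keys p" for m i
  proof -
    have "lookup m i \<le> mdeg m" unfolding mdeg_def by (rule member_le_sum) auto
    also have "mdeg m \<le> Max (mdeg ` keys p)" using that by (intro Max_ge) auto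
    finally show ?thesis by (simp add: N_def)
  qed
  define code where "code m = lookup m 0 + N * (lookup m 1 +
     N * (lookup m 2 + N * lookup m (3::4)))" for m
  have digit: "a = a' \<and> b = b'" if "a + N * b = a' + N * b'" "a < N" "a' < N" for a a' b b'
  proof -
    have "a = (a + N * b) mod N" "b = (a + N * b) div N" using that(2) by simp_all
    moreover have "a' = (a' + N * b') mod N" "b' = (a' + N * b') div N" using that(3) by simp_all
    ultimately show ?thesis using that(1) by metis
  qed
  have inj: "m = n" if "m \<in> keys p" "n \<in> keys p" "code m = code n" for m n
  proof -
    note 1 = digit[OF that(3)[unfolded code_def] N[OF that(1)] N[OF that(2)]]
    note 2 = digit[OF 1[THEN conjunct2] N[OF that(1)] N[OF that(2)]]
    note 3 = digit[OF 2[THEN conjunct2] N[OF that(1)] N[OF that(2)]]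
    have "N > 0" by (simp add: N_def)
    then show ?thesis using 1 2 3 by (intro poly_mapping_4_eqI) auto
  qed
  define P where "P = (\<Sum>m\<in>keys p. monom (lookup p m) (code m))"
  obtain m0 where m0: "m0 \<in> keys p" using assms by (metis all_not_in_conv keys_eq_empty)
  have "coeff P (code m0) = (\<Sum>m\<in>keys p. if m = m0 then lookup p m0 else 0)"
    unfolding P_def coeff_sum using inj m0 by (intro sum.cong) auto
  also have "\<dots> = lookup p m0" using m0 by simp
  finally have "coeff P (code m0) \<noteq> 0" using m0 by (simp add: in_keys_iff)
  then have "P \<noteq> 0" by auto
  then have "finite {t. poly P t = 0}" by (rule poly_roots_finite)
  then have "{t. poly P t = 0} \<noteq> UNIV" using infinite_UNIV_char_0 by metis
  then obtain t where t: "poly P t \<noteq> 0" by blast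
  define x :: "complex ^ 4" where
    "x = (\<chi> i. if i = 0 then t else if i = 1 then t ^ N else if i = 2 then t ^ (N * N) else t ^ (N * N * N))"
  have "(\<Prod>i\<in>UNIV. (x $ i) ^ lookup m i) = t ^ code m" for m
    unfolding UNIV_4_eq by (simp add: x_def code_def power_add power_mult[symmetric] algebra_simps)
  then have "eval4 p x = poly P t"
    by (simp add: eval4_def P_def poly_sum poly_monom)
  then show ?thesis using t by metis
qed

lemma eval4_scale:
  assumes "p \<in> hom_part k"
  shows "eval4 p (c *s x) = c ^ k * eval4 p x"
proof -
  have "(\<Prod>i\<in>UNIV. ((c *s x) $ i) ^ lookup m i) = c ^ k * (\<Prod>i\<in>UNIV. (x $ i) ^ lookup m i)"
    if "m \<in> keys p" for m
    using that assms by (simp add: hom_part_def mdeg_def power_mult_distrib prod.distrib power_sum[symmetric])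
  then show ?thesis by (simp add: eval4_def sum_distrib_left mult.left_commute)
qed

lemma ex_eval4_nonzero_normalized:
  assumes "p \<noteq> 0" "p \<in> hom_part k"
  shows "\<exists>x. x $ j = 1 \<and> eval4 p x \<noteq> 0"
proof -
  \<comment> \<open>At a point where x_j p does not vanish, neither p nor the j-th coordinate
    vanishes, and the point can be rescaled.\<close>
  have "var j * p \<noteq> 0"
  proof -
    have "var j \<noteq> 0" by (metis keys_single var_def keys_zero insert_not_empty one_neq_zero)
    then show ?thesis using assms(1) by simp
  qed
  then obtain x where "eval4 (var j * p) x \<noteq> 0" using ex_eval4_nonzero by blast
  then have x: "x $ j \<noteq> 0" "eval4 p x \<noteq> 0"
    by (auto simp: eval4_eq_psubst eval.psubst_mult eval.psubst_var)
  have "eval4 p (inverse (x $ j) *s x) \<noteq> 0" using x by (simp add: eval4_scale[OF assms(2)])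
  moreover have "(inverse (x $ j) *s x) $ j = 1" using x by simp
  ultimately show ?thesis by blast
qed

lemma eval4_axis:
  assumes "p \<in> hom_part k"
  shows "eval4 p (axis j 1) = lookup p (single j k)"
proof -
  have "(\<Prod>i\<in>UNIV. (axis j (1::complex) $ i) ^ lookup m i) = (if m = single j k then 1 else 0)"
    if "m \<in> keys p" for m
  proof (cases "m = single j k")
    case True
    then show ?thesis by (auto simp: axis_def lookup_single when_def intro!: prod.neutral)
  next
    case False
    have "\<exists>i. i \<noteq> j \<and> lookup m i \<noteq> 0"
    proof (rule ccontr)
      assume no: "\<not> (\<exists>i. i \<noteq> j \<and> lookup m i \<noteq> 0)"
      have "mdeg m = (\<Sum>i\<in>UNIV. if i = j then lookup m j else 0)"
        unfolding mdeg_def using no by (intro sum.cong) auto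
      then have "lookup m j = k" using that assms by (simp add: hom_part_def)
      then have "m = single j k"
        using no by (intro poly_mapping_eqI) (auto simp: lookup_single when_def)
      then show False using False by simp
    qed
    then obtain i where "i \<noteq> j" "lookup m i \<noteq> 0" by blast
    then have "(axis j (1::complex) $ i) ^ lookup m i = 0" by (simp add: axis_def)
    then have "(\<Prod>i\<in>UNIV. (axis j (1::complex) $ i) ^ lookup m i) = 0"
      by (intro prod_zero) auto
    then show ?thesis using False by simp
  qed
  then have "eval4 p (axis j 1) = (\<Sum>m\<in>keys p. if m = single j k then lookup p m else 0)"
    unfolding eval4_def by (intro sum.cong) auto
  then show ?thesis by (simp add: in_keys_iff)
qed

text \<open>The value of a form of degree k at the j-th coordinate point is its coefficient of
  x_j^k, and every other monomial of degree k has a smaller exponent of j.\<close>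

lemma monic_var_if_eval4_axis:
  assumes p: "p \<in> hom_part k" and nz: "eval4 p (axis j 1) \<noteq> 0"
  shows "monic_var j k p"
proof -
  define c where "c = lookup p (single j k)"
  define p' where "p' = p - single (single j k) c"
  have "lookup m j < k" if m: "m \<in> keys p'" for m
  proof -
    have ne: "m \<noteq> single j k"
      using m by (auto simp: p'_def in_keys_iff lookup_minus c_def)
    then have "m \<in> keys p"
      using m by (auto simp: p'_def in_keys_iff lookup_minus lookup_single when_def)
    then have deg: "mdeg m = k" using p by (simp add: hom_part_def)
    have split: "mdeg m = lookup m j + (\<Sum>i\<in>UNIV - {j}. lookup m i)"
      unfolding mdeg_def by (rule sum.remove) auto
    have "(\<Sum>i\<in>UNIV - {j}. lookup m i) \<noteq> 0"
    proof
      assume "(\<Sum>i\<in>UNIV - {j}. lookup m i) = 0"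
      then have z: "lookup m i = 0" if "i \<noteq> j" for i using that by simp
      have "lookup m j = k"
        using split deg \<open>(\<Sum>i\<in>UNIV - {j}. lookup m i) = 0\<close> by linarith
      then have "m = single j k"
        using z by (intro poly_mapping_eqI) (auto simp: lookup_single when_def)
      then show False using ne by simp
    qed
    then show ?thesis using split deg by linarith
  qed
  then have "p' \<in> var_deg_less j k" by (simp add: var_deg_less_def)
  moreover have "c \<noteq> 0" using nz eval4_axis[OF p] by (simp add: c_def)
  moreover have "p = single (single j k) c + p'" by (simp add: p'_def)
  ultimately show ?thesis unfolding monic_var_def by blast
qed


section \<open>Graded automorphisms and generic coordinates\<close>

locale graded_aut =
  fixes T T' :: "poly4 \<Rightarrow> poly4"
  assumes T_add: "T (p + q) = T p + T q" and T_mult: "T (p * q) = T p * T q"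
    and T_cscale: "T (cscale c p) = cscale c (T p)" and T_hom: "p \<in> hom_part k \<Longrightarrow> T p \<in> hom_part k"
    and T'_add: "T' (p + q) = T' p + T' q" and T'_mult: "T' (p * q) = T' p * T' q"
    and T'_cscale: "T' (cscale c p) = cscale c (T' p)" and T'_hom: "p \<in> hom_part k \<Longrightarrow> T' p \<in> hom_part k"
    and T'_T [simp]: "T' (T p) = p" and T_T' [simp]: "T (T' p) = p"
begin

lemma T_0 [simp]: "T 0 = 0"
  using T_add[of 0 0] by simp

lemma T'_0 [simp]: "T' 0 = 0"
  using T'_add[of 0 0] by simp

lemma T_eq_0_iff [simp]: "T p = 0 \<longleftrightarrow> p = 0"
  by (metis T'_T T_0 T'_0)

lemma T'_eq_0_iff [simp]: "T' p = 0 \<longleftrightarrow> p = 0"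
  by (metis T_T' T_0 T'_0)

lemma T_dvd_iff: "T p dvd T q \<longleftrightarrow> p dvd q"
proof
  assume "T p dvd T q"
  then obtain r where "T q = T p * r" by (rule dvdE)
  then have "T q = T (p * T' r)" by (simp add: T_mult)
  then have "T' (T q) = T' (T (p * T' r))" by (rule arg_cong)
  then have "q = p * T' r" by simp
  then show "p dvd q" by simp
next
  assume "p dvd q"
  then obtain r where "q = p * r" by (rule dvdE)
  then show "T p dvd T q" by (simp add: T_mult)
qed

lemma T'_sum: "T' (sum f A) = (\<Sum>i\<in>A. T' (f i))"
  by (induction A rule: infinite_finite_induct) (simp_all add: T'_add)

lemma hom_component_T': "hom_component k (T' p) = T' (hom_component k p)"
proof -
  let ?D = "mdeg ` keys p"
  have "T' p = T' (\<Sum>q\<in>?D. hom_component q p)"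
    by (rule arg_cong[OF sum_hom_components])
  then have "hom_component k (T' p) = (\<Sum>q\<in>?D. hom_component k (T' (hom_component q p)))"
    by (simp only: T'_sum hom_component_sum)
  also have "\<dots> = (\<Sum>q\<in>?D. if q = k then T' (hom_component k p) else 0)"
    using hom_component_hom_part[OF T'_hom[OF hom_component_in_hom_part]]
    by (intro sum.cong refl) auto
  also have "\<dots> = T' (hom_component k p)"
  proof -
    have "hom_component k p = 0" if "k \<notin> ?D"
      using that by (intro poly_mapping_eqI) (force simp: lookup_hom_component in_keys_iff image_iff)
    then show ?thesis by auto
  qed
  finally show ?thesis .
qed

text \<open>This is the image of \<open>I\<close> under \<open>T\<close>; as a preimage under the
  inverse map it inherits the ideal properties directly.\<close>

definition pull :: "poly4 set \<Rightarrow> poly4 set" where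
  "pull I = {p. T' p \<in> I}"

lemma hom_ideal_pull: "hom_ideal I \<Longrightarrow> hom_ideal (pull I)"
  by (simp add: hom_ideal_def is_ideal_def pull_def T'_add T'_mult hom_component_T'[symmetric])

lemma hilbert_function_pull:
  assumes "hom_ideal I"
  shows "hilbert_function (pull I) k = hilbert_function I k"
proof -
  have lin: "Vector_Spaces.linear cscale cscale T'"
    by (simp add: linear_cscale_iff T'_add T'_cscale)
  have "T' ` (pull I \<inter> hom_part k) = I \<inter> hom_part k"
  proof (intro equalityI subsetI)
    fix p assume p: "p \<in> I \<inter> hom_part k"
    then have "T p \<in> pull I \<inter> hom_part k" by (simp add: pull_def T_hom)
    then show "p \<in> T' ` (pull I \<inter> hom_part k)" by (rule rev_image_eqI) simp
  qed (auto simp: pull_def T'_hom)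
  moreover have "poly4.dim (T' ` (pull I \<inter> hom_part k)) = poly4.dim (pull I \<inter> hom_part k)"
    by (rule linear.dim_inj_image[OF lin subspace_ideal_part[OF hom_ideal_pull[OF assms]]
        finite_hom_basis ideal_part_span]) simp
  ultimately show ?thesis by (simp add: hilbert_function_def)
qed

end

text \<open>For c_j = 0 this is an invertible linear change of coordinates with inverse given by -c.
  It makes the j-th coordinate point play the role of that point plus c and leaves the other
  coordinate points alone.\<close>

definition shear :: "4 \<Rightarrow> complex ^ 4 \<Rightarrow> 4 \<Rightarrow> poly4" where
  "shear j c i = var i + cscale (c $ i) (var j)"

lemma shear_hom_part: "shear j c i \<in> hom_part 1"
  unfolding shear_def by (intro hom_part_add hom_part_cscale var_in_hom_part)

lemma psub_shear_shear:
  assumes "c $ j = 0"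
  shows "psub (shear j (- c)) (psub (shear j c) p) = p"
proof -
  have "psub (shear j (- c)) (shear j c i) = var i" for i
    using assms
    by (simp add: shear_def poly.psubst_add poly.psubst_cscale poly.psubst_var cscale_def[symmetric]
        poly4.scale_minus_left)
  then show ?thesis by (simp add: poly.psubst_psub psub_var)
qed

lemma graded_aut_shear:
  assumes "c $ j = 0"
  shows "graded_aut (psub (shear j c)) (psub (shear j (- c)))"
proof
  show "psub (shear j c) (psub (shear j (- c)) p) = p" for p
    using psub_shear_shear[of "- c" j p] assms by simp
qed (simp_all add: psub_shear_shear[OF assms] poly.psubst_add poly.psubst_mult poly.psubst_cscale
    cscale_def[symmetric] psub_hom_part[OF shear_hom_part])

lemma eval4_psub_shear_axis: "eval4 (psub (shear j c) p) (axis k 1) = eval4 p (axis k 1 + (if j = k then c else 0))"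
proof -
  have "psubst (\<lambda>c. c) (\<lambda>i. axis k 1 $ i) (shear j c i) = (axis k 1 + (if j = k then c else 0)) $ i" for i
    by (simp add: shear_def eval.psubst_add eval.psubst_cscale eval.psubst_var axis_def)
  then show ?thesis by (simp add: eval4_eq_psubst eval.psubst_psub)
qed

lemma monic_var_psub_shear:
  assumes "p \<in> hom_part k" "eval4 p x \<noteq> 0" "x $ j = 1" "c = x - axis j 1"
  shows "monic_var j k (psub (shear j c) p)"
proof (rule monic_var_if_eval4_axis)
  show "psub (shear j c) p \<in> hom_part k"
    by (rule psub_hom_part[OF shear_hom_part assms(1)])
  show "eval4 (psub (shear j c) p) (axis j 1) \<noteq> 0"
    using assms(2,4) by (simp add: eval4_psub_shear_axis)
qed

section \<open>Ideal elements in few variables, cancellation and regular pairs\<close>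

lemma ideal_meets_subspace:
  assumes I: "hom_ideal I" and V: "poly4.subspace V" "V \<subseteq> hom_part k" and less: "hilbert_function I k < poly4.dim V"
  obtains b where "b \<in> I" "b \<in> V" "b \<noteq> 0"
proof -
  define X :: "(poly4 ^ 2) set" where "X = vprod (\<lambda>i. if i = 0 then I \<inter> hom_part k else V)"
  define f :: "poly4 ^ 2 \<Rightarrow> poly4" where "f = (\<lambda>v. v $ 0 + v $ 1)"
  have in_X: "v \<in> X \<longleftrightarrow> v $ 0 \<in> I \<inter> hom_part k \<and> v $ 1 \<in> V" for v
    by (simp add: X_def vprod_def all_2_iff)
  have sub: "poly4.subspace (if i = 0 then I \<inter> hom_part k else V)" for i :: 2
    using I V by (simp add: subspace_ideal_part)
  have W: "finite (hom_basis k)" "(if i = 0 then I \<inter> hom_part k else V) \<subseteq> poly4.span (hom_basis k)" for i :: 2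
    using V by (auto simp: finite_hom_basis span_hom_basis)
  have dimX: "pvec.dim X = poly4.dim (I \<inter> hom_part k) + poly4.dim V"
    unfolding X_def dim_vprod[OF sub W] UNIV_2_eq by simp
  have subX: "pvec.subspace X" unfolding X_def by (rule subspace_vprod[OF sub])
  note spX = vprod_finite_span[of "\<lambda>_. hom_basis k"
      "\<lambda>i. if i = 0 then I \<inter> hom_part k else V", OF W, folded X_def]
  have lin: "Vector_Spaces.linear vscale cscale f"
    by (simp add: linear_vscale_cscale_iff f_def poly4.scale_right_distrib)
  have "f ` X \<subseteq> hom_part k" using V(2) by (auto simp: f_def in_X intro!: hom_part_add)
  then have "poly4.dim (f ` X) \<le> poly4.dim (hom_part k)" by (rule dim_le_hom_part)
  then have "pvec.dim X > poly4.dim (f ` X)"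
    using dimX less hilbert_function_plus_dim[of I k] by linarith
  moreover have "pvec.dim (X :: (poly4 ^ 2) set) = poly4.dim (f ` X) + pvec.dim {v \<in> X. f v = 0}"
    by (rule linear.rank_nullity[OF lin subX spX])
  ultimately have "pvec.dim {v \<in> X. f v = 0} \<noteq> 0" by linarith
  then have "{v \<in> X. f v = 0} \<noteq> {0}" using pvec.dim_singleton_0 by metis
  moreover have "0 \<in> {v \<in> X. f v = 0}" using pvec.subspace_0[OF subX] by (simp add: f_def)
  ultimately obtain v where v: "v \<in> X" "f v = 0" "v \<noteq> 0" by blast
  have "v $ 1 = - (v $ 0)" using v(2) by (simp add: f_def eq_neg_iff_add_eq_0 add.commute)
  moreover from this have "v $ 1 \<noteq> 0" using v(3) by (auto simp: vec_eq_iff all_2_iff)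
  ultimately show ?thesis
    using that[of "v $ 1"] v(1) hom_ideal_uminus[OF I, of "v $ 0"] by (simp add: in_X)
qed

lemma ideal_meets_mono_span:
  assumes "hom_ideal I" "M \<subseteq> {m. mdeg m = k}" "hilbert_function I k < card M"
  obtains b where "b \<in> I" "b \<in> mono_span M" "b \<noteq> 0"
proof -
  have fin: "finite M" using assms(2) finite_monomials by (rule finite_subset)
  have "mono_span M \<subseteq> hom_part k" using assms(2) by (auto simp: hom_part_eq_mono_span mono_span_def)
  moreover have "hilbert_function I k < poly4.dim (mono_span M)" using assms(3) fin by (simp add: dim_mono_span)
  ultimately show ?thesis using ideal_meets_subspace[OF assms(1) subspace_mono_span] that by metis
qed

text \<open>The monomials y^a z^b w^(2n-a-b) with a, b \<le> n are (n + 1)^2 forms of degree 2n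
  without x; they exceed the Hilbert function, so they are dependent modulo \<open>I\<close>. Degree
  2n makes the index set a square.\<close>

lemma ideal_meets_three_vars:
  assumes "hom_ideal I" "hilbert_function I (2 * n) < (n + 1)\<^sup>2"
  obtains b where "b \<in> I" "b \<in> var_deg_less 0 1" "b \<noteq> 0"
proof -
  define g where "g = (\<lambda>(a, b). single (1::4) a + single 2 b + single 3 (2 * n - a - b))"
  define M where "M = g ` ({..n} \<times> {..n})"
  have l1: "lookup (g ab) 1 = fst ab" and l2: "lookup (g ab) 2 = snd ab"
    and l0: "lookup (g ab) 0 = 0" for ab
    by (simp_all add: g_def lookup_add lookup_single when_def split: prod.split)
  have "inj_on g ({..n} \<times> {..n})" by (rule inj_onI) (metis l1 l2 prod_eq_iff)
  then have "card M = (n + 1)\<^sup>2" by (simp add: M_def card_image power2_eq_square)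
  then have card: "hilbert_function I (2 * n) < card M" using assms(2) by simp
  have "mdeg m = 2 * n" if "m \<in> M" for m
    using that by (auto simp: M_def g_def mdeg_add)
  then have "M \<subseteq> {m. mdeg m = 2 * n}" by blast
  then obtain b where b: "b \<in> I" "b \<in> mono_span M" "b \<noteq> 0"
    using ideal_meets_mono_span[OF assms(1) _ card] by metis
  have "lookup m 0 = 0" if "m \<in> M" for m using that l0 by (auto simp: M_def)
  then have "b \<in> var_deg_less 0 1" using b(2) by (auto simp: mono_span_def var_deg_less_def)
  then show ?thesis using that b by blast
qed

text \<open>There are k + 1 monomials of degree k in z and w.\<close>

lemma ideal_meets_two_vars:
  assumes "hom_ideal I" "hilbert_function I k \<le> k"
  obtains b where "b \<in> I" "b \<in> hom_part k" "b \<in> var_deg_less 0 1" "b \<in> var_deg_less 1 1" "b \<noteq> 0"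
proof -
  define g where "g = (\<lambda>a. single (2::4) a + single 3 (k - a))"
  define M where "M = g ` {..k}"
  have l2: "lookup (g a) 2 = a"
    and l0: "lookup (g a) 0 = 0" and l1: "lookup (g a) 1 = 0" for a
    by (simp_all add: g_def lookup_add lookup_single when_def)
  have "inj_on g {..k}" by (rule inj_onI) (metis l2)
  then have "card M = k + 1" by (simp add: M_def card_image)
  then have card: "hilbert_function I k < card M" using assms(2) by simp
  have deg: "mdeg m = k" if "m \<in> M" for m
    using that by (auto simp: M_def g_def mdeg_add)
  then have "M \<subseteq> {m. mdeg m = k}" by blast
  then obtain b where b: "b \<in> I" "b \<in> mono_span M" "b \<noteq> 0"
    using ideal_meets_mono_span[OF assms(1) _ card] by metis
  have "lookup m 0 = 0" "lookup m 1 = 0" if "m \<in> M" for m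
    using that l0 l1 by (auto simp: M_def)
  then have "b \<in> var_deg_less 0 1" "b \<in> var_deg_less 1 1" "b \<in> hom_part k"
    using b(2) deg by (auto simp: mono_span_def var_deg_less_def hom_part_def)
  then show ?thesis using that b by blast
qed

text \<open>Quadratic growth is missing, so \<open>J\<close> contains some \<open>b \<noteq> 0\<close> free of \<open>x\<close>, and \<open>S/(q)\<close> is free over
  \<open>\<complex>[y, z, w]\<close> once \<open>q\<close> is monic in \<open>x\<close>.\<close>

lemma dvd_if_ideal_mult_dvd:
  assumes J: "hom_ideal J" "hilbert_function J (2 * n) < (n + 1)\<^sup>2"
    and q: "q \<in> hom_part l" "q \<noteq> 0" and dvd: "\<And>b. b \<in> J \<Longrightarrow> q dvd b * t"
  shows "q dvd t"
proof -
  obtain x where x: "x $ 0 = 1" "eval4 q x \<noteq> 0"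
    using ex_eval4_nonzero_normalized[OF q(2,1)] by blast
  define c where "c = x - axis 0 1"
  have "c $ 0 = 0" using x(1) by (simp add: c_def)
  then interpret graded_aut "psub (shear 0 c)" "psub (shear 0 (- c))" by (rule graded_aut_shear)
  have monic: "monic_var 0 l (psub (shear 0 c) q)"
    by (rule monic_var_psub_shear[OF q(1) x(2,1) c_def])
  obtain b where b: "b \<in> pull J" "b \<in> var_deg_less 0 1" "b \<noteq> 0"
    using ideal_meets_three_vars[OF hom_ideal_pull[OF J(1)], of n] J hilbert_function_pull by metis
  have "q dvd psub (shear 0 (- c)) b * t" using b(1) dvd by (simp add: pull_def)
  then have "psub (shear 0 c) q dvd psub (shear 0 c) (psub (shear 0 (- c)) b * t)" by (simp add: T_dvd_iff)
  then have "psub (shear 0 c) q dvd b * psub (shear 0 c) t" by (simp add: T_mult)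
  then have "psub (shear 0 c) q dvd psub (shear 0 c) t" by (rule monic_var_cancel[OF monic b(2,3)])
  then show ?thesis by (simp add: T_dvd_iff)
qed

text \<open>The first conditions say that multiplication by q is injective modulo the nonzero p, so
  p, q behave as a regular sequence in \<open>I\<close>. The last one says that the colon ideal of
  (p, q) by \<open>I\<close> is (p, q) itself, which is the form in which \<open>I\<close> having
  depth at least three is used.\<close>

definition regular_pair :: "poly4 set \<Rightarrow> poly4 \<Rightarrow> poly4 \<Rightarrow> bool" where
  "regular_pair I p q \<longleftrightarrow> p \<in> I \<and> q \<in> I \<and> p \<noteq> 0 \<and> (\<forall>s t. p * s = q * t \<longrightarrow> p dvd t) \<and>
     (\<forall>a. (\<forall>b\<in>I. \<exists>s t. b * a = p * s + q * t) \<longrightarrow> (\<exists>s t. a = p * s + q * t))"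

lemma (in graded_aut) regular_pair_pull:
  assumes "regular_pair (pull I) p q"
  shows "regular_pair I (T' p) (T' q)"
  unfolding regular_pair_def
proof (intro conjI allI impI)
  note pq = assms[unfolded regular_pair_def]
  show "T' p \<in> I" "T' q \<in> I" "T' p \<noteq> 0" using pq by (simp_all add: pull_def)
  fix s t assume "T' p * s = T' q * t"
  then have "T (T' p * s) = T (T' q * t)" by (rule arg_cong)
  then have "p * T s = q * T t" by (simp add: T_mult)
  then have "p dvd T t" using pq by blast
  then have "T (T' p) dvd T t" by simp
  then show "T' p dvd t" unfolding T_dvd_iff .
next
  note pq = assms[unfolded regular_pair_def]
  fix a assume a: "\<forall>b\<in>I. \<exists>s t. b * a = T' p * s + T' q * t"
  have "\<exists>s t. b * T a = p * s + q * t" if "b \<in> pull I" for b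
  proof -
    have "T' b \<in> I" using that by (simp add: pull_def)
    then obtain s t where "T' b * a = T' p * s + T' q * t" using a by blast
    then have "T (T' b * a) = T (T' p * s + T' q * t)" by (rule arg_cong)
    then have "b * T a = p * T s + q * T t" by (simp add: T_mult T_add)
    then show ?thesis by blast
  qed
  then obtain s t where "T a = p * s + q * t" using pq by blast
  then have "T' (T a) = T' (p * s + q * t)" by (rule arg_cong)
  then have "a = T' p * T' s + T' q * T' t" by (simp add: T'_mult T'_add)
  then show "\<exists>s t. a = T' p * s + T' q * t" by blast
qed

text \<open>S/(p) is torsion free over the polynomials in y, z, w, and S/(p, q) over those in z, w;
  the elements to be cancelled are q and b.\<close>

lemma regular_pair_if_monic:
  assumes p: "monic_var 0 n p" "p \<in> I" and q: "monic_var 1 l q" "q \<in> var_deg_less 0 1" "q \<in> I"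
    and b: "b \<in> I" "b \<in> var_deg_less 0 1" "b \<in> var_deg_less 1 1" "b \<noteq> 0"
  shows "regular_pair I p q"
proof -
  have nz: "p \<noteq> 0" if "monic_var i n p" for i n and p :: poly4
    using monic_var_mult_eq_0[OF that, of 1] that by (auto simp: var_deg_less_def)
  have "p dvd t" if "p * s = q * t" for s t
  proof (rule monic_var_cancel[OF p(1) q(2)])
    show "q \<noteq> 0" by (rule nz[OF q(1)])
    show "p dvd q * t" using that by (metis dvd_triv_left)
  qed
  moreover have "\<exists>s t. a = p * s + q * t" if "\<forall>b\<in>I. \<exists>s t. b * a = p * s + q * t" for a
    using monic_var_cancel2[OF p(1) q(1,2) b(2,3,4)] that b(1) by blast
  ultimately show ?thesis using p q nz[OF p(1)] unfolding regular_pair_def by blast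
qed

text \<open>The Hilbert function is invariant under coordinate changes, so the ideal contains forms
  in z and w in every system of coordinates. First p is made monic in x; then q in z and w is chosen
  and made monic in y, staying free of x; finally b in z and w is taken in the last
  coordinates.\<close>

lemma ex_regular_pair:
  assumes I: "hom_ideal I" "hilbert_function I k \<le> k"
  shows "\<exists>p q. regular_pair I p q"
proof -
  obtain p where p: "p \<in> I" "p \<in> hom_part k" "p \<noteq> 0"
    using ideal_meets_two_vars[OF I] by blast
  obtain x where x: "x $ 0 = 1" "eval4 p x \<noteq> 0"
    using ex_eval4_nonzero_normalized[OF p(3,2)] by blast
  define c where "c = x - axis 0 1"
  have "c $ 0 = 0" using x(1) by (simp add: c_def)
  then interpret A: graded_aut "psub (shear 0 c)" "psub (shear 0 (- c))" by (rule graded_aut_shear)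
  let ?I = "A.pull I" and ?p = "psub (shear 0 c) p"
  have I1: "hom_ideal ?I" "hilbert_function ?I k \<le> k"
    using I by (simp_all add: A.hom_ideal_pull A.hilbert_function_pull)
  have p1: "?p \<in> ?I" "?p \<in> hom_part k" "eval4 ?p (axis 0 1) \<noteq> 0"
  proof -
    have "axis 0 1 + c = x" by (simp add: c_def)
    then show "eval4 ?p (axis 0 1) \<noteq> 0" using x(2) by (simp add: eval4_psub_shear_axis)
  qed (use p A.T_hom in \<open>simp_all add: A.pull_def\<close>)
  obtain q where q: "q \<in> ?I" "q \<in> hom_part k" "q \<in> var_deg_less 0 1" "q \<noteq> 0"
    by (rule ideal_meets_two_vars[OF I1])
  obtain y where y: "y $ 1 = 1" "eval4 q y \<noteq> 0"
    using ex_eval4_nonzero_normalized[OF q(4,2)] by blast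
  define y' :: "complex ^ 4" where "y' = (\<chi> i. if i = 0 then 0 else y $ i)"
  have "(\<Prod>i\<in>UNIV. (y' $ i) ^ lookup m i) = (\<Prod>i\<in>UNIV. (y $ i) ^ lookup m i)"
    if "m \<in> keys q" for m
    using q(3) that by (intro prod.cong) (auto simp: y'_def var_deg_less_def)
  then have y': "y' $ 1 = 1" "eval4 q y' \<noteq> 0"
    using y by (simp_all add: y'_def eval4_def)
  define e where "e = y' - axis 1 1"
  have "e $ 1 = 0" "e $ 0 = 0" using y'(1) by (simp_all add: e_def y'_def axis_def)
  from this(1) interpret B: graded_aut "psub (shear 1 e)" "psub (shear 1 (- e))" by (rule graded_aut_shear)
  let ?J = "B.pull ?I" and ?P = "psub (shear 1 e) ?p" and ?Q = "psub (shear 1 e) q"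
  have J: "hom_ideal ?J" "hilbert_function ?J k \<le> k"
    using I1 by (simp_all add: B.hom_ideal_pull B.hilbert_function_pull)
  \<comment> \<open>A shear along y does not affect the value at the coordinate point of x, so the
    first polynomial stays monic in x.\<close>
  have "monic_var 0 k ?P"
    using p1(2,3) by (intro monic_var_if_eval4_axis B.T_hom) (simp_all add: eval4_psub_shear_axis)
  moreover have "?P \<in> ?J" "?Q \<in> ?J" using p1(1) q(1) by (simp_all add: B.pull_def)
  moreover have "monic_var 1 k ?Q"
    by (rule monic_var_psub_shear[OF q(2) y'(2,1) e_def])
  moreover have "?Q \<in> var_deg_less 0 1"
  proof (rule psub_var_deg_less[OF _ q(3)])
    show "shear 1 e i \<in> var_deg_less 0 1" if "i \<noteq> 0" for i
    proof -
      have "var i \<in> var_deg_less 0 1" "var 1 \<in> var_deg_less 0 1"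
        using that by (auto simp: var_def var_deg_less_def lookup_single)
      then show ?thesis
        unfolding shear_def var_deg_less_eq_mono_span
        by (intro mono_span_add poly4.subspace_scale[OF subspace_mono_span])
    qed
  qed
  moreover obtain b where "b \<in> ?J" "b \<in> var_deg_less 0 1" "b \<in> var_deg_less 1 1" "b \<noteq> 0"
    by (rule ideal_meets_two_vars[OF J])
  ultimately have "regular_pair ?J ?P ?Q" by (intro regular_pair_if_monic)
  from A.regular_pair_pull[OF B.regular_pair_pull[OF this]] show ?thesis by blast
qed


section \<open>Syzygies and cross products\<close>

lemma pdiff_hom_part:
  assumes "f \<in> hom_part d"
  shows "pdiff i f \<in> hom_part (d - 1)"
  unfolding pdiff_def
proof (rule hom_part_sum)
  fix m assume "m \<in> keys f"
  then have m: "mdeg m = d" using assms by (simp add: hom_part_def)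
  show "single (m - single i 1)
      (of_nat (lookup m i) * lookup f m) \<in> hom_part (d - 1)"
  proof (cases "lookup m i = 0")
    case False
    then have "m = (m - single i 1) + single i 1"
      by (intro poly_mapping_eqI) (auto simp: lookup_add lookup_minus lookup_single when_def)
    then have "mdeg m = mdeg (m - single i 1) + 1" by (metis mdeg_add mdeg_single)
    then show ?thesis using m by (intro hom_part_single) simp
  qed simp
qed

lemma jacobian_idealI: "p = (\<Sum>i\<in>UNIV. a i * pdiff i f) \<Longrightarrow> p \<in> jacobian_ideal f"
  unfolding jacobian_ideal_def by blast

lemma hom_ideal_jacobian:
  assumes "f \<in> hom_part d"
  shows "hom_ideal (jacobian_ideal f)"
  unfolding hom_ideal_def is_ideal_def
proof (intro conjI ballI allI)
  have "0 = (\<Sum>i\<in>UNIV. 0 * pdiff i f)" by simp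
  then show "0 \<in> jacobian_ideal f" by (rule jacobian_idealI)
next
  fix p q assume "p \<in> jacobian_ideal f" "q \<in> jacobian_ideal f"
  then obtain a b where "p = (\<Sum>i\<in>UNIV. a i * pdiff i f)" "q = (\<Sum>i\<in>UNIV. b i * pdiff i f)"
    unfolding jacobian_ideal_def by blast
  then have "p + q = (\<Sum>i\<in>UNIV. (a i + b i) * pdiff i f)" by (simp add: distrib_right sum.distrib)
  then show "p + q \<in> jacobian_ideal f" by (rule jacobian_idealI)
next
  fix p c assume "p \<in> jacobian_ideal f"
  then obtain a where "p = (\<Sum>i\<in>UNIV. a i * pdiff i f)" unfolding jacobian_ideal_def by blast
  then have "c * p = (\<Sum>i\<in>UNIV. (c * a i) * pdiff i f)" by (simp add: sum_distrib_left mult.assoc)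
  then show "c * p \<in> jacobian_ideal f" by (rule jacobian_idealI)
next
  fix p k assume "p \<in> jacobian_ideal f"
  then obtain a where "p = (\<Sum>i\<in>UNIV. a i * pdiff i f)" unfolding jacobian_ideal_def by blast
  then have "hom_component k p = (\<Sum>i\<in>UNIV. (if d - 1 \<le> k then hom_component (k - (d - 1)) (a i) else 0) * pdiff i f)"
    by (simp add: hom_component_sum hom_component_mult[OF pdiff_hom_part[OF assms]] if_distrib[of "\<lambda>x. x * _"] cong: if_cong)
  then show "hom_component k p \<in> jacobian_ideal f" by (rule jacobian_idealI)
qed

definition vcomp :: "nat \<Rightarrow> poly4 ^ 'n \<Rightarrow> poly4 ^ 'n" where
  "vcomp q v = (\<chi> i. hom_component q (v $ i))"

lemma vcomp_nth [simp]: "vcomp q v $ i = hom_component q (v $ i)"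
  by (simp add: vcomp_def)

lemma AR_iff: "\<rho> \<in> AR f \<longleftrightarrow> (\<Sum>i\<in>UNIV. \<rho> $ i * pdiff i f) = 0"
  by (simp add: AR_def)

lemma AR_add: "\<rho> \<in> AR f \<Longrightarrow> \<sigma> \<in> AR f \<Longrightarrow> \<rho> + \<sigma> \<in> AR f"
  by (simp add: AR_iff distrib_right sum.distrib)

lemma AR_smult: "\<rho> \<in> AR f \<Longrightarrow> a *s \<rho> \<in> AR f"
  by (simp add: AR_iff mult.assoc sum_distrib_left[symmetric])

lemma AR_diff: "\<rho> \<in> AR f \<Longrightarrow> \<sigma> \<in> AR f \<Longrightarrow> \<rho> - \<sigma> \<in> AR f"
  by (simp add: AR_iff left_diff_distrib sum_subtractf)

lemma vcomp_AR:
  assumes "f \<in> hom_part d" "\<rho> \<in> AR f"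
  shows "vcomp q \<rho> \<in> AR_part f q"
proof -
  have "(\<Sum>i\<in>UNIV. hom_component q (\<rho> $ i) * pdiff i f) = hom_component (q + (d - 1)) (\<Sum>i\<in>UNIV. \<rho> $ i * pdiff i f)"
    by (simp add: hom_component_sum hom_component_mult[OF pdiff_hom_part[OF assms(1)]])
  then show ?thesis using assms(2) by (simp add: AR_iff AR_part_def hom_component_in_hom_part)
qed

lemma AR_partD: "\<rho> \<in> AR_part f q \<Longrightarrow> \<rho> \<in> AR f" "\<rho> \<in> AR_part f q \<Longrightarrow> \<rho> $ i \<in> hom_part q"
  by (simp_all add: AR_part_def)

lemma subspace_AR_part: "pvec.subspace (AR_part f q)"
proof -
  have "vscale c v = single 0 c *s v" for c and v :: "poly4 ^ 4" by (simp add: vscale_def)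
  moreover have "(0 :: poly4 ^ 4) \<in> AR f" by (simp add: AR_iff)
  ultimately show ?thesis
    unfolding pvec.subspace_def AR_part_def
    using AR_add AR_smult by (auto intro: hom_part_add hom_part_cscale simp: AR_smult simp flip: cscale_def)
qed

definition graded_vecs :: "nat \<Rightarrow> (poly4 ^ 'n) set" where
  "graded_vecs q = vprod (\<lambda>_. hom_part q)"

lemma graded_vecs_span:
  "finite (\<Union>i::'n::finite. axis i ` hom_basis q)"
  "(graded_vecs q :: (poly4 ^ 'n) set) \<subseteq> pvec.span (\<Union>i. axis i ` hom_basis q)"
  unfolding graded_vecs_def
  by (rule vprod_finite_span[of "\<lambda>_. hom_basis q" "\<lambda>_. hom_part q"]; simp add: finite_hom_basis span_hom_basis)+

lemma dim_graded_vecs: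
  "pvec.dim (graded_vecs q :: (poly4 ^ 'n::finite) set) = CARD('n) * poly4.dim (hom_part q)"
  unfolding graded_vecs_def
  using dim_vprod[of "\<lambda>_::'n. hom_part q" "\<lambda>_. hom_basis q"]
  by (simp add: subspace_hom_part finite_hom_basis span_hom_basis)

lemma AR_part_subset_graded_vecs: "AR_part f q \<subseteq> graded_vecs q"
  by (auto simp: AR_part_def graded_vecs_def vprod_def)

lemma AR_part_span: "AR_part f q \<subseteq> pvec.span (\<Union>i. axis i ` hom_basis q)"
  using AR_part_subset_graded_vecs graded_vecs_span(2) by (rule subset_trans)

text \<open>Rank-nullity for the product with the gradient, which maps the vectors of degree k onto
  the part of the Jacobian ideal of degree k + d - 1.\<close>

lemma dim_AR_part:
  assumes "f \<in> hom_part d"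
  shows "pvec.dim (AR_part f k) + poly4.dim (jacobian_ideal f \<inter> hom_part (k + (d - 1))) = 4 * poly4.dim (hom_part k)"
proof -
  define L where "L v = (\<Sum>i\<in>UNIV. v $ i * pdiff i f)" for v :: "poly4 ^ 4"
  have lin: "Vector_Spaces.linear vscale cscale L"
    by (simp add: linear_vscale_cscale_iff L_def distrib_right sum.distrib cscale_mult_left poly4.scale_sum_right)
  have sub: "pvec.subspace (graded_vecs k :: (poly4 ^ 4) set)"
    unfolding graded_vecs_def by (rule subspace_vprod[OF subspace_hom_part])
  have "pvec.dim (graded_vecs k :: (poly4 ^ 4) set) =
      poly4.dim (L ` graded_vecs k) + pvec.dim {v \<in> graded_vecs k. L v = 0}"
    by (rule linear.rank_nullity[OF lin sub graded_vecs_span])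
  moreover have "{v \<in> graded_vecs k. L v = 0} = AR_part f k"
    by (auto simp: graded_vecs_def vprod_def AR_part_def AR_iff L_def)
  moreover have "L ` graded_vecs k = jacobian_ideal f \<inter> hom_part (k + (d - 1))"
  proof (intro equalityI subsetI)
    fix p assume "p \<in> L ` graded_vecs k"
    then obtain v where v: "p = L v" "\<And>i. v $ i \<in> hom_part k" by (auto simp: graded_vecs_def vprod_def)
    have "p \<in> hom_part (k + (d - 1))" unfolding v(1) L_def
      by (intro hom_part_sum hom_part_mult v(2) pdiff_hom_part assms)
    moreover have "p \<in> jacobian_ideal f" using v(1) unfolding L_def by (rule jacobian_idealI)
    ultimately show "p \<in> jacobian_ideal f \<inter> hom_part (k + (d - 1))" by blast
  next
    fix p assume p: "p \<in> jacobian_ideal f \<inter> hom_part (k + (d - 1))"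
    then obtain a where a: "p = (\<Sum>i\<in>UNIV. a i * pdiff i f)" unfolding jacobian_ideal_def by blast
    define v :: "poly4 ^ 4" where "v = (\<chi> i. hom_component k (a i))"
    have "p = hom_component (k + (d - 1)) p"
      using p hom_component_hom_part[of p "k + (d - 1)" "k + (d - 1)"] by simp
    also have "\<dots> = L v"
      unfolding a by (simp add: hom_component_sum hom_component_mult[OF pdiff_hom_part[OF assms]] L_def v_def)
    finally show "p \<in> L ` graded_vecs k"
      by (rule image_eqI) (simp add: graded_vecs_def vprod_def v_def hom_component_in_hom_part)
  qed
  ultimately show ?thesis by (simp add: dim_graded_vecs)
qed

section \<open>Cross products of three vectors\<close>

definition minor2 :: "poly4 ^ 4 \<Rightarrow> poly4 ^ 4 \<Rightarrow> 4 \<Rightarrow> 4 \<Rightarrow> poly4" where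
  "minor2 r s i j = r $ i * s $ j - r $ j * s $ i"

text \<open>Component i is (-1)^i times the 3 x 3 minor of r, s, t without column i, expanded along
  t. These are, up to sign, the coefficients of the wedge product of the three one-forms.\<close>

definition cross :: "poly4 ^ 4 \<Rightarrow> poly4 ^ 4 \<Rightarrow> poly4 ^ 4 \<Rightarrow> poly4 ^ 4" where
  "cross r s t = (\<chi> i.
     if i = 0 then minor2 r s 1 2 * t $ 3 - minor2 r s 1 3 * t $ 2 + minor2 r s 2 3 * t $ 1
     else if i = 1 then minor2 r s 0 3 * t $ 2 - minor2 r s 0 2 * t $ 3 - minor2 r s 2 3 * t $ 0
     else if i = 2 then minor2 r s 0 1 * t $ 3 - minor2 r s 0 3 * t $ 1 + minor2 r s 1 3 * t $ 0
     else minor2 r s 0 2 * t $ 1 - minor2 r s 0 1 * t $ 2 - minor2 r s 1 2 * t $ 0)"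

lemma cross_nth:
  "cross r s t $ 0 = minor2 r s 1 2 * t $ 3 - minor2 r s 1 3 * t $ 2 + minor2 r s 2 3 * t $ 1"
  "cross r s t $ 1 = minor2 r s 0 3 * t $ 2 - minor2 r s 0 2 * t $ 3 - minor2 r s 2 3 * t $ 0"
  "cross r s t $ 2 = minor2 r s 0 1 * t $ 3 - minor2 r s 0 3 * t $ 1 + minor2 r s 1 3 * t $ 0"
  "cross r s t $ 3 = minor2 r s 0 2 * t $ 1 - minor2 r s 0 1 * t $ 2 - minor2 r s 1 2 * t $ 0"
  by (simp_all add: cross_def)

lemma vec4_eq_iff: "(v :: 'a ^ 4) = w \<longleftrightarrow> v $ 0 = w $ 0 \<and> v $ 1 = w $ 1 \<and> v $ 2 = w $ 2 \<and> v $ 3 = w $ 3"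
  unfolding vec_eq_iff by (rule all_4_iff)

lemma cross_add: "cross r s (t + u) = cross r s t + cross r s u"
  by (simp add: vec4_eq_iff cross_nth algebra_simps)

lemma cross_smult: "cross r s (a *s t) = a *s cross r s t"
  by (simp add: vec4_eq_iff cross_nth algebra_simps)

lemma cross_self: "cross r s r = 0" "cross r s s = 0"
  by (simp_all add: vec4_eq_iff cross_nth minor2_def algebra_simps)

text \<open>The cross product is orthogonal to its three factors, and so is the gradient: each difference
  below is the \<open>3 \<times> 3\<close> minor of the factors in which one column is replaced by the column of
  their products with the gradient.\<close>

lemma cross_AR_proportional:
  assumes "r \<in> AR f" "s \<in> AR f" "t \<in> AR f"
  shows "cross r s t $ i * pdiff j f = cross r s t $ j * pdiff i f"
proof -
  define F where "F i = pdiff i f" for i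
  define L where "L u = u $ 0 * F 0 + u $ 1 * F 1 + u $ 2 * F 2 + u $ 3 * F 3" for u :: "poly4 ^ 4"
  have L: "L r = 0" "L s = 0" "L t = 0"
    using assms by (simp_all add: AR_iff sum_4_eq L_def F_def)
  define D where "D a b = L r * minor2 s t a b - L s * minor2 r t a b + L t * minor2 r s a b" for a b
  have D: "D a b = 0" for a b by (simp add: D_def L)
  have "cross r s t $ 0 * F 1 - cross r s t $ 1 * F 0 = D 2 3"
    "cross r s t $ 0 * F 2 - cross r s t $ 2 * F 0 = - D 1 3"
    "cross r s t $ 0 * F 3 - cross r s t $ 3 * F 0 = D 1 2"
    "cross r s t $ 1 * F 2 - cross r s t $ 2 * F 1 = D 0 3"
    "cross r s t $ 1 * F 3 - cross r s t $ 3 * F 1 = - D 0 2"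
    "cross r s t $ 2 * F 3 - cross r s t $ 3 * F 2 = D 0 1"
    by (simp_all add: D_def L_def cross_nth minor2_def algebra_simps)
  then have "\<forall>i j. cross r s t $ i * F j = cross r s t $ j * F i"
    by (simp add: D all_4_iff)
  then show ?thesis by (simp add: F_def)
qed

lemma hom_component_cross:
  assumes "\<And>i. r $ i \<in> hom_part d" "\<And>i. s $ i \<in> hom_part e"
  shows "vcomp (q + (d + e)) (cross r s t) = cross r s (vcomp q t)"
proof -
  have "minor2 r s i j \<in> hom_part (d + e)" for i j
    unfolding minor2_def by (intro hom_part_diff hom_part_mult assms)
  from hom_component_mult_left[OF this]
  have "hom_component (q + (d + e)) (minor2 r s i j * p) = minor2 r s i j * hom_component q p" for i j p
    by simp
  then show ?thesis
    by (simp add: vec4_eq_iff cross_nth hom_component_add hom_component_diff)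
qed


section \<open>The wedge product of three one-forms\<close>

lemma omega_nth: "omega r $ X = (\<Sum>i\<in>UNIV. if X = {i} then r $ i else 0)"
  by (auto simp: omega_def dvar_def intro!: sum.cong)

lemma omega_singleton [simp]: "omega r $ {i} = r $ i"
  by (simp add: omega_nth)

lemma omega_not_singleton: "\<forall>i. X \<noteq> {i} \<Longrightarrow> omega r $ X = 0"
  by (simp add: omega_nth)

text \<open>A one-form has coefficients only at singletons, so only the sets \<open>K - {j}\<close>
  contribute; sorting j into place passes the elements of \<open>K\<close> above it.\<close>

lemma wedge_omega:
  "wedge \<alpha> (omega r) $ K = (\<Sum>j\<in>K. (-1) ^ card {i \<in> K. j < i} * \<alpha> $ (K - {j}) * r $ j)"
proof -
  define g where "g I = (-1) ^ card {(i, j). i \<in> I \<and> j \<in> K - I \<and> j < i} * \<alpha> $ I * omega r $ (K - I)" for I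
  have inj: "inj_on (\<lambda>j. K - {j}) K" by (rule inj_onI) blast
  have "g I = 0" if "I \<in> Pow K - (\<lambda>j. K - {j}) ` K" for I
  proof -
    have "K - I \<noteq> {j}" for j
    proof
      assume j: "K - I = {j}"
      then have "I = K - {j}" using that by blast
      then show False using that j by blast
    qed
    then show ?thesis by (simp add: g_def omega_not_singleton)
  qed
  note g0 = this
  have "wedge \<alpha> (omega r) $ K = sum g (Pow K)" by (simp add: wedge_def g_def)
  also have "\<dots> = sum g ((\<lambda>j. K - {j}) ` K)"
    by (rule sum.mono_neutral_right) (use g0 in auto)
  also have "\<dots> = (\<Sum>j\<in>K. g (K - {j}))" by (simp add: sum.reindex[OF inj])
  also have "\<dots> = (\<Sum>j\<in>K. (-1) ^ card {i \<in> K. j < i} * \<alpha> $ (K - {j}) * r $ j)"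
  proof (rule sum.cong)
    fix j assume j: "j \<in> K"
    have "{(i, j'). i \<in> K - {j} \<and> j' \<in> K - (K - {j}) \<and> j' < i} = (\<lambda>i. (i, j)) ` {i \<in> K. j < i}"
      using j by auto
    then have "card {(i, j'). i \<in> K - {j} \<and> j' \<in> K - (K - {j}) \<and> j' < i} = card {i \<in> K. j < i}"
      by (simp add: card_image inj_on_def)
    moreover have "K - (K - {j}) = {j}" using j by blast
    ultimately show "g (K - {j}) = (-1) ^ card {i \<in> K. j < i} * \<alpha> $ (K - {j}) * r $ j"
      by (simp add: g_def)
  qed simp
  finally show ?thesis .
qed

lemma less_4 [simp]: "(0::4) < 1" "(0::4) < 2" "(0::4) < 3" "(1::4) < 2" "(1::4) < 3" "(2::4) < 3"
  by (simp_all add: less_bit0_def bit0.Rep_numeral bit0.Rep_1 bit0.Rep_0)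

lemma wedge_omega3_triple:
  assumes "a < b" "b < c"
  shows "wedge (wedge (omega r) (omega s)) (omega t) $ {a, b, c} =
     minor2 r s a b * t $ c - minor2 r s a c * t $ b + minor2 r s b c * t $ a"
proof -
  have pair: "wedge (omega r) (omega s) $ {i, j} = minor2 r s i j" if "i < j" for i j
  proof -
    have cards: "card {k \<in> {i, j}. i < k} = card {j}" "card {k \<in> {i, j}. j < k} = card ({} :: 4 set)"
      using that by (intro arg_cong[of _ _ card]; auto)+
    have diffs: "{i, j} - {i} = {j}" "{i, j} - {j} = {i}" and "i \<noteq> j" using that by auto
    from \<open>i \<noteq> j\<close> have "sum h {i, j} = h i + h j" for h :: "4 \<Rightarrow> poly4" by simp
    then have "wedge (omega r) (omega s) $ {i, j} = (-1) ^ card {j} * omega r $ {j} * s $ i +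
        (-1) ^ card ({} :: 4 set) * omega r $ {i} * s $ j"
      by (simp only: wedge_omega cards diffs)
    then show ?thesis by (simp add: minor2_def)
  qed
  have "a < c" using assms by simp
  have cards: "card {k \<in> {a, b, c}. a < k} = card {b, c}" "card {k \<in> {a, b, c}. b < k} = card {c}"
    "card {k \<in> {a, b, c}. c < k} = card ({} :: 4 set)"
    using assms \<open>a < c\<close> by (intro arg_cong[of _ _ card]; auto)+
  have diffs: "{a, b, c} - {a} = {b, c}" "{a, b, c} - {b} = {a, c}" "{a, b, c} - {c} = {a, b}"
    and ne: "a \<noteq> b" "a \<noteq> c" "b \<noteq> c" using assms \<open>a < c\<close> by auto
  from ne have "sum h {a, b, c} = h a + (h b + h c)" for h :: "4 \<Rightarrow> poly4" by simp
  then have "wedge (wedge (omega r) (omega s)) (omega t) $ {a, b, c} =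
      (-1) ^ card {b, c} * minor2 r s b c * t $ a + ((-1) ^ card {c} * minor2 r s a c * t $ b +
      (-1) ^ card ({} :: 4 set) * minor2 r s a b * t $ c)"
    by (simp only: wedge_omega[of "wedge (omega r) (omega s)"] cards diffs pair[OF assms(1)] pair[OF assms(2)]
        pair[OF \<open>a < c\<close>])
  then show ?thesis using ne by simp
qed

lemma wedge_omega3_eq_0:
  assumes "cross r s t = 0"
  shows "wedge (wedge (omega r) (omega s)) (omega t) = 0"
proof -
  have "wedge (wedge (omega r) (omega s)) (omega t) $ K = 0" for K
  proof (cases "card K = 3")
    \<comment> \<open>Removing two elements from \<open>K\<close> leaves a singleton only if
      \<open>K\<close> has three elements.\<close>
    case False
    have "wedge (omega r) (omega s) $ (K - {j}) = 0" if j: "j \<in> K" for j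
      unfolding wedge_omega
    proof (rule sum.neutral, rule ballI)
      fix i assume i: "i \<in> K - {j}"
      have "K - {j} - {i} \<noteq> {l}" for l
      proof
        assume l: "K - {j} - {i} = {l}"
        then have "K = {i, j, l}" "i \<noteq> j" "i \<noteq> l" "j \<noteq> l" using i j by blast+
        then show False using False by simp
      qed
      then show "(-1) ^ card {k \<in> K - {j}. i < k} * omega r $ (K - {j} - {i}) * s $ i = 0"
        by (simp add: omega_not_singleton)
    qed
    then show ?thesis by (simp add: wedge_omega[of "wedge (omega r) (omega s)"])
  next
    case True
    have "card (- K) = 1" using True by (simp add: Compl_eq_Diff_UNIV card_Diff_subset)
    then obtain l where "- K = {l}" by (rule card_1_singletonE)
    then have K: "K = UNIV - {l}" by blast
    have "\<forall>l::4. UNIV - {l} = {0,1,2} \<or> UNIV - {l} = {0,1,3} \<or> UNIV - {l} = {0,2,3} \<or> UNIV - {l} = {1,2,3}"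
      unfolding all_4_iff UNIV_4_eq by auto
    then have "K = {0,1,2} \<or> K = {0,1,3} \<or> K = {0,2,3} \<or> K = {1,2,3}" using K by blast
    moreover have "\<forall>i. cross r s t $ i = 0" using assms by simp
    ultimately show ?thesis
      unfolding all_4_iff cross_nth
      using wedge_omega3_triple[of 0 1 2 r s t] wedge_omega3_triple[of 0 1 3 r s t]
        wedge_omega3_triple[of 0 2 3 r s t] wedge_omega3_triple[of 1 2 3 r s t]
      by (auto simp: algebra_simps)
  qed
  then show ?thesis by (simp add: vec_eq_iff)
qed

lemma omega_eq_combination:
  assumes "omega t = a *s omega r + b *s omega s"
  shows "t = a *s r + b *s s"
proof -
  have "omega t $ {i} = (a *s omega r + b *s omega s) $ {i}" for i using assms by simp
  then show ?thesis by (simp add: vec_eq_iff)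
qed


section \<open>The ideal of a tame pair of syzygies\<close>

lemma minor2_combination:
  "minor2 (a *s r + b *s s) (c *s r + e *s s) i j = (a * e - b * c) * minor2 r s i j"
  by (simp add: minor2_def algebra_simps)

lemma dim_hom_part_rat:
  "(of_nat (poly4.dim (hom_part k)) :: rat) = (of_nat k + 1) * (of_nat k + 2) * (of_nat k + 3) / 6"
proof -
  have 1: "((k + 3) choose 3) * 3 = (k + 3) * ((k + 2) choose 2)"
    using Suc_times_binomial_eq[of "k + 2" 2] by (simp only: numeral_eq_Suc pred_numeral_simps add_Suc_right add_0_right BitM.simps)
  have 2: "((k + 2) choose 2) * 2 = (k + 2) * (k + 1)"
    using Suc_times_binomial_eq[of "k + 1" 1] by (simp add: numeral_2_eq_2)
  have six: "x * 6 = a * b * c" if "x * 3 = a * y" "y * 2 = b * c" for x y a b c :: nat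
  proof -
    have "x * 6 = (x * 3) * 2" by simp
    also have "\<dots> = a * (y * 2)" using that(1) by simp
    also have "\<dots> = a * b * c" by (simp add: that(2) mult.assoc)
    finally show ?thesis .
  qed
  from arg_cong[OF six[OF 1 2], of "of_nat :: nat \<Rightarrow> rat"]
  have "of_nat ((k + 3) choose 3) * 6 = (of_nat k + 3) * (of_nat k + 2) * (of_nat k + 1 :: rat)"
    by (simp only: of_nat_mult of_nat_add of_nat_numeral of_nat_1)
  moreover have "x = c * b * a / 6" if "x * 6 = a * b * c" for x a b c :: rat
    using that by (simp add: field_simps)
  ultimately show ?thesis unfolding dim_hom_part by blast
qed

lemma all_3_iff: "(\<forall>i::3. P i) \<longleftrightarrow> P 0 \<and> P 1 \<and> P 2"
proof -
  have "(3::3) = 0" by simp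
  then show ?thesis using forall_3[of P] by metis
qed

text \<open>The inequality \<open>growth\<close> carries the information that the singular subscheme
  has codimension at least two: a linearly growing Hilbert function satisfies it for large
  n.\<close>

locale tame_pair =
  fixes f :: poly4 and d e1 e2 e3 :: nat and r1 r2 :: "poly4 ^ 4" and n :: nat
  assumes f: "f \<in> hom_part d" and deg: "d - 1 = e1 + e2 + e3" "e1 \<le> e2" "e2 \<le> e3"
    and r1: "r1 \<in> AR_part f e1" and r2: "r2 \<in> AR_part f e2" and tame: "tame_wrt f r1 r2"
    and growth: "hilbert_function (jacobian_ideal f) (2 * n) < (n + 1)\<^sup>2"
begin

abbreviation F :: "4 \<Rightarrow> poly4" where "F i \<equiv> pdiff i f"

abbreviation C :: "poly4 ^ 4 \<Rightarrow> poly4 ^ 4" where "C \<equiv> cross r1 r2"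

lemma F_hom_part: "F i \<in> hom_part (e1 + e2 + e3)"
  using pdiff_hom_part[OF f, of i] deg(1) by simp

lemma r_AR: "r1 \<in> AR f" "r2 \<in> AR f"
  using r1 r2 AR_partD(1) by blast+

lemma r_hom_part: "r1 $ i \<in> hom_part e1" "r2 $ i \<in> hom_part e2"
  using r1 r2 AR_partD(2) by blast+

text \<open>Otherwise J would be 0, whereas \<open>growth\<close> provides a nonzero
  element.\<close>

lemma ex_F_nonzero: "\<exists>j. F j \<noteq> 0"
proof (rule ccontr)
  assume "\<not> (\<exists>j. F j \<noteq> 0)"
  then have "b = 0" if "b \<in> jacobian_ideal f" for b using that by (auto simp: jacobian_ideal_def)
  then show False using ideal_meets_three_vars[OF hom_ideal_jacobian[OF f] growth] by metis
qed

text \<open>Tameness in terms of the cross product; the later arguments use tameness only in this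
  form.\<close>

lemma combination_if_cross_eq_0:
  assumes "t \<in> AR f" "C t = 0"
  shows "\<exists>a b. t = a *s r1 + b *s r2"
proof -
  have "omega t \<in> {\<eta> \<in> Omega1_0 f. wedge (wedge (omega r1) (omega r2)) \<eta> = 0}"
    using assms wedge_omega3_eq_0 by (simp add: Omega1_0_def)
  then obtain a b where "omega t = a *s omega r1 + b *s omega r2"
    using tame unfolding tame_wrt_def by blast
  then show ?thesis using omega_eq_combination by blast
qed

lemma C_combination: "C (a *s r1 + b *s r2) = 0"
  by (simp add: cross_add cross_smult cross_self)

lemma combination_AR: "a *s r1 + b *s r2 \<in> AR f"
  by (intro AR_add AR_smult r_AR)

text \<open>If \<open>\<rho>\<^sub>1, \<rho>\<^sub>2\<close> were dependent, tameness would make all syzygies pairwise dependent, which fails for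
  the Koszul syzygies.\<close>

lemma independent_syzygies:
  assumes "a *s r1 + b *s r2 = 0"
  shows "a = 0 \<and> b = 0"
proof (rule ccontr)
  assume ab: "\<not> (a = 0 \<and> b = 0)"
  have minor: "minor2 r1 r2 i j = 0" for i j
  proof -
    have eq: "a * r1 $ i + b * r2 $ i = 0" "a * r1 $ j + b * r2 $ j = 0"
      using assms by (simp_all add: vec_eq_iff)
    have "a * minor2 r1 r2 i j = (a * r1 $ i + b * r2 $ i) * r2 $ j - (a * r1 $ j + b * r2 $ j) * r2 $ i"
      "b * minor2 r1 r2 i j = (a * r1 $ j + b * r2 $ j) * (- 1) * (- r1 $ i) - (a * r1 $ i + b * r2 $ i) * r1 $ j"
      by (simp_all add: minor2_def algebra_simps)
    then have "a * minor2 r1 r2 i j = 0" "b * minor2 r1 r2 i j = 0" by (simp_all add: eq)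
    then show ?thesis using ab by auto
  qed
  have "C t = 0" for t by (simp add: vec4_eq_iff cross_nth minor)
  then have comb: "\<exists>a b. t = a *s r1 + b *s r2" if "t \<in> AR f" for t
    using that combination_if_cross_eq_0 by blast
  obtain j where j: "F j \<noteq> 0" using ex_F_nonzero by blast
  \<comment> \<open>The Koszul syzygies pairing F_i with the nonzero F_j.\<close>
  define kos :: "4 \<Rightarrow> poly4 ^ 4" where "kos i = (\<chi> l. if l = i then F j else if l = j then - F i else 0)" for i
  have kos: "kos i \<in> AR f" if "i \<noteq> j" for i
  proof -
    have "(\<Sum>l\<in>UNIV. kos i $ l * F l) = (\<Sum>l\<in>{i, j}. kos i $ l * F l)"
      by (rule sum.mono_neutral_right) (auto simp: kos_def)
    also have "\<dots> = 0" using that by (simp add: kos_def mult.commute)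
    finally show ?thesis by (simp add: AR_iff)
  qed
  define i k :: 4 where "i = (if j = 0 then 1 else 0)" and "k = (if j = 0 \<or> j = 1 then 2 else 1)"
  have ik: "i \<noteq> j" "k \<noteq> j" "i \<noteq> k" by (auto simp: i_def k_def)
  obtain a1 b1 where 1: "kos i = a1 *s r1 + b1 *s r2" using comb kos ik by blast
  obtain a2 b2 where 2: "kos k = a2 *s r1 + b2 *s r2" using comb kos ik by blast
  \<comment> \<open>Both syzygies are combinations of r1 and r2, so each 2 x 2 minor is a
    determinant times a minor of r1, r2, which is 0.\<close>
  have "minor2 (kos i) (kos k) i k = 0" unfolding 1 2 minor2_combination by (simp add: minor)
  moreover have "minor2 (kos i) (kos k) i k = F j * F j" using ik by (simp add: minor2_def kos_def)
  ultimately show False using j by simp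
qed

definition I :: "poly4 set" where
  "I = {h. \<exists>t\<in>AR f. C t = (\<chi> i. h * F i)}"

lemma I_iff: "h \<in> I \<longleftrightarrow> (\<exists>t\<in>AR f. \<forall>i. C t $ i = h * F i)"
  by (simp add: I_def vec_eq_iff)

text \<open>Proportionality to the gradient makes b C_j divisible by the nonzero F_j for every b in
  J. As J has codimension at least two, C_j itself is divisible, and the quotient serves for all
  components.\<close>

lemma cross_eq_mult_gradient:
  assumes t: "t \<in> AR f"
  shows "\<exists>h. \<forall>i. C t $ i = h * F i"
proof -
  obtain j where j: "F j \<noteq> 0" using ex_F_nonzero by blast
  have prp: "C t $ i * F l = C t $ l * F i" for i l
    by (rule cross_AR_proportional[OF r_AR t])
  have "F j dvd C t $ j"
  proof (rule dvd_if_ideal_mult_dvd[OF hom_ideal_jacobian[OF f] growth F_hom_part j])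
    fix b assume "b \<in> jacobian_ideal f"
    then obtain a where "b = (\<Sum>i\<in>UNIV. a i * F i)" unfolding jacobian_ideal_def by blast
    then have "b * C t $ j = (\<Sum>i\<in>UNIV. a i * (C t $ j * F i))"
      by (simp only: sum_distrib_right mult.assoc mult.commute[of "F _" "C t $ j"])
    also have "\<dots> = (\<Sum>i\<in>UNIV. a i * (C t $ i * F j))" by (simp only: prp[of j])
    also have "\<dots> = F j * (\<Sum>i\<in>UNIV. a i * C t $ i)" by (simp add: sum_distrib_left mult.assoc mult.left_commute mult.commute[of "F j"])
    finally show "F j dvd b * C t $ j" by simp
  qed
  then obtain h where h: "C t $ j = F j * h" by (rule dvdE)
  have "C t $ i = h * F i" for i
  proof -
    have "C t $ i * F j = h * F i * F j" using prp[of i j] by (simp add: h ac_simps)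
    then show ?thesis using j by simp
  qed
  then show ?thesis by blast
qed

lemma C_vcomp: "vcomp (q + (e1 + e2)) (C t) = C (vcomp q t)"
  by (rule hom_component_cross) (rule r_hom_part)+

text \<open>Origin of the shift by e3: C raises degrees by e1 + e2 and multiplication by F_i raises
  them by e1 + e2 + e3.\<close>

lemma C_vcomp_gradient:
  assumes "\<forall>i. C t $ i = h * F i"
  shows "\<forall>i. C (vcomp (k + e3) t) $ i = hom_component k h * F i"
proof
  fix i
  have "C (vcomp (k + e3) t) $ i = vcomp (k + e3 + (e1 + e2)) (C t) $ i" by (simp add: C_vcomp)
  also have "\<dots> = hom_component (k + (e1 + e2 + e3)) (h * F i)" using assms by (simp add: ac_simps)
  also have "\<dots> = hom_component k h * F i" by (simp add: hom_component_mult[OF F_hom_part])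
  finally show "C (vcomp (k + e3) t) $ i = hom_component k h * F i" .
qed

lemma hom_ideal_I: "hom_ideal I"
  unfolding hom_ideal_def is_ideal_def
proof (intro conjI ballI allI)
  have "C 0 = 0" using cross_smult[of r1 r2 0 0] by simp
  moreover have "0 \<in> AR f" by (simp add: AR_iff)
  ultimately show "0 \<in> I" unfolding I_iff by (intro bexI[of _ 0]) auto
next
  fix p q assume "p \<in> I" "q \<in> I"
  then obtain t u where "t \<in> AR f" "\<forall>i. C t $ i = p * F i" "u \<in> AR f" "\<forall>i. C u $ i = q * F i"
    unfolding I_iff by blast
  then show "p + q \<in> I" unfolding I_iff
    by (intro bexI[of _ "t + u"]) (simp_all add: cross_add AR_add distrib_right)
next
  fix p c assume "p \<in> I"
  then obtain t where "t \<in> AR f" "\<forall>i. C t $ i = p * F i" unfolding I_iff by blast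
  then show "c * p \<in> I" unfolding I_iff
    by (intro bexI[of _ "c *s t"]) (simp_all add: cross_smult AR_smult mult.assoc)
next
  fix p k assume "p \<in> I"
  then obtain t where t: "t \<in> AR f" "\<forall>i. C t $ i = p * F i" unfolding I_iff by blast
  then show "hom_component k p \<in> I" unfolding I_iff
    using C_vcomp_gradient[OF t(2)] AR_partD(1)[OF vcomp_AR[OF f t(1)]]
    by (intro bexI[of _ "vcomp (k + e3) t"])
qed

lemma vcomp_combination:
  assumes "e2 \<le> k"
  shows "vcomp k (a *s r1 + b *s r2) = hom_component (k - e1) a *s r1 + hom_component (k - e2) b *s r2"
proof -
  have "e1 \<le> k" using assms deg by simp
  then show ?thesis using assms
    by (simp add: vec_eq_iff hom_component_add hom_component_mult[OF r_hom_part(1)] hom_component_mult[OF r_hom_part(2)])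
qed

lemma AR_part_combinationE:
  assumes "t \<in> AR_part f k" "C t = 0" "e2 \<le> k"
  obtains a b where "a \<in> hom_part (k - e1)" "b \<in> hom_part (k - e2)" "t = a *s r1 + b *s r2"
proof -
  obtain a b where ab: "t = a *s r1 + b *s r2"
    using combination_if_cross_eq_0[OF AR_partD(1)[OF assms(1)] assms(2)] by blast
  have "t = vcomp k t"
    using hom_component_hom_part[OF AR_partD(2)[OF assms(1)], of k] by (simp add: vec_eq_iff)
  also have "\<dots> = hom_component (k - e1) a *s r1 + hom_component (k - e2) b *s r2"
    unfolding ab by (rule vcomp_combination[OF assms(3)])
  finally show ?thesis using that hom_component_in_hom_part by blast
qed

lemma combination_AR_part:
  assumes "a \<in> hom_part k" "b \<in> hom_part l" "k + e1 = m" "l + e2 = m"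
  shows "a *s r1 + b *s r2 \<in> AR_part f m"
  using combination_AR[of a b] hom_part_mult[OF assms(1) r_hom_part(1)] hom_part_mult[OF assms(2) r_hom_part(2)]
  by (auto simp: AR_part_def assms(3,4) intro!: hom_part_add)

text \<open>Degree k + e3 of the exact sequence 0 -> S(-e1) + S(-e2) -> AR(f) -> I(-e3) -> 0. Since
  e1 \<le> e2 \<le> e3, no subtraction is truncated.\<close>

lemma dim_AR_part_eq:
  "pvec.dim (AR_part f (k + e3)) = poly4.dim (hom_part (k + e3 - e1)) + poly4.dim (hom_part (k + e3 - e2)) +
     poly4.dim (I \<inter> hom_part k)"
proof -
  obtain j where j: "F j \<noteq> 0" using ex_F_nonzero by blast
  have linC: "Vector_Spaces.linear vscale vscale C"
    by (simp add: linear_vscale_vscale_iff cross_add cross_smult vscale_def)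
  have "pvec.dim (AR_part f (k + e3)) =
      pvec.dim (C ` AR_part f (k + e3)) + pvec.dim {t \<in> AR_part f (k + e3). C t = 0}"
    by (rule linear.rank_nullity[OF linC subspace_AR_part graded_vecs_span(1) AR_part_span])
  moreover have "pvec.dim (C ` AR_part f (k + e3)) = poly4.dim (I \<inter> hom_part k)"
  proof -
    define G :: "poly4 \<Rightarrow> poly4 ^ 4" where "G h = (\<chi> i. h * F i)" for h
    have linG: "Vector_Spaces.linear cscale vscale G"
      by (simp add: linear_cscale_vscale_iff G_def vec_eq_iff distrib_right cscale_mult_left)
    have "C ` AR_part f (k + e3) = G ` (I \<inter> hom_part k)"
    proof (intro equalityI subsetI)
      fix v assume "v \<in> C ` AR_part f (k + e3)"
      then obtain t where t: "t \<in> AR_part f (k + e3)" "v = C t" by blast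
      obtain h where h: "\<forall>i. C t $ i = h * F i" using cross_eq_mult_gradient AR_partD(1)[OF t(1)] by blast
      have "t = vcomp (k + e3) t"
        using hom_component_hom_part[OF AR_partD(2)[OF t(1)], of "k + e3"] by (simp add: vec_eq_iff)
      then have "C t $ i = hom_component k h * F i" for i using C_vcomp_gradient[OF h, of k] by metis
      then have "v = G (hom_component k h)" by (simp add: t(2) G_def vec_eq_iff)
      moreover have "h \<in> I" using h AR_partD(1)[OF t(1)] by (auto simp: I_iff)
      ultimately show "v \<in> G ` (I \<inter> hom_part k)"
        using hom_idealD(5)[OF hom_ideal_I] hom_component_in_hom_part by blast
    next
      fix v assume "v \<in> G ` (I \<inter> hom_part k)"
      then obtain h where h: "h \<in> I" "h \<in> hom_part k" "v = G h" by blast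
      then obtain t where t: "t \<in> AR f" "\<forall>i. C t $ i = h * F i" by (auto simp: I_iff)
      have "C (vcomp (k + e3) t) = v"
        using C_vcomp_gradient[OF t(2), of k] hom_component_hom_part[OF h(2), of k]
        by (simp add: h(3) G_def vec_eq_iff)
      then show "v \<in> C ` AR_part f (k + e3)" using vcomp_AR[OF f t(1)] by blast
    qed
    moreover have "pvec.dim (G ` (I \<inter> hom_part k)) = poly4.dim (I \<inter> hom_part k)"
      using j by (intro linear.dim_inj_image[OF linG subspace_ideal_part[OF hom_ideal_I] finite_hom_basis ideal_part_span])
        (auto simp: G_def vec_eq_iff)
    ultimately show ?thesis by simp
  qed
  moreover have "pvec.dim {t \<in> AR_part f (k + e3). C t = 0} =
      poly4.dim (hom_part (k + e3 - e1)) + poly4.dim (hom_part (k + e3 - e2))"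
  proof -
    define X :: "(poly4 ^ 2) set" where "X = vprod (\<lambda>i. hom_part (if i = 0 then k + e3 - e1 else k + e3 - e2))"
    define G :: "poly4 ^ 2 \<Rightarrow> poly4 ^ 4" where "G v = v $ 0 *s r1 + v $ 1 *s r2" for v
    have sub: "poly4.subspace (hom_part (if i = 0 then k + e3 - e1 else k + e3 - e2))" for i :: 2
      by (rule subspace_hom_part)
    have W: "finite (hom_basis (if i = 0 then k + e3 - e1 else k + e3 - e2))"
      "hom_part (if i = 0 then k + e3 - e1 else k + e3 - e2) \<subseteq>
       poly4.span (hom_basis (if i = 0 then k + e3 - e1 else k + e3 - e2))" for i :: 2
      by (auto simp: finite_hom_basis span_hom_basis)
    have linG: "Vector_Spaces.linear vscale vscale G"
      by (simp add: linear_vscale_vscale_iff G_def vec_eq_iff distrib_right cscale_mult_left poly4.scale_right_distrib)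
    have "{t \<in> AR_part f (k + e3). C t = 0} = G ` X"
    proof (intro equalityI subsetI)
      fix t assume "t \<in> {t \<in> AR_part f (k + e3). C t = 0}"
      then obtain a b where ab: "a \<in> hom_part (k + e3 - e1)" "b \<in> hom_part (k + e3 - e2)" "t = a *s r1 + b *s r2"
        using AR_part_combinationE[of t "k + e3"] deg by auto
      have "t = G (\<chi> i. if i = 0 then a else b)" by (simp add: G_def ab(3))
      moreover have "(\<chi> i. if i = 0 then a else b) \<in> X" using ab by (simp add: X_def vprod_def all_2_iff)
      ultimately show "t \<in> G ` X" by blast
    next
      fix t assume "t \<in> G ` X"
      then obtain v where v: "v \<in> X" "t = G v" by blast
      then have "v $ 0 \<in> hom_part (k + e3 - e1)" "v $ 1 \<in> hom_part (k + e3 - e2)"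
        by (simp_all add: X_def vprod_def all_2_iff)
      then have "t \<in> AR_part f (k + e3)"
        unfolding v(2) G_def by (rule combination_AR_part) (use deg in auto)
      then show "t \<in> {t \<in> AR_part f (k + e3). C t = 0}" by (simp add: v(2) G_def C_combination)
    qed
    moreover have "pvec.dim (G ` X) = pvec.dim X"
    proof (rule linear.dim_inj_image[OF linG])
      show "pvec.subspace X" unfolding X_def by (rule subspace_vprod[OF sub])
      show "finite (\<Union>i::2. axis i ` hom_basis (if i = 0 then k + e3 - e1 else k + e3 - e2))"
        "X \<subseteq> pvec.span (\<Union>i::2. axis i ` hom_basis (if i = 0 then k + e3 - e1 else k + e3 - e2))"
        unfolding X_def by (rule vprod_finite_span[OF W])+
      fix v assume "G v = 0"
      then have "v $ 0 = 0 \<and> v $ 1 = 0" unfolding G_def by (rule independent_syzygies)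
      then show "v = 0" by (simp add: vec_eq_iff all_2_iff)
    qed
    moreover have "pvec.dim X = poly4.dim (hom_part (k + e3 - e1)) + poly4.dim (hom_part (k + e3 - e2))"
      unfolding X_def dim_vprod[OF sub W] UNIV_2_eq by simp
    ultimately show ?thesis by simp
  qed
  ultimately show ?thesis by simp
qed

text \<open>Apart from the Hilbert function of S/I, these are the dimensions belonging to a free
  surface with exponents e1, e2, e3. All terms are arranged to be added, apart from the exact
  subtractions inside the degrees.\<close>

lemma hilbert_function_jacobian:
  "hilbert_function (jacobian_ideal f) (k + e3 + (e1 + e2 + e3)) + hilbert_function I k + 4 * poly4.dim (hom_part (k + e3)) =
   poly4.dim (hom_part (k + e3 + (e1 + e2 + e3))) + poly4.dim (hom_part (k + e3 - e1)) +
   poly4.dim (hom_part (k + e3 - e2)) + poly4.dim (hom_part k)"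
  using dim_AR_part[OF f, of "k + e3", unfolded deg(1)] dim_AR_part_eq[of k] hilbert_function_plus_dim[of I k]
    hilbert_function_plus_dim[of "jacobian_ideal f" "k + e3 + (e1 + e2 + e3)"]
  by linarith

text \<open>For lifts \<open>\<sigma>\<^sub>p, \<sigma>\<^sub>q\<close> of a regular pair to \<open>AR(f)\<close>, the syzygy \<open>p \<sigma>\<^sub>q - q \<sigma>\<^sub>p\<close> is a combination
  of \<open>\<rho>\<^sub>1, \<rho>\<^sub>2\<close> whose coefficients are multiplied into \<open>(p, q)\<close> by all of \<open>I\<close>, hence lie in \<open>(p, q)\<close>;
  correcting \<open>\<sigma>\<^sub>p\<close> accordingly makes it divisible by \<open>p\<close>, and the quotient maps to \<open>1\<close>.\<close>

lemma one_in_I_if_regular_pair: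
  assumes "regular_pair I p q"
  shows "1 \<in> I"
proof -
  note pq = assms[unfolded regular_pair_def]
  obtain sp where sp: "sp \<in> AR f" "\<forall>i. C sp $ i = p * F i" using pq unfolding I_iff by blast
  obtain sq where sq: "sq \<in> AR f" "\<forall>i. C sq $ i = q * F i" using pq unfolding I_iff by blast
  have cocycle: "\<exists>a b. g *s t - h *s s = a *s r1 + b *s r2"
    if "s \<in> AR f" "\<forall>i. C s $ i = g * F i" "t \<in> AR f" "\<forall>i. C t $ i = h * F i" for g h s t
  proof (rule combination_if_cross_eq_0)
    show "g *s t - h *s s \<in> AR f" using that by (intro AR_diff AR_smult)
    have "C (g *s t - h *s s) = g *s C t - h *s C s"
      using cross_add[of r1 r2 "g *s t - h *s s" "h *s s"] by (simp add: cross_smult)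
    then show "C (g *s t - h *s s) = 0" using that(2,4) by (simp add: vec_eq_iff)
  qed
  obtain a b where ab: "p *s sq - q *s sp = a *s r1 + b *s r2" using cocycle[OF sp sq] by blast
  have both: "\<exists>s t. (r * a = p * s + q * t) \<and> (\<exists>s t. r * b = p * s + q * t)" if r: "r \<in> I" for r
  proof -
    obtain sr where sr: "sr \<in> AR f" "\<forall>i. C sr $ i = r * F i" using r unfolding I_iff by blast
    obtain a1 b1 where 1: "r *s sq - q *s sr = a1 *s r1 + b1 *s r2" using cocycle[OF sr sq] by blast
    obtain a2 b2 where 2: "r *s sp - p *s sr = a2 *s r1 + b2 *s r2" using cocycle[OF sr sp] by blast
    \<comment> \<open>Uses r (p sq - q sp) = p (r sq - q sr) - q (r sp - p sr); independence of r1
      and r2 then permits comparing coefficients.\<close>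
    have "(r * a - (p * a1 - q * a2)) *s r1 + (r * b - (p * b1 - q * b2)) *s r2 =
        r *s (a *s r1 + b *s r2) - p *s (a1 *s r1 + b1 *s r2) + q *s (a2 *s r1 + b2 *s r2)"
      by (simp add: vec_eq_iff algebra_simps)
    also have "\<dots> = 0"
      unfolding ab[symmetric] 1[symmetric] 2[symmetric] by (simp add: vec_eq_iff algebra_simps)
    finally have "r * a - (p * a1 - q * a2) = 0 \<and> r * b - (p * b1 - q * b2) = 0"
      by (rule independent_syzygies)
    then have "r * a = p * a1 + q * (- a2)" "r * b = p * b1 + q * (- b2)" by simp_all
    then show ?thesis by blast
  qed
  obtain a1 a2 where a: "a = p * a1 + q * a2" using pq both by meson
  obtain b1 b2 where b: "b = p * b1 + q * b2" using pq both by meson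
  \<comment> \<open>Moving the multiples of p and of q in \<open>ab\<close> to opposite sides gives
    p (sq - a1 r1 - b1 r2) = q (sp + a2 r1 + b2 r2).\<close>
  define t where "t = sp + (a2 *s r1 + b2 *s r2)"
  have "p *s (sq - (a1 *s r1 + b1 *s r2)) = q *s t"
  proof -
    have "p *s (sq - (a1 *s r1 + b1 *s r2)) - q *s t =
        (p *s sq - q *s sp) - ((p * a1 + q * a2) *s r1 + (p * b1 + q * b2) *s r2)"
      by (simp add: t_def vec_eq_iff algebra_simps)
    also have "\<dots> = 0" unfolding ab a[symmetric] b[symmetric] by simp
    finally show ?thesis by simp
  qed
  then have "p * (sq - (a1 *s r1 + b1 *s r2)) $ i = q * t $ i" for i
    by (metis vector_smult_component)
  then have "p dvd t $ i" for i using pq by blast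
  then have "\<exists>u. t $ i = p * u" for i by (auto elim: dvdE)
  then obtain u where u: "\<And>i. t $ i = p * u i" by metis
  define w :: "poly4 ^ 4" where "w = (\<chi> i. u i)"
  have tw: "t = p *s w" by (simp add: vec_eq_iff u w_def)
  have p: "p \<noteq> 0" using pq by blast
  have "t \<in> AR f" unfolding t_def by (intro AR_add[OF sp(1)] combination_AR)
  then have "p * (\<Sum>i\<in>UNIV. w $ i * F i) = 0" by (simp add: tw AR_iff sum_distrib_left mult.assoc)
  then have "w \<in> AR f" using p by (simp add: AR_iff)
  moreover have "C w $ i = 1 * F i" for i
  proof -
    have "p *s C w = C t" by (simp add: tw cross_smult)
    also have "\<dots> = C sp" unfolding t_def by (simp only: cross_add[of r1 r2 sp] C_combination add_0_right)
    finally have "p * C w $ i = p * F i" using sp(2) by (metis vector_smult_component)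
    then show ?thesis using p by simp
  qed
  ultimately show ?thesis unfolding I_iff by blast
qed

text \<open>A syzygy t of degree e3 with C t equal to the gradient splits the sequence: if C s is h
  times the gradient, then s - h t is a combination of r1 and r2. So r1, r2, t form a basis, and
  \<open>0 < e1\<close> gives the positivity demanded of exponents.\<close>

lemma free_if_one_in_I:
  assumes "1 \<in> I" "0 < e1"
  shows "free_surface f"
proof -
  obtain t0 where t0: "t0 \<in> AR f" "\<forall>i. C t0 $ i = 1 * F i" using assms(1) unfolding I_iff by blast
  define t where "t = vcomp e3 t0"
  have t: "t \<in> AR_part f e3" unfolding t_def by (rule vcomp_AR[OF f t0(1)])
  have one: "hom_component 0 1 = (1 :: poly4)" using hom_component_hom_part[OF hom_part_single[of 0 0 1], of 0] by simp
  have Ct: "C t $ i = F i" for i using C_vcomp_gradient[OF t0(2), of 0] one by (simp add: t_def)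
  obtain j where j: "F j \<noteq> 0" using ex_F_nonzero by blast
  define e :: "nat ^ 3" where "e = (\<chi> i. if i = 0 then e1 else if i = 1 then e2 else e3)"
  define \<phi> :: "poly4 ^ 3 \<Rightarrow> poly4 ^ 4" where "\<phi> v = v $ 0 *s r1 + v $ 1 *s r2 + v $ 2 *s t" for v
  have d3: "(1::3) \<noteq> 0" "(2::3) \<noteq> 0" "(2::3) \<noteq> 1" by simp_all
  have \<phi>_AR: "\<phi> v \<in> AR f" for v
    unfolding \<phi>_def by (intro AR_add AR_smult r_AR AR_partD(1)[OF t])
  have C\<phi>: "C (\<phi> v) $ i = v $ 2 * F i" for v i
    unfolding \<phi>_def by (simp add: cross_add cross_smult cross_self Ct)
  have inj: "v = 0" if "\<phi> v = 0" for v
  proof -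
    have "v $ 2 * F j = 0" using C\<phi>[of v j] that cross_smult[of r1 r2 0 0] by simp
    then have 2: "v $ 2 = 0" using j by simp
    then have "v $ 0 *s r1 + v $ 1 *s r2 = 0" using that by (simp add: \<phi>_def)
    then have "v $ 0 = 0 \<and> v $ 1 = 0" by (rule independent_syzygies)
    then show ?thesis using 2 by (simp add: vec_eq_iff all_3_iff)
  qed
  have add: "\<phi> (u + v) = \<phi> u + \<phi> v" for u v by (simp add: \<phi>_def vec_eq_iff algebra_simps)
  have smult: "\<phi> (a *s v) = a *s \<phi> v" for a v by (simp add: \<phi>_def vec_eq_iff algebra_simps)
  have diff: "\<phi> (u - v) = \<phi> u - \<phi> v" for u v by (simp add: \<phi>_def vec_eq_iff algebra_simps)
  have graded: "\<phi> ` {v. \<forall>i. v $ i \<in> shifted_part (e $ i) k} = AR_part f k" for k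
  proof (intro equalityI subsetI)
    fix s assume "s \<in> \<phi> ` {v. \<forall>i. v $ i \<in> shifted_part (e $ i) k}"
    then obtain v where v: "s = \<phi> v" "\<And>i. v $ i \<in> shifted_part (e $ i) k" by blast
    have sh: "p * q \<in> hom_part k" if "p \<in> shifted_part l k" "q \<in> hom_part l" for p q l
      using that hom_part_mult[of p "k - l" q l] by (auto simp: shifted_part_def split: if_splits)
    have "v $ 0 \<in> shifted_part e1 k" "v $ 1 \<in> shifted_part e2 k" "v $ 2 \<in> shifted_part e3 k"
      using v(2)[of 0] v(2)[of 1] v(2)[of 2] d3 by (simp_all add: e_def)
    then have "s $ i \<in> hom_part k" for i unfolding v(1) \<phi>_def
      by (auto intro!: hom_part_add sh r_hom_part AR_partD(2)[OF t])
    then show "s \<in> AR_part f k" using \<phi>_AR v(1) by (simp add: AR_part_def)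
  next
    fix s assume s: "s \<in> AR_part f k"
    obtain h where h: "\<forall>i. C s $ i = h * F i" using cross_eq_mult_gradient AR_partD(1)[OF s] by blast
    have "C (s - h *s t) = 0"
      using cross_add[of r1 r2 "s - h *s t" "h *s t"] h by (simp add: vec_eq_iff cross_smult Ct)
    then obtain a b where ab: "s - h *s t = a *s r1 + b *s r2"
      using combination_if_cross_eq_0 AR_diff[OF AR_partD(1)[OF s] AR_smult[OF AR_partD(1)[OF t]]] by blast
    define pt where "pt l p = (if l \<le> k then hom_component (k - l) p else 0)" for l p
    have mult: "hom_component k (p * q) = pt l p * q" if "q \<in> hom_part l" for p q l
      using hom_component_mult[OF that, of k p] by (simp add: pt_def)
    have "s = a *s r1 + b *s r2 + h *s t" using ab by (simp add: algebra_simps)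
    then have "vcomp k s = vcomp k (a *s r1 + b *s r2 + h *s t)" by (rule arg_cong)
    also have "\<dots> = pt e1 a *s r1 + pt e2 b *s r2 + pt e3 h *s t"
      by (simp add: vec_eq_iff hom_component_add mult[OF r_hom_part(1)] mult[OF r_hom_part(2)] mult[OF AR_partD(2)[OF t]])
    also have "vcomp k s = s"
      using hom_component_hom_part[OF AR_partD(2)[OF s], of k] by (simp add: vec_eq_iff)
    finally have "s = \<phi> (\<chi> i. if i = 0 then pt e1 a else if i = 1 then pt e2 b else pt e3 h)"
      using d3 by (simp add: \<phi>_def)
    moreover have "pt l p \<in> shifted_part l k" for l p
      by (simp add: pt_def shifted_part_def hom_component_in_hom_part)
    then have "(\<chi> i. if i = 0 then pt e1 a else if i = 1 then pt e2 b else pt e3 h) \<in> {v. \<forall>i. v $ i \<in> shifted_part (e $ i) k}"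
      by (simp add: e_def)
    ultimately show "s \<in> \<phi> ` {v. \<forall>i. v $ i \<in> shifted_part (e $ i) k}" by blast
  qed
  have "bij_betw \<phi> UNIV (AR f)"
  proof (rule bij_betw_imageI)
    show "inj \<phi>"
    proof (rule injI)
      fix u v assume "\<phi> u = \<phi> v"
      then have "\<phi> (u - v) = 0" by (simp add: diff)
      then show "u = v" using inj by fastforce
    qed
    show "range \<phi> = AR f"
    proof (intro equalityI subsetI)
      fix s assume s: "s \<in> AR f"
      obtain h where h: "\<forall>i. C s $ i = h * F i" using cross_eq_mult_gradient s by blast
      have "C (s - h *s t) = 0"
        using cross_add[of r1 r2 "s - h *s t" "h *s t"] h by (simp add: vec_eq_iff cross_smult Ct)
      then obtain a b where ab: "s - h *s t = a *s r1 + b *s r2"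
        using combination_if_cross_eq_0 AR_diff[OF s AR_smult[OF AR_partD(1)[OF t]]] by blast
      have "s = a *s r1 + b *s r2 + h *s t" using ab by (simp add: algebra_simps)
      then have "s = \<phi> (\<chi> i. if i = 0 then a else if i = 1 then b else h)"
        using d3 by (simp add: \<phi>_def)
      then show "s \<in> range \<phi>" by blast
    qed (use \<phi>_AR in blast)
  qed
  then have "free_with_exponents f e"
    unfolding free_with_exponents_def using add smult graded by blast
  moreover have "0 < e $ 0" "e $ 0 \<le> e $ 1" "e $ 1 \<le> e $ 2" using assms(2) deg d3 by (simp_all add: e_def)
  ultimately show ?thesis unfolding free_surface_def by blast
qed

end


section \<open>Constant syzygies and cones\<close>

lemma eval4_pdiff:
  "eval4 (pdiff i f) x = (\<Sum>m\<in>keys f. lookup f m *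
     (of_nat (lookup m i) * (x $ i) ^ (lookup m i - 1) *
      (\<Prod>j\<in>UNIV - {i}. (x $ j) ^ lookup m j)))"
proof -
  have "(\<Prod>j\<in>UNIV. (x $ j) ^ lookup (m - single i 1) j) =
      (x $ i) ^ (lookup m i - 1) * (\<Prod>j\<in>UNIV - {i}. (x $ j) ^ lookup m j)" for m
  proof -
    have "(\<Prod>j\<in>UNIV - {i}. (x $ j) ^ lookup (m - single i 1) j) =
        (\<Prod>j\<in>UNIV - {i}. (x $ j) ^ lookup m j)"
      by (rule prod.cong) (auto simp: lookup_minus lookup_single when_def)
    then show ?thesis
      by (subst prod.remove[of UNIV i]) (simp_all add: lookup_minus)
  qed
  then show ?thesis
    by (simp add: pdiff_def eval4_eq_psubst eval.psubst_sum eval.psubst_single ac_simps)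
qed

lemma eval4_line_derivative:
  "((\<lambda>s. eval4 f (s *s p + q)) has_field_derivative
    (\<Sum>i\<in>UNIV. p $ i * eval4 (pdiff i f) (s *s p + q))) (at s)"
proof -
  define x where "x s = s *s p + q" for s
  have lin: "((\<lambda>s. (x s $ i) ^ lookup m i) has_field_derivative
      of_nat (lookup m i) * (x s $ i) ^ (lookup m i - 1) * p $ i) (at s)" for m i
    unfolding x_def by (auto intro!: derivative_eq_intros)
  have prd: "((\<lambda>s. \<Prod>i\<in>UNIV. (x s $ i) ^ lookup m i) has_field_derivative
      (\<Sum>i\<in>UNIV. of_nat (lookup m i) * (x s $ i) ^ (lookup m i - 1) * p $ i *
        (\<Prod>j\<in>UNIV - {i}. (x s $ j) ^ lookup m j))) (at s)" for m
    by (rule has_field_derivative_prod) (rule lin)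
  have "((\<lambda>s. eval4 f (x s)) has_field_derivative
      (\<Sum>m\<in>keys f. lookup f m *
       (\<Sum>i\<in>UNIV. of_nat (lookup m i) * (x s $ i) ^ (lookup m i - 1) * p $ i *
        (\<Prod>j\<in>UNIV - {i}. (x s $ j) ^ lookup m j)))) (at s)"
    unfolding eval4_def by (intro DERIV_sum DERIV_cmult prd)
  also have "(\<Sum>m\<in>keys f. lookup f m *
       (\<Sum>i\<in>UNIV. of_nat (lookup m i) * (x s $ i) ^ (lookup m i - 1) * p $ i *
        (\<Prod>j\<in>UNIV - {i}. (x s $ j) ^ lookup m j))) =
      (\<Sum>i\<in>UNIV. p $ i * eval4 (pdiff i f) (x s))"
    unfolding eval4_pdiff sum_distrib_left by (subst sum.swap) (simp only: ac_simps)
  finally show ?thesis by (simp add: x_def)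
qed

text \<open>A constant syzygy is a direction p in which the derivative of f vanishes, so f is
  constant on all lines parallel to p. If p_j is nonzero, the plane x_j = 0 misses the vertex, and f
  itself is an equation of the base curve.\<close>

lemma cone_if_constant_syzygy:
  assumes f: "f \<in> hom_part d" "f \<noteq> 0" "1 \<le> d" and r: "r \<in> AR_part f 0" "r \<noteq> 0"
  shows "cone_over_plane_curve f"
proof -
  have "\<exists>c. r $ i = single 0 c" for i
    using hom_part_0E[OF AR_partD(2)[OF r(1)]] by metis
  then obtain c where c: "\<And>i. r $ i = single 0 (c i)" by metis
  define p :: "complex ^ 4" where "p = (\<chi> i. c i)"
  obtain j where "r $ j \<noteq> 0" using r(2) by (auto simp: vec_eq_iff)
  then have "c j \<noteq> 0" unfolding c by (metis single_zero)
  then have j: "p $ j \<noteq> 0" by (simp add: p_def)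
  have const: "eval4 f (s *s p + q) = eval4 f q" for s q
  proof -
    have zero: "(\<Sum>i\<in>UNIV. p $ i * eval4 (pdiff i f) x) = 0" for x
    proof -
      have "eval4 (\<Sum>i\<in>UNIV. r $ i * pdiff i f) x = 0"
        using AR_partD(1)[OF r(1)] by (simp add: AR_iff eval4_def)
      then show ?thesis
        by (simp add: eval4_eq_psubst eval.psubst_sum eval.psubst_mult c eval.psubst_const p_def)
    qed
    have "((\<lambda>s. eval4 f (s *s p + q)) has_field_derivative 0) (at s)" for s
      using eval4_line_derivative[of f p q s] by (simp only: zero)
    then obtain e where "\<And>s. eval4 f (s *s p + q) = e"
      using has_field_derivative_zero_constant[of UNIV "\<lambda>s. eval4 f (s *s p + q)"] by auto
    from this[of s] this[of 0] show ?thesis by simp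
  qed
  have ax: "(\<Sum>i\<in>UNIV. axis j (1::complex) $ i * q $ i) = q $ j" for q :: "complex ^ 4"
  proof -
    have "(\<Sum>i\<in>UNIV. axis j (1::complex) $ i * q $ i) = (\<Sum>i\<in>UNIV. if i = j then q $ j else 0)"
      by (rule sum.cong) (auto simp: axis_def)
    then show ?thesis by simp
  qed
  have decomp: "\<exists>s q. v = s *s p + q \<and> q $ j = 0" for v :: "complex ^ 4"
  proof (intro exI conjI)
    show "v = (v $ j / p $ j) *s p + (v - (v $ j / p $ j) *s p)" by simp
    show "(v - (v $ j / p $ j) *s p) $ j = 0" using j by simp
  qed
  obtain v where v: "eval4 f v \<noteq> 0" using ex_eval4_nonzero[OF f(2)] by blast
  obtain s q where sq: "v = s *s p + q" "q $ j = 0" using decomp by blast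
  show ?thesis
    unfolding cone_over_plane_curve_def
  proof (intro exI conjI)
    show "(\<Sum>i\<in>UNIV. axis j (1::complex) $ i * p $ i) \<noteq> 0" unfolding ax by (rule j)
    show "(\<Sum>i\<in>UNIV. axis j (1::complex) $ i * q $ i) = 0" unfolding ax by (rule sq(2))
    show "eval4 f q \<noteq> 0" using v unfolding sq(1) const .
    show "{v. eval4 f v = 0} = {s *s p + q |s q. (\<Sum>i\<in>UNIV. axis j 1 $ i * q $ i) = 0 \<and> eval4 f q = 0}"
      unfolding ax
    proof (intro equalityI subsetI)
      fix v assume v: "v \<in> {v. eval4 f v = 0}"
      obtain s q where "v = s *s p + q" "q $ j = 0" using decomp by blast
      then show "v \<in> {s *s p + q |s q. q $ j = 0 \<and> eval4 f q = 0}" using v const by auto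
    qed (auto simp: const)
  qed (use f in auto)
qed


section \<open>The degree of the singular subscheme\<close>

text \<open>Dimension one excludes chains of length two, so the Hilbert polynomial has degree at
  most one; it is unique because two polynomials that agree at all large integers are equal.\<close>

lemma deg_Sigma_asymptotics:
  assumes "f \<in> hom_part d" "has_proj_dim (jacobian_ideal f) 1"
  shows "\<exists>b N. \<forall>m\<ge>N. of_nat (hilbert_function (jacobian_ideal f) m) = deg_Sigma f * of_nat m + b"
proof -
  have "m < 2" if "has_chain (jacobian_ideal f) m" for m
    using assms(2) that unfolding has_proj_dim_def by force
  then obtain P :: "rat poly" where P: "\<forall>i\<ge>2. coeff P i = 0"
      "\<forall>\<^sub>F k in sequentially. of_nat (hilbert_function (jacobian_ideal f) k) = poly P (of_nat k)"
    using hilbert_function_eventually_poly[OF hom_ideal_jacobian[OF assms(1)], of 2] by blast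
  have "hilbert_polynomial (jacobian_ideal f) = P"
    unfolding hilbert_polynomial_def
  proof (rule the_equality)
    show "\<forall>\<^sub>F k in sequentially. poly P (of_nat k) = of_nat (hilbert_function (jacobian_ideal f) k)"
      using P(2) by eventually_elim simp
    fix Q :: "rat poly"
    assume "\<forall>\<^sub>F k in sequentially. poly Q (of_nat k) = of_nat (hilbert_function (jacobian_ideal f) k)"
    then have "\<forall>\<^sub>F k in sequentially. poly Q (of_nat k) = poly P (of_nat k)"
      using P(2) by eventually_elim simp
    then show "Q = P" by (rule poly_eqI_sequentially)
  qed
  then have "deg_Sigma f = coeff P 1" by (simp add: deg_Sigma_def)
  moreover have "P = [:coeff P 0, coeff P 1:]"
  proof (rule poly_eqI)
    fix i show "coeff P i = coeff [:coeff P 0, coeff P 1:] i"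
      using P(1) by (cases i) (auto simp: coeff_pCons numeral_2_eq_2 split: nat.split)
  qed
  then have "poly P x = coeff P 1 * x + coeff P 0" for x
    by (metis add.commute mult.commute mult_zero_right add_0_right poly_0 poly_pCons)
  ultimately show ?thesis using P(2) unfolding eventually_sequentially by metis
qed

text \<open>The Hilbert polynomial of S on the rationals, where shifts may be subtracted without
  truncation.\<close>

definition hS :: "rat \<Rightarrow> rat" where
  "hS x = (x + 1) * (x + 2) * (x + 3) / 6"

lemma dim_hom_part_hS: "of_nat (poly4.dim (hom_part k)) = hS (of_nat k)"
  by (simp add: hS_def dim_hom_part_rat)

text \<open>The Hilbert polynomial of S/J at x + r + (p + q + r) for a free surface with exponents
  p, q, r. The cubic and quadratic terms cancel, and the slope is half of (p + q + r)^2 + p^2 + q^2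
  + r^2, that is s1^2 - s2.\<close>

lemma hS_free_resolution:
  "hS (x + r + (p + q + r)) + hS (x + r - p) + hS (x + r - q) + hS x - 4 * hS (x + r) =
   hS (r + (p + q + r)) + hS (r - p) + hS (r - q) + hS 0 - 4 * hS r +
   ((p + q + r)\<^sup>2 - (p * q + p * r + q * r)) * x"
  by (simp add: hS_def field_simps power2_eq_square)

context tame_pair
begin

definition s :: rat where
  "s = (of_nat e1 + of_nat e2 + of_nat e3)\<^sup>2 -
     (of_nat e1 * of_nat e2 + of_nat e1 * of_nat e3 + of_nat e2 * of_nat e3)"

text \<open>The slopes of S/J and S/I add up to the slope s of the free case; c collects the
  constant terms.\<close>

lemma hilbert_function_I:
  assumes "\<forall>m\<ge>N. of_nat (hilbert_function (jacobian_ideal f) m) = a * of_nat m + b"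
  shows "\<exists>c. \<forall>k\<ge>N. of_nat (hilbert_function I k) = (s - a) * of_nat k + c"
proof -
  define p q r :: rat where "p = of_nat e1" and "q = of_nat e2" and "r = of_nat e3"
  define c where "c = hS (r + (p + q + r)) + hS (r - p) + hS (r - q) + hS 0 - 4 * hS r - a * (r + (p + q + r)) - b"
  have "of_nat (hilbert_function I k) = (s - a) * of_nat k + c" if "k \<ge> N" for k
  proof -
    define x :: rat where "x = of_nat k"
    have sub: "of_nat (k + e3 - e1) = x + r - p" "of_nat (k + e3 - e2) = x + r - q"
      using deg by (simp_all add: of_nat_diff x_def p_def q_def r_def)
    have sub': "of_nat (k + e3 + (e1 + e2 + e3)) = x + r + (p + q + r)" "of_nat (k + e3) = x + r"
      by (simp_all add: x_def p_def q_def r_def)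
    have J: "of_nat (hilbert_function (jacobian_ideal f) (k + e3 + (e1 + e2 + e3))) = a * (x + r + (p + q + r)) + b"
      using assms[rule_format, of "k + e3 + (e1 + e2 + e3)"] that by (simp only: sub')
    from arg_cong[OF hilbert_function_jacobian[of k], of "of_nat :: nat \<Rightarrow> rat"]
    have "a * (x + r + (p + q + r)) + b + of_nat (hilbert_function I k) + 4 * hS (x + r) =
        hS (x + r + (p + q + r)) + hS (x + r - p) + hS (x + r - q) + hS x"
      by (simp only: of_nat_add[of "_ + _" "_ * _"] of_nat_add[of "hilbert_function _ _"]
          of_nat_add[of "poly4.dim _"] of_nat_add[of "poly4.dim _ + poly4.dim _"]
          of_nat_add[of "poly4.dim _ + poly4.dim _ + poly4.dim _"] of_nat_mult of_nat_numeral
          dim_hom_part_hS J sub sub' x_def[symmetric])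
    moreover have s: "s = (p + q + r)\<^sup>2 - (p * q + p * r + q * r)" by (simp add: s_def p_def q_def r_def)
    have "(s - a) * x = ((p + q + r)\<^sup>2 - (p * q + p * r + q * r)) * x - a * x" by (simp only: s left_diff_distrib)
    moreover have "a * (x + r + (p + q + r)) = a * x + a * (r + (p + q + r))" by (simp add: algebra_simps)
    ultimately show ?thesis
      using hS_free_resolution[of x r p q] unfolding x_def[symmetric] c_def by linarith
  qed
  then show ?thesis by blast
qed

text \<open>A negative slope would eventually make the Hilbert function of S/I negative.\<close>

lemma degree_le:
  assumes "\<forall>m\<ge>N. of_nat (hilbert_function (jacobian_ideal f) m) = a * of_nat m + b"
  shows "a \<le> s"
proof (rule ccontr)
  assume "\<not> a \<le> s"
  then have pos: "a - s > 0" by simp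
  obtain c where c: "\<And>k. k \<ge> N \<Longrightarrow> of_nat (hilbert_function I k) = (s - a) * of_nat k + c"
    using hilbert_function_I[OF assms] by blast
  obtain k where k: "c / (a - s) < of_nat k" using reals_Archimedean2[of "c / (a - s)"] by blast
  define m where "m = max N k"
  have "c / (a - s) < of_nat m" using k by (rule less_le_trans) (simp add: m_def)
  then have "c < (a - s) * of_nat m" using pos by (simp add: field_simps)
  then have "of_nat (hilbert_function I m) < (0::rat)" using c[of m] by (simp add: m_def algebra_simps)
  then show False by simp
qed

text \<open>With slope 0 the Hilbert function of S/I is eventually constant, hence at most m in some
  degree m, which is what the construction of a regular pair requires.\<close>

lemma free_if_degree_eq:
  assumes "\<forall>m\<ge>N. of_nat (hilbert_function (jacobian_ideal f) m) = a * of_nat m + b" "a = s" "0 < e1"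
  shows "free_surface f"
proof -
  obtain c where c: "\<And>k. k \<ge> N \<Longrightarrow> of_nat (hilbert_function I k) = (s - a) * of_nat k + c"
    using hilbert_function_I[OF assms(1)] by blast
  obtain k where k: "c < of_nat k" using reals_Archimedean2[of c] by blast
  define m where "m = max N k"
  have "of_nat (hilbert_function I m) < (of_nat k :: rat)" using c[of m] k assms(2) by (simp add: m_def)
  then have "hilbert_function I m \<le> m" by (simp add: m_def)
  then obtain p q where "regular_pair I p q" using ex_regular_pair[OF hom_ideal_I] by blast
  then show ?thesis using one_in_I_if_regular_pair free_if_one_in_I[OF _ assms(3)] by blast
qed

end

section \<open>Exponents and degrees of free surfaces\<close>

lemma UNIV_3_eq: "(UNIV :: 3 set) = {0, 1, 2}"
proof -
  have "\<forall>i::3. i \<in> {0, 1, 2}" unfolding all_3_iff by simp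
  then show ?thesis by blast
qed

lemma shifted_part_subset: "shifted_part d k \<subseteq> hom_part (k - d)"
  by (simp add: shifted_part_def)

lemma subspace_shifted_part: "poly4.subspace (shifted_part d k)"
  by (simp add: shifted_part_def subspace_hom_part poly4.subspace_single_0)

locale free_module_basis =
  fixes f :: poly4 and e :: "nat ^ 3" and \<phi> :: "poly4 ^ 3 \<Rightarrow> poly4 ^ 4"
  assumes ord: "e $ 0 \<le> e $ 1" "e $ 1 \<le> e $ 2" and bij: "bij_betw \<phi> UNIV (AR f)"
    and add: "\<phi> (u + v) = \<phi> u + \<phi> v" and smult: "\<phi> (a *s v) = a *s \<phi> v"
    and graded: "\<phi> ` {v. \<forall>i. v $ i \<in> shifted_part (e $ i) k} = AR_part f k"
begin

lemma phi_0: "\<phi> 0 = 0"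
  using add[of 0 0] by simp

lemma phi_eq_0: "\<phi> v = 0 \<Longrightarrow> v = 0"
  using bij phi_0 unfolding bij_betw_def inj_def by metis

lemma dim_AR_part_free:
  assumes "e $ 0 + e $ 1 + e $ 2 \<le> k"
  shows "pvec.dim (AR_part f k) = poly4.dim (hom_part (k - e $ 0)) + poly4.dim (hom_part (k - e $ 1)) +
    poly4.dim (hom_part (k - e $ 2))"
proof -
  have lin: "Vector_Spaces.linear vscale vscale \<phi>"
    by (simp add: linear_vscale_vscale_iff add smult vscale_def)
  define X :: "(poly4 ^ 3) set" where "X = vprod (\<lambda>i. shifted_part (e $ i) k)"
  have W: "finite (hom_basis (k - e $ i))" "shifted_part (e $ i) k \<subseteq> poly4.span (hom_basis (k - e $ i))" for i :: 3
    using shifted_part_subset by (auto simp: finite_hom_basis span_hom_basis)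
  have "pvec.dim (\<phi> ` X) = pvec.dim X"
  proof (rule linear.dim_inj_image[OF lin])
    show "pvec.subspace X" unfolding X_def by (rule subspace_vprod[OF subspace_shifted_part])
    show "finite (\<Union>i::3. axis i ` hom_basis (k - e $ i))"
      "X \<subseteq> pvec.span (\<Union>i::3. axis i ` hom_basis (k - e $ i))"
      unfolding X_def by (rule vprod_finite_span[OF W])+
  qed (rule phi_eq_0)
  moreover have "\<phi> ` X = AR_part f k" using graded[of k] by (simp add: X_def vprod_def)
  moreover have "pvec.dim X = (\<Sum>i\<in>UNIV. poly4.dim (shifted_part (e $ i) k))"
    unfolding X_def by (rule dim_vprod[OF subspace_shifted_part W])
  moreover have "(\<Sum>i\<in>UNIV. poly4.dim (shifted_part (e $ i) k)) = poly4.dim (hom_part (k - e $ 0)) +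
      poly4.dim (hom_part (k - e $ 1)) + poly4.dim (hom_part (k - e $ 2))"
    using assms unfolding UNIV_3_eq by (simp add: shifted_part_def)
  ultimately show ?thesis by simp
qed

lemma basis_AR_part: "\<phi> (axis i 1) \<in> AR_part f (e $ i)"
proof -
  have "(1::poly4) \<in> hom_part 0" using hom_part_single[of 0 0 1] by simp
  then have "axis i 1 \<in> {v. \<forall>j. v $ j \<in> shifted_part (e $ j) (e $ i)}"
    by (auto simp: axis_def shifted_part_def)
  then show ?thesis using graded by blast
qed

lemma basis_nonzero: "\<phi> (axis i 1) \<noteq> 0"
proof
  assume "\<phi> (axis i 1) = 0"
  then have "axis i (1::poly4) = 0" by (rule phi_eq_0)
  then have "axis i (1::poly4) $ i = 0" by simp
  then show False by simp
qed

lemma AR_partE: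
  assumes "t \<in> AR_part f k"
  obtains v where "t = \<phi> v" "\<And>i. v $ i \<in> shifted_part (e $ i) k"
  using assms graded[of k] by blast

text \<open>Below degree \<open>e $ 0\<close> there are no nonzero syzygies. The first two basis
  elements cannot both be multiples of r1, so one of them bounds e2 from above. If e2 were smaller
  than \<open>e $ 1\<close>, both r1 and r2 would be multiples of the first basis element; the
  factor for r1 is a nonzero constant, so r2 would be a multiple of r1.\<close>

lemma exponents_eq:
  assumes "minimal_syzygies f e1 e2 r1 r2"
  shows "e $ 0 = e1" "e $ 1 = e2"
proof -
  note m = assms[unfolded minimal_syzygies_def]
  have z: "p = 0" if "p \<in> shifted_part l k" "k < l" for p l k using that by (simp add: shifted_part_def)
  obtain w where w: "r1 = \<phi> w" "\<And>i. w $ i \<in> shifted_part (e $ i) e1" using AR_partE m by metis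
  obtain u where u: "r2 = \<phi> u" "\<And>i. u $ i \<in> shifted_part (e $ i) e2" using AR_partE m by metis
  have "e1 \<le> e $ 0" using m basis_AR_part[of 0] basis_nonzero[of 0] by blast
  moreover have "\<not> e1 < e $ 0"
  proof
    assume lt: "e1 < e $ 0"
    then have "w = 0" using z[OF w(2)[of 0]] z[OF w(2)[of 1]] z[OF w(2)[of 2]] ord by (simp add: vec_eq_iff all_3_iff)
    then show False using w(1) phi_0 m by simp
  qed
  ultimately show e0: "e $ 0 = e1" by simp
  have "e2 \<le> e $ 1"
  proof (cases "\<phi> (axis 0 1) \<in> range (\<lambda>a. a *s r1)")
    case False
    then have "e2 \<le> e $ 0" using m basis_AR_part[of 0] by blast
    then show ?thesis using ord by simp
  next
    case True
    then obtain a where a: "\<phi> (axis 0 1) = a *s r1" by blast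
    have "\<phi> (axis 1 1) \<notin> range (\<lambda>a. a *s r1)"
    proof
      assume "\<phi> (axis 1 1) \<in> range (\<lambda>a. a *s r1)"
      then obtain b where b: "\<phi> (axis 1 1) = b *s r1" by blast
      \<comment> \<open>If two basis elements are a r1 and b r1, they satisfy a relation with
        coefficients b and -a, contrary to independence.\<close>
      have "\<phi> (b *s axis 0 1 + (- a) *s axis 1 1) = b *s (a *s r1) + (- a) *s (b *s r1)"
        by (simp only: add smult a b)
      also have "\<dots> = 0" by (simp add: vec_eq_iff)
      finally have "b *s axis 0 1 + (- a) *s axis (1::3) 1 = (0 :: poly4 ^ 3)" by (rule phi_eq_0)
      then have "(b *s axis 0 1 + (- a) *s axis (1::3) 1) $ 0 = (0 :: poly4 ^ 3) $ 0" by (rule arg_cong)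
      then have "b = 0" by (simp add: axis_def)
      then show False using b basis_nonzero[of 1] by simp
    qed
    then show ?thesis using m basis_AR_part[of 1] by blast
  qed
  moreover have "\<not> e2 < e $ 1"
  proof
    assume lt: "e2 < e $ 1"
    have e12: "e1 \<le> e2" using m by blast
    have "v = v $ 0 *s axis 0 1" if "v $ 1 = 0" "v $ 2 = 0" for v :: "poly4 ^ 3"
      using that by (simp add: vec_eq_iff all_3_iff axis_def)
    then have "w = w $ 0 *s axis 0 1" "u = u $ 0 *s axis 0 1"
      using z[OF w(2)[of 1]] z[OF w(2)[of 2]] z[OF u(2)[of 1]] z[OF u(2)[of 2]] lt e12 ord by auto
    then have wu: "r1 = w $ 0 *s \<phi> (axis 0 1)" "r2 = u $ 0 *s \<phi> (axis 0 1)"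
      using w(1) u(1) smult by metis+
    have "w $ 0 \<in> hom_part 0" using w(2)[of 0] e0 by (simp add: shifted_part_def)
    then obtain c where c: "w $ 0 = single 0 c" by (rule hom_part_0E)
    have "c \<noteq> 0" using wu(1) c m by auto
    then have "single 0 (inverse c) * w $ 0 = 1" by (simp add: c mult_single)
    then have "r2 = (u $ 0 * single 0 (inverse c)) *s r1"
      by (simp add: wu vec_eq_iff mult.assoc)
    then show False using m by blast
  qed
  ultimately show "e $ 1 = e2" by simp
qed

text \<open>That the exponents add up to d - 1 is extracted from the Hilbert function of S/J being
  eventually linear. The resolution is evaluated at three consecutive degrees: comparing the two
  first differences yields D = p + q + r, and one of them then yields the slope a.\<close>

lemma free_degree:
  fixes a b :: rat
  assumes f: "f \<in> hom_part d" and J: "\<forall>m\<ge>N. of_nat (hilbert_function (jacobian_ideal f) m) = a * of_nat m + b"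
  shows "e $ 0 + e $ 1 + e $ 2 = d - 1"
    and "a = (of_nat (e $ 0) + of_nat (e $ 1) + of_nat (e $ 2))\<^sup>2 -
      (of_nat (e $ 0) * of_nat (e $ 1) + of_nat (e $ 0) * of_nat (e $ 2) + of_nat (e $ 1) * of_nat (e $ 2))"
proof -
  define D p q r :: rat where "D = of_nat (d - 1)" and "p = of_nat (e $ 0)" and "q = of_nat (e $ 1)"
    and "r = of_nat (e $ 2)"
  define K where "K = N + (e $ 0 + e $ 1 + e $ 2)"
  have eq: "a * (x + D) + b + 4 * hS x = hS (x + D) + hS (x - p) + hS (x - q) + hS (x - r)"
    if "k \<ge> K" "x = of_nat k" for k x
  proof -
    have "hilbert_function (jacobian_ideal f) (k + (d - 1)) + 4 * poly4.dim (hom_part k) =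
        poly4.dim (hom_part (k + (d - 1))) + (poly4.dim (hom_part (k - e $ 0)) +
        poly4.dim (hom_part (k - e $ 1)) + poly4.dim (hom_part (k - e $ 2)))"
      using dim_AR_part[OF f, of k] dim_AR_part_free[of k] that(1)
        hilbert_function_plus_dim[of "jacobian_ideal f" "k + (d - 1)"]
      unfolding K_def by linarith
    from arg_cong[OF this, of "of_nat :: nat \<Rightarrow> rat"]
    have "of_nat (hilbert_function (jacobian_ideal f) (k + (d - 1))) + 4 * hS (of_nat k) =
        hS (of_nat (k + (d - 1))) + (hS (of_nat (k - e $ 0)) + hS (of_nat (k - e $ 1)) + hS (of_nat (k - e $ 2)))"
      by (simp only: of_nat_add[of "poly4.dim _"] of_nat_add[of "poly4.dim _ + poly4.dim _"]
          of_nat_add[of "hilbert_function _ _"] of_nat_mult of_nat_numeral dim_hom_part_hS)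
    moreover have "of_nat (k - e $ 0) = x - p" "of_nat (k - e $ 1) = x - q" "of_nat (k - e $ 2) = x - r"
      "of_nat (k + (d - 1)) = x + D"
      using that by (simp_all add: K_def of_nat_diff p_def q_def r_def D_def)
    moreover have "of_nat (hilbert_function (jacobian_ideal f) (k + (d - 1))) = a * of_nat (k + (d - 1)) + b"
      using J[rule_format, of "k + (d - 1)"] that by (simp add: K_def)
    ultimately show ?thesis using that(2) by simp
  qed
  define x :: rat where "x = of_nat K"
  have eqs: "a * (x + D) + b + 4 * hS x = hS (x + D) + hS (x - p) + hS (x - q) + hS (x - r)"
    "a * (x + D) + a + b + 4 * hS (x + 1) = hS (x + D + 1) + hS (x - p + 1) + hS (x - q + 1) + hS (x - r + 1)"
    "a * (x + D) + 2 * a + b + 4 * hS (x + 1 + 1) = hS (x + D + 1 + 1) + hS (x - p + 1 + 1) + hS (x - q + 1 + 1) + hS (x - r + 1 + 1)"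
    using eq[of K x] eq[of "K + 1" "x + 1"] eq[of "K + 2" "x + 2"] by (simp_all add: x_def algebra_simps)
  have h: "hS (y + 1) = hS y + (y + 2) * (y + 3) / 2"
    "hS (y + 1 + 1) = hS y + (y + 2) * (y + 3) / 2 + (y + 3) * (y + 4) / 2" for y
    by (simp_all add: hS_def field_simps)
  \<comment> \<open>Values and quadratic increments of \<open>hS\<close> are replaced by variables,
    so only linear identities remain; dividing the increments by 2 matches the form in
    \<open>h\<close>.\<close>
  have first_difference: "a + 2 * U = (V1 + V2 + V3 + V4) / 2"
    if "A + b + 4 * H = H1 + H2 + H3 + H4"
      "A + a + b + 4 * (H + U / 2) = H1 + V1 / 2 + (H2 + V2 / 2) + (H3 + V3 / 2) + (H4 + V4 / 2)"
    for A H U H1 H2 H3 H4 V1 V2 V3 V4 :: rat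
    using that by (simp add: field_simps)
  have second_difference: "a + 2 * U' = (W1 + W2 + W3 + W4) / 2"
    if "A + b + 4 * H = H1 + H2 + H3 + H4"
      "A + 2 * a + b + 4 * (H + U / 2 + U' / 2) = H1 + V1 / 2 + W1 / 2 + (H2 + V2 / 2 + W2 / 2) +
       (H3 + V3 / 2 + W3 / 2) + (H4 + V4 / 2 + W4 / 2)"
      "a + 2 * U = (V1 + V2 + V3 + V4) / 2"
    for A H U U' H1 H2 H3 H4 V1 V2 V3 V4 W1 W2 W3 W4 :: rat
    using that by (simp add: field_simps)
  have first: "a + 2 * ((x + 2) * (x + 3)) = ((x + D + 2) * (x + D + 3) + (x - p + 2) * (x - p + 3) +
      (x - q + 2) * (x - q + 3) + (x - r + 2) * (x - r + 3)) / 2"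
    using first_difference[OF eqs(1) eqs(2)[unfolded h]] .
  have second: "a + 2 * ((x + 3) * (x + 4)) = ((x + D + 3) * (x + D + 4) + (x - p + 3) * (x - p + 4) +
      (x - q + 3) * (x - q + 4) + (x - r + 3) * (x - r + 4)) / 2"
    using second_difference[OF eqs(1) eqs(3)[unfolded h(2)] first] .
  from first second have D: "D = p + q + r" by (simp add: field_simps)
  then have "of_nat (d - 1) = (of_nat (e $ 0 + e $ 1 + e $ 2) :: rat)" by (simp add: D_def p_def q_def r_def)
  then show "e $ 0 + e $ 1 + e $ 2 = d - 1" using of_nat_eq_iff by metis
  show "a = (of_nat (e $ 0) + of_nat (e $ 1) + of_nat (e $ 2))\<^sup>2 -
      (of_nat (e $ 0) * of_nat (e $ 1) + of_nat (e $ 0) * of_nat (e $ 2) + of_nat (e $ 1) * of_nat (e $ 2))"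
    using first unfolding D p_def[symmetric] q_def[symmetric] r_def[symmetric]
    by (simp add: field_simps power2_eq_square)
qed

end

section \<open>The degree bound and the case of equality\<close>

lemma tame_surface_degree:
  assumes "f \<in> tame_surfaces d e1 e2" and d: "d - 1 = e1 + e2 + e3" "e2 \<le> e3" "1 \<le> d"
  defines "s \<equiv> (of_nat e1 + of_nat e2 + of_nat e3)\<^sup>2 -
     (of_nat e1 * of_nat e2 + of_nat e1 * of_nat e3 + of_nat e2 * of_nat e3) :: rat"
  shows "deg_Sigma f \<le> s" and "deg_Sigma f = s \<longleftrightarrow> free_surface f"
proof -
  have surf: "f \<in> hom_part d" "\<not> cone_over_plane_curve f" "has_proj_dim (jacobian_ideal f) 1"
    using assms(1) by (simp_all add: tame_surfaces_def)
  obtain r1 r2 where r: "minimal_syzygies f e1 e2 r1 r2" "tame_wrt f r1 r2"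
    using assms(1) unfolding tame_surfaces_def by blast
  let ?a = "deg_Sigma f"
  obtain b N where J: "\<forall>m\<ge>N. of_nat (hilbert_function (jacobian_ideal f) m) = ?a * of_nat m + b"
    using deg_Sigma_asymptotics[OF surf(1,3)] by blast
  \<comment> \<open>For n \<ge> 1 with n \<ge> 2 |a| + |b|, the value 2 a n + b of the Hilbert
    function at 2n is at most n^2.\<close>
  obtain k where k: "2 * \<bar>?a\<bar> + \<bar>b\<bar> < of_nat k" using reals_Archimedean2 by blast
  define n where "n = Suc (max N k)"
  have "of_nat (hilbert_function (jacobian_ideal f) (2 * n)) < (of_nat ((n + 1)\<^sup>2) :: rat)"
  proof -
    define x :: rat where "x = of_nat n"
    have x: "1 \<le> x" "2 * \<bar>?a\<bar> + \<bar>b\<bar> \<le> x" using k by (auto simp: x_def n_def)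
    have "of_nat (hilbert_function (jacobian_ideal f) (2 * n)) = 2 * ?a * x + b"
      using J[rule_format, of "2 * n"] by (simp add: x_def n_def)
    also have "\<dots> \<le> 2 * \<bar>?a\<bar> * x + \<bar>b\<bar> * x"
    proof (rule add_mono)
      show "2 * ?a * x \<le> 2 * \<bar>?a\<bar> * x" using x(1) by (intro mult_right_mono) auto
      have "b \<le> \<bar>b\<bar> * 1" by simp
      also have "\<dots> \<le> \<bar>b\<bar> * x" using x(1) by (intro mult_left_mono) auto
      finally show "b \<le> \<bar>b\<bar> * x" .
    qed
    also have "\<dots> = (2 * \<bar>?a\<bar> + \<bar>b\<bar>) * x" by (simp add: distrib_right)
    also have "\<dots> \<le> x * x" using x by (intro mult_right_mono) auto
    also have "\<dots> < (x + 1)\<^sup>2" using x(1) by (simp add: power2_eq_square algebra_simps)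
    finally show ?thesis by (simp add: x_def add.commute)
  qed
  then have growth: "hilbert_function (jacobian_ideal f) (2 * n) < (n + 1)\<^sup>2" by (simp only: of_nat_less_iff)
  interpret tame_pair f d e1 e2 e3 r1 r2 n
    by unfold_locales (use surf(1) d r growth in \<open>auto simp: minimal_syzygies_def\<close>)
  have s_eq: "s = tame_pair.s e1 e2 e3" unfolding assms(5) s_def ..
  have e1: "0 < e1"
  proof (rule ccontr)
    assume "\<not> 0 < e1"
    then have "r1 \<in> AR_part f 0" "r1 \<noteq> 0" using r(1) by (simp_all add: minimal_syzygies_def)
    moreover have "f \<noteq> 0" using ex_F_nonzero by (auto simp: pdiff_def)
    ultimately show False using cone_if_constant_syzygy[OF surf(1) _ d(3)] surf(2) by blast
  qed
  show "?a \<le> s" unfolding s_eq by (rule degree_le[OF J])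
  show "?a = s \<longleftrightarrow> free_surface f"
  proof
    assume "?a = s"
    then show "free_surface f" unfolding s_eq by (rule free_if_degree_eq[OF J _ e1])
  next
    assume "free_surface f"
    then obtain e where e: "e $ 0 \<le> e $ 1" "e $ 1 \<le> e $ 2" "free_with_exponents f e"
      unfolding free_surface_def by blast
    then obtain \<phi> :: "poly4 ^ 3 \<Rightarrow> poly4 ^ 4" where "bij_betw \<phi> UNIV (AR f)"
        "\<And>u v. \<phi> (u + v) = \<phi> u + \<phi> v" "\<And>a v. \<phi> (a *s v) = a *s \<phi> v"
        "\<And>k. \<phi> ` {v. \<forall>i. v $ i \<in> shifted_part (e $ i) k} = AR_part f k"
      unfolding free_with_exponents_def by blast
    with e interpret free_module_basis f e \<phi> by unfold_locales
    note ex = exponents_eq[OF r(1)] and fd = free_degree[OF surf(1) J]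
    \<comment> \<open>Two exponents are known from minimality; the third follows from their sum d -
      1.\<close>
    have "e $ 2 = e3" using fd(1) d(1) ex by simp
    then show "?a = s" using fd(2) ex by (simp add: assms(5))
  qed
qed

theorem theorem1p3:
  fixes d e1 e2 :: nat and e3 s1 s2 :: int and f :: poly4
  assumes "f \<in> tame_surfaces d e1 e2"
    and "int e1 + 2 * int e2 \<le> int d - 1"
    and "e3 = int d - 1 - int e1 - int e2"
    and "s1 = int e1 + int e2 + e3"
    and "s2 = int e1 * int e2 + int e1 * e3 + int e2 * e3"
  shows "deg_Sigma f \<le> of_int (s1\<^sup>2 - s2) \<and>
    (deg_Sigma f = of_int (s1\<^sup>2 - s2) \<longleftrightarrow> free_surface f) \<and>
    (free_surface f \<longrightarrow> (\<forall>g \<in> tame_surfaces d e1 e2. deg_Sigma g \<le> deg_Sigma f))"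
proof -
  define e where "e = d - 1 - e1 - e2"
  \<comment> \<open>The hypothesis on the degrees forces d \<ge> 1 and makes e3 a natural number
    that is at least e2.\<close>
  have d: "d - 1 = e1 + e2 + e" "e2 \<le> e" "1 \<le> d" using assms(2) by (auto simp: e_def)
  have e: "e3 = int e" using assms(2,3) by (simp add: e_def of_nat_diff)
  have s: "(of_int (s1\<^sup>2 - s2) :: rat) = (of_nat e1 + of_nat e2 + of_nat e)\<^sup>2 -
      (of_nat e1 * of_nat e2 + of_nat e1 * of_nat e + of_nat e2 * of_nat e)"
    by (simp add: assms(4,5) e)
  note deg = tame_surface_degree[OF _ d, folded s]
  show ?thesis using deg[OF assms(1)] deg(1) by metis
qed

end
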